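(* Let $t>0$, let $d\ge1$ and $l\ge1$ be integers, $m\in\{0,1\}$, $n\ge1$ an integer, $v_0=\frac n2$, $v_1=n+1$, and suppose $v_m>\frac d2-1$. Then, given $N(t)=n$, for $x\in\mathbb{R}$, $$P\left\{X_m(\mathcal{R}_l^d(t))\in dx\,|\,N(t)=n\right\}=\frac{dx}{B\left(\frac d2,v_m-\frac d2+1\right)}\frac{1}{\left(\Gamma(\frac d2)2^{\frac d2-1}\right)^l}\int_{(0,\infty)^l}\left(\prod_{j=1}^{l}\frac{t_j^{d-1}e^{-\frac{t_j^2}{2t_{j+1}}}}{t_{j+1}^{\frac d2}}\right)\left(\int_0^1w^{\frac d2-1}(1-w)^{v_m-\frac d2}\frac{e^{-\frac{x^2}{2c^2t_1w}}}{\sqrt{2\pi t_1w}\,c}\,dw\right)dt_1\cdots dt_l,$$ where $t_{l+1}=t$.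
   Context: Fix $c>0$, $\lambda>0$. For $m\in\{0,1\}$ let $X_m(s)=c\sum_{j=1}^{N(s)+1}(s_j-s_{j-1})\cos\theta_j$, where $N$ is a homogeneous Poisson process of rate $\lambda$ with event times $s_1<s_2<\cdots$, $s_0=0$, $s_{N(s)+1}=s$, and the $\theta_j$ are i.i.d. (independent of $N$) with density $\frac{\Gamma(m+1)}{\sqrt\pi\,\Gamma(m+\frac12)}\sin^{2m}\theta$ on $(0,\pi)$. For $n\ge1$ let $p_n^m(x,s)$ be the density of $X_m(s)$ given $N(s)=n$; explicitly $p_n^m(x,s)=\frac{\Gamma(v_m)\Gamma(v_m+1)}{2\pi\Gamma(2v_m)}\left(\frac{2}{cs}\right)^{2v_m}(c^2s^2-x^2)^{v_m-\frac12}$ for $|x|<cs$ and $0$ otherwise. A Bessel process $R^d(t)=\sqrt{\sum_{i=1}^dB_i^2(t)}$ ($B_i$ independent standard Brownian motions) has density $\frac{1}{\Gamma(d/2)}\frac{r^{d-1}}{2^{d/2-1}t^{d/2}}e^{-r^2/(2t)}$, $r>0$. The $l$-times iterated Bessel process is $\mathcal{R}_l^d(t)=R_1^d(R_2^d(\cdots(R_{l+1}^d(t))\cdots))$, where $R_1^d,\dots,R_{l+1}^d$ are independent Bessel processes, independent of $X_m$ and $N$. For an independent positive random time $T$, the conditional law $P\{X_m(T)\in dx\,|\,N(t)=n\}$ means the law of $X_m$ at time $T$ when the number of Poisson events up to that time is fixed to be $n$, i.e. $dx\int_0^\infty p_n^m(x,s)\,P\{T\in ds\}$. $B(a,b)=\Gamma(a)\Gamma(b)/\Gamma(a+b)$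 is the Beta function. Equalities of laws are equalities of Lebesgue densities (a.e. $x$). *)

theory Defs
  imports "HOL-Probability.Probability"
begin

section \<open>Random variables indexed by a set\<close>

text \<open>Families of real random variables (sequences, processes) are compared through the random
  element of the product space that they form; independence of families is independence of these
  random elements.\<close>

abbreviation path_space :: "'i set \<Rightarrow> ('i \<Rightarrow> real) measure" where
  "path_space I \<equiv> PiM I (\<lambda>_. borel)"

abbreviation sample_path :: "'i set \<Rightarrow> ('i \<Rightarrow> 'a \<Rightarrow> real) \<Rightarrow> 'a \<Rightarrow> 'i \<Rightarrow> real" where
  "sample_path I Y \<omega> \<equiv> (\<lambda>i\<in>I. Y i \<omega>)"

text \<open>The library's \<open>indep_var\<close> for random elements of spaces of different types.\<close>

definition indep_elements ::
  "'a measure \<Rightarrow> 'b measure \<Rightarrow> ('a \<Rightarrow> 'b) \<Rightarrow> 'c measure \<Rightarrow> ('a \<Rightarrow> 'c) \<Rightarrow> bool" where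
  "indep_elements M E X F Y \<longleftrightarrow>
     X \<in> measurable M E \<and> Y \<in> measurable M F \<and>
     prob_space.indep_set M (sets (vimage_algebra (space M) X E)) (sets (vimage_algebra (space M) Y F))"

section \<open>The random motion\<close>

text \<open>Event times of a homogeneous Poisson process: \<open>S 0 = 0\<close> and the waiting times
  \<open>S (j + 1) - S j\<close> are i.i.d. exponential; in particular \<open>S 1 < S 2 < \<dots>\<close> almost surely.\<close>

definition poisson_event_times :: "'a measure \<Rightarrow> real \<Rightarrow> (nat \<Rightarrow> 'a \<Rightarrow> real) \<Rightarrow> bool" where
  "poisson_event_times M rate S \<longleftrightarrow>
     (\<forall>\<omega>\<in>space M. S 0 \<omega> = 0) \<and>
     prob_space.indep_vars M (\<lambda>_. borel) (\<lambda>j \<omega>. S (Suc j) \<omega> - S j \<omega>) UNIV \<and>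
     (\<forall>j. distributed M lborel (\<lambda>\<omega>. S (Suc j) \<omega> - S j \<omega>)
            (\<lambda>x. ennreal (exponential_density rate x)))"

text \<open>The Poisson process itself. On the null event that infinitely many events occur up to time
  \<open>s\<close>, \<open>card\<close> gives 0.\<close>

definition event_count :: "(nat \<Rightarrow> 'a \<Rightarrow> real) \<Rightarrow> real \<Rightarrow> 'a \<Rightarrow> nat" where
  "event_count S s \<omega> = card {j. 1 \<le> j \<and> S j \<omega> \<le> s}"

definition angle_density :: "nat \<Rightarrow> real \<Rightarrow> real" where
  "angle_density m \<theta> =
     Gamma (real m + 1) / (sqrt pi * Gamma (real m + 1 / 2)) * sin \<theta> ^ (2 * m)
       * indicator {0<..<pi} \<theta>"

definition iid_angles :: "'a measure \<Rightarrow> nat \<Rightarrow> (nat \<Rightarrow> 'a \<Rightarrow> real) \<Rightarrow> bool" where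
  "iid_angles M m \<Theta> \<longleftrightarrow>
     prob_space.indep_vars M (\<lambda>_. borel) \<Theta> {1..} \<and>
     (\<forall>j\<ge>1. distributed M lborel (\<Theta> j) (\<lambda>x. ennreal (angle_density m x)))"

text \<open>The conditional expression is the convention that \<open>s\<close> itself takes the place of the event
  time with number \<open>N(s) + 1\<close>.\<close>

definition random_motion ::
  "real \<Rightarrow> (nat \<Rightarrow> 'a \<Rightarrow> real) \<Rightarrow> (nat \<Rightarrow> 'a \<Rightarrow> real) \<Rightarrow> real \<Rightarrow> 'a \<Rightarrow> real" where
  "random_motion c S \<Theta> s \<omega> =
     c * (\<Sum>j = 1..event_count S s \<omega> + 1.
            ((if j = event_count S s \<omega> + 1 then s else S j \<omega>) - S (j - 1) \<omega>) * cos (\<Theta> j \<omega>))"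

definition v_index :: "nat \<Rightarrow> nat \<Rightarrow> real" where
  "v_index m n = (if m = 0 then real n / 2 else real n + 1)"

section \<open>Iterated Bessel processes\<close>

definition brownian_motion :: "'a measure \<Rightarrow> (real \<Rightarrow> 'a \<Rightarrow> real) \<Rightarrow> bool" where
  "brownian_motion M W \<longleftrightarrow>
     (\<forall>t\<ge>0. W t \<in> borel_measurable M) \<and>
     (AE \<omega> in M. W 0 \<omega> = 0) \<and>
     (\<forall>\<omega>\<in>space M. continuous_on {0..} (\<lambda>t. W t \<omega>)) \<and>
     (\<forall>s\<ge>0. \<forall>t>s. distributed M lborel (\<lambda>\<omega>. W t \<omega> - W s \<omega>)
        (\<lambda>x. ennreal (normal_density 0 (sqrt (t - s)) x))) \<and>
     (\<forall>\<tau> :: nat \<Rightarrow> real. \<forall>k. 0 \<le> \<tau> 0 \<and> mono \<tau> \<longrightarrow>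
        prob_space.indep_vars M (\<lambda>_. borel) (\<lambda>i \<omega>. W (\<tau> (Suc i)) \<omega> - W (\<tau> i) \<omega>) {..<k})"

definition bessel :: "nat \<Rightarrow> (nat \<Rightarrow> real \<Rightarrow> 'a \<Rightarrow> real) \<Rightarrow> real \<Rightarrow> 'a \<Rightarrow> real" where
  "bessel d W t \<omega> = sqrt (\<Sum>i = 1..d. (W i t \<omega>)\<^sup>2)"

text \<open>\<open>iterated R l t = R 1 (R 2 (\<dots> (R (l + 1) t) \<dots>))\<close>, pointwise in \<open>\<omega>\<close>.\<close>

primrec iterated :: "(nat \<Rightarrow> real \<Rightarrow> 'a \<Rightarrow> real) \<Rightarrow> nat \<Rightarrow> real \<Rightarrow> 'a \<Rightarrow> real" where
  "iterated R 0 t \<omega> = R 1 t \<omega>"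
| "iterated R (Suc l) t \<omega> = iterated R l (R (l + 2) t \<omega>) \<omega>"

text \<open>\<open>B k i\<close> is the \<open>i\<close>-th Brownian motion in the \<open>k\<close>-th Bessel process.\<close>

definition iterated_bessel ::
  "nat \<Rightarrow> (nat \<Rightarrow> nat \<Rightarrow> real \<Rightarrow> 'a \<Rightarrow> real) \<Rightarrow> nat \<Rightarrow> real \<Rightarrow> 'a \<Rightarrow> real" where
  "iterated_bessel d B l = iterated (\<lambda>k. bessel d (B k)) l"

section \<open>Laws given the number of events\<close>

text \<open>The law of \<open>X s\<close> given \<open>N s = n\<close>, for a fixed time \<open>s\<close>. If \<open>N s = n\<close> has probability 0
  (e.g. for \<open>s \<le> 0\<close> and \<open>n \<ge> 1\<close>), this is the zero measure.\<close>

definition law_given_count ::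
  "'a measure \<Rightarrow> (real \<Rightarrow> 'a \<Rightarrow> real) \<Rightarrow> (real \<Rightarrow> 'a \<Rightarrow> nat) \<Rightarrow> nat \<Rightarrow> real \<Rightarrow> real measure" where
  "law_given_count M X N n s = distr (uniform_measure M {\<omega> \<in> space M. N s \<omega> = n}) borel (X s)"

text \<open>The law of \<open>X\<close> at the random time \<open>T\<close> when the number of events up to that time is fixed to
  be \<open>n\<close>: the mixture of the laws of \<open>X s\<close> given \<open>N s = n\<close> over the law of \<open>T\<close>. This is not the
  conditional law of \<open>X T\<close> given the event \<open>N T = n\<close>, which would reweight the law of \<open>T\<close>.\<close>

definition law_at_time_given_count ::
  "'a measure \<Rightarrow> (real \<Rightarrow> 'a \<Rightarrow> real) \<Rightarrow> (real \<Rightarrow> 'a \<Rightarrow> nat) \<Rightarrow> nat \<Rightarrow> ('a \<Rightarrow> real) \<Rightarrow> real measure" where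
  "law_at_time_given_count M X N n T =
     Giry_Monad.bind (distr M borel T) (law_given_count M X N n)"

end

theory Submission
  imports Defs
begin

text \<open>
  No densities of the motion are needed: the laws are identified through their moments.
  Given that \<open>n\<close> events occur up to time \<open>s\<close>, integrating out one waiting time and one angle after
  the other shows that the \<open>k\<close>-th moment of \<open>X(s) / (c s)\<close> is \<open>k! n! / (n + k)!\<close> times the
  \<open>k\<close>-th coefficient of \<open>A ^ (n + 1)\<close>, where \<open>A\<close> is the generating function of the moments of
  \<open>cos \<theta>\<close>, an explicit algebraic function for \<open>m \<le> 1\<close>; the odd moments vanish and the moment of
  order \<open>2 j\<close> is \<open>(1/2)\<^sub>j / (v + 1)\<^sub>j\<close>. The density of a Bessel process multiplied by \<open>r ^ (2 * j)\<close>
  is again such a density up to a constant, so \<open>X\<close> at a Bessel time has the moments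
  \<open>(2 t c\<^sup>2) ^ j * (1/2)\<^sub>j * (d/2)\<^sub>j / (v + 1)\<^sub>j\<close>. These are also the moments of a centred Gaussian
  variable with variance \<open>c\<^sup>2 t w\<close>, where \<open>w\<close> is beta distributed with parameters
  \<open>d/2\<close> and \<open>v - d/2 + 1\<close>, and they grow slowly enough to determine the law. The remaining \<open>l\<close>
  Bessel processes are composed by conditioning on the innermost one.
\<close>

unbundle no vec_syntax and fps_syntax

section \<open>Moment generating functions of the angles\<close>

text \<open>Given n events up to s, the n + 1 spacings divided by s are uniform on the simplex, so
  the monomial in them with exponents k_0, ..., k_n of sum k has mean n! k_0! ... k_n! / (n + k)!.
  The multinomial expansion of (X(s) / (c s))^k divides by the same factorials k_i!, and a
  coefficient of a product of n + 1 copies of A is left; this is why the ordinary generating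
  function governs the moments. For m = 0 it is (1 - X^2)^(-1/2); for m = 1 it is 2 (1 - sqrt(1 -
  X^2)) / X^2, the Catalan series at X^2 / 4. The powers of both have closed coefficients. The
  target moments split into factors of known laws: 2^j (1/2)_j are the moments of a standard normal
  variable, (d/2)_j / (v + 1)_j those of the beta law, whose second parameter is positive exactly
  when v > d/2 - 1. Two obstacles shape the rest. Time is random, so processes must be measurable
  jointly in time and outcome. And the stated density consists of real-valued integrals that may
  diverge at single points, so Tonelli's theorem is used on extended nonnegative functions and the
  passage to real integrals is made for almost every x.\<close>

lemma one_minus_X2_deriv_nth:
  fixes G :: "real fps"
  shows "((1 - fps_X\<^sup>2) * fps_deriv G) $ j =
      real (j + 1) * G $ (j + 1) - (if j < 2 then 0 else real (j - 1) * G $ (j - 1))"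
proof -
  have "Suc (j - 2) = j - 1" if "\<not> j < 2" using that by simp
  then show ?thesis
    by (simp add: left_diff_distrib fps_X_power_mult_nth)
qed

text \<open>The solutions of this equation are the constant multiples of (1 - X^2)^(-r/2). Comparing
  coefficients of X^(k + 1) expresses that as a two-step recursion, without powers of series to real
  exponents.\<close>

lemma fps_ode_coeffs:
  fixes G :: "real fps"
  assumes ode: "(1 - fps_X\<^sup>2) * fps_deriv G = fps_const r * (fps_X * G)"
  shows "real (k + 2) * G $ (k + 2) = (real k + r) * G $ k" "G $ 1 = 0"
proof -
  have c: "((1 - fps_X\<^sup>2) * fps_deriv G) $ j = (fps_const r * (fps_X * G)) $ j" for j
    by (simp only: ode)
  have r: "(fps_const r * (fps_X * G)) $ j = (if j = 0 then 0 else r * G $ (j - 1))" for j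
    by simp
  show "G $ 1 = 0" using c[of 0] one_minus_X2_deriv_nth[of G 0] r[of 0] by simp
  show "real (k + 2) * G $ (k + 2) = (real k + r) * G $ k"
    using c[of "k+1"] one_minus_X2_deriv_nth[of G "k+1"] r[of "k+1"]
    by (cases k) (simp_all add: algebra_simps)
qed

text \<open>For v > -1/2 these are the moments of the law on (-1, 1) with density proportional to (1
  - x^2)^(v - 1/2). The value v = m belongs to the cosine of an angle, and v =
  \<open>v_index m n\<close> to X(s) / (c s) given n events.\<close>

definition sym_moment :: "real \<Rightarrow> nat \<Rightarrow> real" where
  "sym_moment v k = (if odd k then 0 else pochhammer (1/2) (k div 2) / pochhammer (v + 1) (k div 2))"

lemma sym_moment_0: "sym_moment v 0 = 1"
  and sym_moment_1: "sym_moment v (Suc 0) = 0"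
  by (auto simp: sym_moment_def)

text \<open>Together with the values at 0 and 1 this recursion determines the whole sequence, so
  other sequences are identified with it by comparing recursions.\<close>

lemma sym_moment_step:
  assumes "v > - 1"
  shows "(real k + 2 + 2 * v) * sym_moment v (k + 2) = real (k + 1) * sym_moment v k"
proof (cases "odd k")
  case False
  then obtain j where k: "k = 2 * j" by (metis evenE)
  have "pochhammer (v + 1) j \<noteq> 0" "v + 1 + real j \<noteq> 0"
    using assms pochhammer_pos[of "v + 1" j] by auto
  then show ?thesis
    by (simp add: k sym_moment_def pochhammer_Suc divide_simps) (simp add: algebra_simps)
qed (simp add: sym_moment_def)

abbreviation angle_fps :: "nat \<Rightarrow> real fps" where
  "angle_fps m \<equiv> Abs_fps (sym_moment (real m))"

text \<open>For m = 0 the series is (1 - X^2)^(-1/2), whose logarithmic derivative is X / (1 -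
  X^2).\<close>

lemma angle_fps_0_ode: "(1 - fps_X\<^sup>2) * fps_deriv (angle_fps 0) = fps_X * angle_fps 0"
proof (rule fps_ext)
  fix j :: nat
  consider "j = 0" | "j = 1" | i where "j = i + 2"
    by (metis One_nat_def add_2_eq_Suc' not0_implies_Suc)
  then show "((1 - fps_X\<^sup>2) * fps_deriv (angle_fps 0)) $ j = (fps_X * angle_fps 0) $ j"
  proof cases
    case 2
    then show ?thesis using sym_moment_step[of 0 0] by (simp add: one_minus_X2_deriv_nth)
  next
    case 3
    then show ?thesis
      using sym_moment_step[of 0 "i + 1"] unfolding one_minus_X2_deriv_nth by (simp add: algebra_simps)
  qed (simp_all add: one_minus_X2_deriv_nth sym_moment_1)
qed

text \<open>Raising to the power n + 1 multiplies the logarithmic derivative by n + 1, so the power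
  obeys the same type of equation with r = n + 1. The factorial weight turns the resulting recursion
  into that of \<open>sym_moment\<close> with v = n/2; this is the origin of v_0.\<close>

lemma angle_fps_0_power:
  "(angle_fps 0 ^ (n + 1)) $ k * (fact k * fact n / fact (n + k)) = sym_moment (real n / 2) k"
proof -
  let ?G = "angle_fps 0 ^ (n + 1)"
  have "(1 - fps_X\<^sup>2) * fps_deriv ?G
      = fps_const (real n + 1) * (angle_fps 0 ^ n * ((1 - fps_X\<^sup>2) * fps_deriv (angle_fps 0)))"
    unfolding fps_deriv_power by (simp add: ac_simps)
  also have "\<dots> = fps_const (real n + 1) * (fps_X * ?G)"
    unfolding angle_fps_0_ode by (simp add: ac_simps)
  finally have "(1 - fps_X\<^sup>2) * fps_deriv ?G = fps_const (real n + 1) * (fps_X * ?G)" .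
  note ode = fps_ode_coeffs[OF this]
  \<comment> \<open>The recursion advances by 2, so the induction carries two neighbouring
    indices.\<close>
  have "?G $ k * (fact k * fact n / fact (n + k)) = sym_moment (real n / 2) k
      \<and> ?G $ Suc k * (fact (Suc k) * fact n / fact (n + Suc k)) = sym_moment (real n / 2) (Suc k)"
  proof (induction k)
    case 0
    then show ?case using ode(2) by (simp add: sym_moment_0 sym_moment_1 fps_nth_power_0)
  next
    case (Suc k)
    have nz: "real k + 2 + real n \<noteq> 0" "real k + (real n + 1) \<noteq> 0" by linarith+
    have s: "(real k + 2 + real n) * sym_moment (real n / 2) (k + 2) = real (k + 1) * sym_moment (real n / 2) k"
      using sym_moment_step[of "real n / 2" k] by simp
    have "sym_moment (real n / 2) (k + 2)
        = real (k + 1) / (real k + 2 + real n) * (?G $ k * (fact k * fact n / fact (n + k)))"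
      using s nz Suc by (simp add: eq_divide_eq mult.commute)
    also have "?G $ k = real (k + 2) * ?G $ (k + 2) / (real k + (real n + 1))"
      using ode(1)[of k] nz by (simp add: eq_divide_eq mult.commute)
    also have "real (k + 1) / (real k + 2 + real n) * (real (k + 2) * ?G $ (k + 2) / (real k + (real n + 1)) * (fact k * fact n / fact (n + k)))
       = ?G $ (k + 2) * (fact (k + 2) * fact n / fact (n + (k + 2)))"
      using nz by (simp add: field_simps del: power_Suc)
    finally have "?G $ (k + 2) * (fact (k + 2) * fact n / fact (n + (k + 2))) = sym_moment (real n / 2) (k + 2)" ..
    with Suc show ?case by simp
  qed
  then show ?thesis by simp
qed

text \<open>\<open>1 - X\<^sup>2 / 2 * angle_fps 1\<close> is the series of \<open>sqrt (1 - X\<^sup>2)\<close>.\<close>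

lemma angle_fps_1_quadratic:
  "fps_X\<^sup>2 * (angle_fps 1)\<^sup>2 = fps_const 4 * (angle_fps 1 - 1)"
proof -
  have cases4: "k = 0 \<or> k = 1 \<or> k = 2 \<or> (\<exists>i. k = i + 3)" for k :: nat
    by presburger
  define Q where "Q = 1 - fps_const (1/2) * (fps_X\<^sup>2 * angle_fps 1)"
  have Qn: "Q $ k = (if k = 0 then 1 else if k < 2 then 0 else - sym_moment 1 (k - 2) / 2)" for k
    by (simp add: Q_def fps_X_power_mult_nth)
  have Q': "(1 - fps_X\<^sup>2) * fps_deriv Q = - (fps_X * Q)"
  proof (rule fps_ext)
    fix j :: nat
    consider "j = 0" | "j = 1" | "j = 2" | i where "j = i + 3" using cases4[of j] by blast
    then show "((1 - fps_X\<^sup>2) * fps_deriv Q) $ j = (- (fps_X * Q)) $ j"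
    proof cases
      case 4
      then show ?thesis using sym_moment_step[of 1 i]
        unfolding one_minus_X2_deriv_nth by (simp add: Qn algebra_simps)
    qed (simp_all add: one_minus_X2_deriv_nth Qn sym_moment_0 sym_moment_1)
  qed
  have "(1 - fps_X\<^sup>2) * fps_deriv (Q\<^sup>2) = fps_const 2 * (Q * ((1 - fps_X\<^sup>2) * fps_deriv Q))"
    unfolding fps_deriv_power by (simp add: ac_simps)
  also have "\<dots> = fps_const (-2) * (fps_X * Q\<^sup>2)"
    unfolding Q' by (simp add: power2_eq_square ac_simps flip: fps_const_neg)
  finally have "(1 - fps_X\<^sup>2) * fps_deriv (Q\<^sup>2) = fps_const (-2) * (fps_X * Q\<^sup>2)" .
  note ode = fps_ode_coeffs[OF this]
  have "Q\<^sup>2 $ k = (1 - fps_X\<^sup>2) $ k" for k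
  proof (induction k rule: less_induct)
    case (less k)
    consider "k = 0" | "k = 1" | "k = 2" | i where "k = i + 3" using cases4[of k] by blast
    then show ?case
    proof cases
      case 3
      then show ?thesis using ode(1)[of 0] by (simp add: fps_nth_power_0 Qn numeral_2_eq_2)
    next
      case 4
      \<comment> \<open>The factor on the right vanishes for i = 1; for every other i the
        coefficient of order i + 1 is 0 by the induction hypothesis. Hence Q^2 stops at degree
        2.\<close>
      have "real (i + 3) * Q\<^sup>2 $ (i + 3) = (real (i+1) - 2) * Q\<^sup>2 $ (i + 1)"
        using ode(1)[of "i + 1"] by (simp add: eval_nat_numeral)
      also have "\<dots> = 0" using less[of "i + 1"] 4 by (auto simp: fps_X_power_iff)
      finally show ?thesis using 4 by (simp add: fps_X_power_iff)
    qed (use ode in \<open>auto simp: fps_nth_power_0 Qn fps_X_power_iff\<close>)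
  qed
  then have Q2: "Q\<^sup>2 = 1 - fps_X\<^sup>2" by (rule fps_ext)
  have XA: "fps_X\<^sup>2 * angle_fps 1 = 2 * (1 - Q)"
  proof -
    have "2 * fps_const (1/2) = (1 :: real fps)"
      unfolding numeral_fps_const fps_const_mult by simp
    then show ?thesis unfolding Q_def by (simp add: mult.assoc[symmetric])
  qed
  \<comment> \<open>After multiplication by X^2 everything can be written in Q, where Q^2 = 1 - X^2
    applies; X^2 is cancelled at the end.\<close>
  have "fps_X\<^sup>2 * (fps_X\<^sup>2 * (angle_fps 1)\<^sup>2) = (fps_X\<^sup>2 * angle_fps 1)\<^sup>2"
    by (simp add: power2_eq_square algebra_simps)
  also have "\<dots> = 4 * (1 - 2 * Q + Q\<^sup>2)"
    unfolding XA by (simp add: power2_eq_square algebra_simps)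
  also have "\<dots> = 4 * (fps_X\<^sup>2 * angle_fps 1 - fps_X\<^sup>2)"
    unfolding XA Q2 by (simp add: algebra_simps)
  also have "\<dots> = fps_X\<^sup>2 * (fps_const 4 * (angle_fps 1 - 1))"
    unfolding numeral_fps_const by (simp add: algebra_simps)
  finally show ?thesis by (subst (asm) mult_cancel_left) simp
qed

lemma sym_moment_nat:
  "sym_moment (real r) (2 * j) = fact (2 * j) * fact r / (4 ^ j * fact j * fact (r + j))"
proof (induction j)
  case (Suc j)
  have "sym_moment (real r) (2 * Suc j) = (2 * real j + 1) / (2 * (real r + real j + 1)) * sym_moment (real r) (2 * j)"
    using sym_moment_step[of "real r" "2 * j"] by (simp add: field_simps)
  also have "\<dots> = fact (2 * Suc j) * fact r / (4 ^ Suc j * fact (Suc j) * fact (r + Suc j))"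
    unfolding Suc by (simp add: divide_simps) (simp add: algebra_simps)
  finally show ?case .
qed (simp add: sym_moment_0)

text \<open>The quadratic relation gives X^2 A^(r + 2) = 4 (A^(r + 1) - A^r), so all powers are
  determined by A^0 and A^1. It remains to check that the guessed coefficients obey the same
  relation.\<close>

lemma angle_fps_1_power:
  "(angle_fps 1 ^ (n + 1)) $ k * (fact k * fact n / fact (n + k)) = sym_moment (real n + 1) k"
proof -
  let ?A = "angle_fps 1"
  have step: "(?A ^ (r + 2)) $ k = 4 * ((?A ^ (r + 1)) $ (k + 2) - (?A ^ r) $ (k + 2))" for r k
  proof -
    have "fps_X\<^sup>2 * ?A ^ (r + 2) = ?A ^ r * (fps_X\<^sup>2 * ?A\<^sup>2)"
      by (simp add: power_add power2_eq_square ac_simps)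
    also have "\<dots> = fps_const 4 * (?A ^ (r + 1) - ?A ^ r)"
      unfolding angle_fps_1_quadratic by (simp add: ring_distribs ac_simps)
    finally have "(fps_X\<^sup>2 * ?A ^ (r + 2)) $ (k + 2) = (fps_const 4 * (?A ^ (r + 1) - ?A ^ r)) $ (k + 2)"
      by (rule arg_cong)
    then show ?thesis by (simp add: fps_X_power_mult_nth del: power_Suc)
  qed
  \<comment> \<open>A is the Catalan series at X^2 / 4, and these are the classical coefficients r /
    (2 j + r) * binomial(2 j + r, j) of its r-th power, scaled by 4^(-j). The value
    \<open>c 0 0\<close> is 0 although A^0 has constant coefficient 1; the recursion uses
    \<open>c 0\<close> only at \<open>j + 1\<close>, where both vanish.\<close>
  define c where "c r j = real r * fact (2 * j + r - 1) / (4 ^ j * fact j * fact (r + j))" for r j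
  have c_step: "c (r + 2) j = 4 * (c (r + 1) (j + 1) - c r (j + 1))" for r j
  proof (cases r)
    case 0
    then show ?thesis
      by (simp add: c_def divide_simps)
  next
    case (Suc i)
    let ?N = "fact (2 * j + i + 1) :: real" and ?D = "fact (i + j + 3) :: real"
    have e: "2 * j + (r + 2) - 1 = Suc (2 * j + i + 1)" "r + 2 + j = i + j + 3"
      "2 * (j + 1) + (r + 1) - 1 = Suc (Suc (2 * j + i + 1))" "r + 1 + (j + 1) = i + j + 3"
      "2 * (j + 1) + r - 1 = Suc (2 * j + i + 1)" "i + j + 3 = Suc (r + (j + 1))"
      by (simp_all add: Suc)
    have fj: "fact (j + 1) = (real j + 1) * fact j" by simp
    have 1: "c (r + 2) j = (real i + 3) * (2 * real j + real i + 2) * ?N / (4 ^ j * fact j * ?D)"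
      unfolding c_def e(1,2) fact_Suc by (simp add: Suc algebra_simps del: fact_Suc)
    have 2: "c (r + 1) (j + 1) = (real i + 2) * (2 * real j + real i + 3) * (2 * real j + real i + 2) * ?N
        / (4 ^ (j + 1) * ((real j + 1) * fact j) * ?D)"
      unfolding c_def e(3,4) fact_Suc fj by (simp add: Suc algebra_simps del: fact_Suc)
    have D: "fact (r + (j + 1)) = ?D / (real i + real j + 3)"
      unfolding e(6) fact_Suc by (simp add: Suc add_divide_distrib[symmetric] divide_simps del: fact_Suc)
    have 3: "c r (j + 1) = (real i + 1) * (real i + real j + 3) * (2 * real j + real i + 2) * ?N
        / (4 ^ (j + 1) * ((real j + 1) * fact j) * ?D)"
      proof -
      have r: "real (Suc (2 * j + i + 1)) = 2 * real j + real i + 2" "real r = real i + 1" by (simp_all add: Suc)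
      show ?thesis unfolding c_def e(5) D fact_Suc[of "2 * j + i + 1"] fj r
        by (simp add: ac_simps del: fact_Suc)
    qed
    have "?D \<noteq> 0" "real j + 1 \<noteq> 0" by (simp_all del: fact_Suc)
    then show ?thesis unfolding 1 2 3
      by (simp add: divide_simps del: fact_Suc) (simp add: algebra_simps del: fact_Suc)
  qed
  have A1: "?A $ k = (if odd k then 0 else c 1 (k div 2))" for k
    using sym_moment_nat[of 1 "k div 2"] by (auto simp: sym_moment_def c_def)
  have A2: "(?A ^ 2) $ k = (if odd k then 0 else c 2 (k div 2))" for k
    using step[of 0 k] A1[of "k + 2"] c_step[of 0 "k div 2"] by (auto simp: c_def simp flip: numeral_2_eq_2)
  have "(\<forall>k. (?A ^ (n + 1)) $ k = (if odd k then 0 else c (n + 1) (k div 2)))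
      \<and> (\<forall>k. (?A ^ (n + 2)) $ k = (if odd k then 0 else c (n + 2) (k div 2)))"
  proof (induction n)
    case 0
    then show ?case using A1 A2 by (simp only: add_0 power_one_right) blast
  next
    case (Suc n)
    have "(?A ^ (n + 3)) $ k = (if odd k then 0 else c (n + 3) (k div 2))" for k
    proof -
      have e: "n + 3 = (n + 1) + 2" "n + 2 = n + 1 + 1" by simp_all
      show ?thesis
        using step[of "n + 1" k] c_step[of "n + 1" "k div 2"]
          Suc[THEN conjunct1, rule_format, of "k + 2"] Suc[THEN conjunct2, rule_format, of "k + 2"]
        unfolding e by (simp del: power_Suc)
    qed
    with Suc show ?case by (simp add: numeral_3_eq_3 del: power_Suc)
  qed
  then have *: "(?A ^ (n + 1)) $ k = (if odd k then 0 else c (n + 1) (k div 2))" by blast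
  show ?thesis
  proof (cases "odd k")
    case True
    then show ?thesis using * by (simp add: sym_moment_def)
  next
    case False
    then obtain j where k: "k = 2 * j" by (metis evenE)
    have 1: "(?A ^ (n + 1)) $ k = real (n + 1) * fact (n + 2 * j) / (4 ^ j * fact j * fact (n + 1 + j))"
      using * by (simp add: k c_def add.commute)
    have 2: "sym_moment (real n + 1) k = fact (2 * j) * (real (n + 1) * fact n) / (4 ^ j * fact j * fact (n + 1 + j))"
      using sym_moment_nat[of "n + 1" j] by (simp add: k add.commute)
    show ?thesis unfolding 1 2 unfolding k by (simp del: fact_Suc add: ac_simps)
  qed
qed

section \<open>Laws determined by their moments\<close>

text \<open>Equal moments give both characteristic functions the same Taylor polynomials. At even
  degree 2 j the remainder is bounded by an ordinary moment instead of an absolute one, and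
  \<open>lim\<close> makes that bound tend to 0 at every argument.\<close>

lemma moment_unique:
  assumes \<mu>: "real_distribution \<mu>" and \<nu>: "real_distribution \<nu>"
    and int: "\<And>k. integrable \<mu> (\<lambda>x. x ^ k)" "\<And>k. integrable \<nu> (\<lambda>x. x ^ k)"
    and eq: "\<And>k. (LINT x|\<mu>. x ^ k) = (LINT x|\<nu>. x ^ k)"
    and lim: "\<And>a::real. (\<lambda>j. a ^ (2 * j) / fact (2 * j) * (LINT x|\<mu>. x ^ (2 * j))) \<longlonglongrightarrow> 0"
  shows "\<mu> = \<nu>"
proof (rule Levy_uniqueness[OF \<mu> \<nu>], rule ext)
  fix a :: real
  let ?S = "\<lambda>j. \<Sum>k\<le>2 * j. ((\<i> * a) ^ k / fact k) * (LINT x|\<mu>. x ^ k)"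
  let ?e = "\<lambda>j. a ^ (2 * j) / fact (2 * j) * (LINT x|\<mu>. x ^ (2 * j))"
  have "cmod (char \<mu> a - char \<nu> a) \<le> 4 * ?e j" for j
  proof -
    have "cmod (char \<mu> a - ?S j) \<le> 2 * ?e j"
      using real_distribution.char_approx1[OF \<mu>, of "2 * j" a] int
      by (simp add: power_even_abs)
    moreover have "cmod (char \<nu> a - ?S j) \<le> 2 * ?e j"
      using real_distribution.char_approx1[OF \<nu>, of "2 * j" a] int
      by (simp add: power_even_abs eq)
    ultimately show ?thesis
      using norm_triangle_ineq4[of "char \<mu> a - ?S j" "char \<nu> a - ?S j"] by simp
  qed
  moreover have "(\<lambda>j. 4 * ?e j) \<longlonglongrightarrow> 4 * 0"
    by (intro tendsto_mult_left lim)
  ultimately have "cmod (char \<mu> a - char \<nu> a) \<le> 0"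
    by (intro LIMSEQ_le_const[where X = "\<lambda>j. 4 * ?e j"]) auto
  then show "char \<mu> a = char \<nu> a" by simp
qed

definition even_moments :: "real measure \<Rightarrow> (nat \<Rightarrow> real) \<Rightarrow> bool" where
  "even_moments \<mu> e \<longleftrightarrow> real_distribution \<mu> \<and>
     (\<forall>j. has_bochner_integral \<mu> (\<lambda>x. x ^ (2 * j)) (e j)) \<and>
     (\<forall>j. has_bochner_integral \<mu> (\<lambda>x. x ^ (2 * j + 1)) 0)"

lemma even_moments_unique:
  assumes \<mu>: "even_moments \<mu> e" and \<nu>: "even_moments \<nu> e"
    and lim: "\<And>a::real. (\<lambda>j. a ^ (2 * j) / fact (2 * j) * e j) \<longlonglongrightarrow> 0"
  shows "\<mu> = \<nu>"
proof (rule moment_unique)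
  show "real_distribution \<mu>" "real_distribution \<nu>" using \<mu> \<nu> by (auto simp: even_moments_def)
  have *: "integrable \<mu>' (\<lambda>x. x ^ k) \<and> (LINT x|\<mu>'. x ^ k) = (if even k then e (k div 2) else 0)"
    if "even_moments \<mu>' e" for \<mu>' k
  proof (cases "even k")
    case True
    then obtain j where "k = 2 * j" by (metis evenE)
    then show ?thesis using that by (auto simp: even_moments_def has_bochner_integral_iff)
  next
    case False
    then obtain j where "k = 2 * j + 1" by (metis oddE)
    then show ?thesis using that by (auto simp: even_moments_def has_bochner_integral_iff)
  qed
  show "integrable \<mu> (\<lambda>x. x ^ k)" "integrable \<nu> (\<lambda>x. x ^ k)" "(LINT x|\<mu>. x ^ k) = (LINT x|\<nu>. x ^ k)" for k
    using *[OF \<mu>] *[OF \<nu>] by auto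
  show "(\<lambda>j. a ^ (2 * j) / fact (2 * j) * (LINT x|\<mu>. x ^ (2 * j))) \<longlonglongrightarrow> 0" for a :: real
    using lim *[OF \<mu>] by simp
qed

text \<open>The odd moments of a mixture vanish because the nonnegative function \<open>x ^ (2 * j) * (1 + x)\<^sup>2\<close>,
  to which Tonelli's theorem applies, contains \<open>2 * x ^ (2 * j + 1)\<close>.\<close>

lemma even_moments_bind:
  assumes \<nu>: "prob_space \<nu>" "sets \<nu> = sets borel"
    and \<kappa>: "\<kappa> \<in> measurable borel (subprob_algebra borel)"
    and mom: "AE s in \<nu>. even_moments (\<kappa> s) (\<lambda>j. e j s)"
    and e: "\<And>j. (\<integral>\<^sup>+ s. ennreal (e j s) \<partial>\<nu>) = ennreal (E j)" and E: "\<And>j. E j \<ge> 0" "E 0 = 1"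
    and e_meas: "\<And>j. e j \<in> borel_measurable borel"
  shows "even_moments (\<nu> \<bind> \<kappa>) E"
proof -
  interpret \<nu>: prob_space \<nu> by fact
  let ?\<mu> = "\<nu> \<bind> \<kappa>"
  have \<kappa>'[measurable]: "\<kappa> \<in> measurable \<nu> (subprob_algebra borel)"
    using \<kappa> \<nu>(2) by (simp cong: measurable_cong_sets)
  note [measurable] = e_meas
  have [simp]: "sets ?\<mu> = sets borel"
    by (rule sets_bind) (use sets_kernel[OF \<kappa>'] \<nu>.not_empty in auto)
  then have [measurable_cong]: "sets ?\<mu> = sets borel" .
  have nn: "(\<integral>\<^sup>+ x. f x \<partial>?\<mu>) = (\<integral>\<^sup>+ s. \<integral>\<^sup>+ x. f x \<partial>\<kappa> s \<partial>\<nu>)" if "f \<in> borel_measurable borel" for f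
    using that \<kappa>' by (rule nn_integral_bind)
  have even: "(\<integral>\<^sup>+ x. ennreal (x ^ (2 * j)) \<partial>?\<mu>) = ennreal (E j)" for j
  proof -
    have "(\<integral>\<^sup>+ x. ennreal (x ^ (2 * j)) \<partial>?\<mu>) = (\<integral>\<^sup>+ s. \<integral>\<^sup>+ x. ennreal (x ^ (2 * j)) \<partial>\<kappa> s \<partial>\<nu>)"
      by (rule nn) simp
    also have "\<dots> = (\<integral>\<^sup>+ s. ennreal (e j s) \<partial>\<nu>)"
    proof (rule nn_integral_cong_AE, use mom in eventually_elim)
      case (elim s)
      then have "has_bochner_integral (\<kappa> s) (\<lambda>x. x ^ (2 * j)) (e j s)" by (simp add: even_moments_def)
      then show ?case
        by (subst nn_integral_eq_integral) (auto simp: has_bochner_integral_iff zero_le_even_power)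
    qed
    finally show ?thesis using e by simp
  qed
  have odd: "(\<integral>\<^sup>+ x. ennreal (x ^ (2 * j) * (1 + x)\<^sup>2) \<partial>?\<mu>) = ennreal (E j + E (j + 1))" for j
  proof -
    have "(\<integral>\<^sup>+ x. ennreal (x ^ (2 * j) * (1 + x)\<^sup>2) \<partial>?\<mu>) = (\<integral>\<^sup>+ s. \<integral>\<^sup>+ x. ennreal (x ^ (2 * j) * (1 + x)\<^sup>2) \<partial>\<kappa> s \<partial>\<nu>)"
      by (rule nn) simp
    also have "\<dots> = (\<integral>\<^sup>+ s. ennreal (e j s) + ennreal (e (j + 1) s) \<partial>\<nu>)"
    proof (rule nn_integral_cong_AE, use mom in eventually_elim)
      case (elim s)
      then have h: "has_bochner_integral (\<kappa> s) (\<lambda>x. x ^ (2 * j)) (e j s)"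
        "has_bochner_integral (\<kappa> s) (\<lambda>x. x ^ (2 * (j + 1))) (e (j + 1) s)"
        "has_bochner_integral (\<kappa> s) (\<lambda>x. x ^ (2 * j + 1)) 0" by (auto simp only: even_moments_def)
      have "(\<lambda>x. x ^ (2 * j) * (1 + x)\<^sup>2) = (\<lambda>x::real. x ^ (2 * j) + 2 * x ^ (2 * j + 1) + x ^ (2 * (j + 1)))"
        by (simp add: fun_eq_iff algebra_simps power2_eq_square)
      moreover have "has_bochner_integral (\<kappa> s) (\<lambda>x. x ^ (2 * j) + 2 * x ^ (2 * j + 1) + x ^ (2 * (j + 1))) (e j s + 2 * 0 + e (j + 1) s)"
        by (intro has_bochner_integral_add has_bochner_integral_mult_right h)
      ultimately have "has_bochner_integral (\<kappa> s) (\<lambda>x. x ^ (2 * j) * (1 + x)\<^sup>2) (e j s + e (j + 1) s)" by simp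
      moreover have "e j s \<ge> 0" "e (j + 1) s \<ge> 0"
        unfolding h(1,2)[THEN has_bochner_integral_integral_eq, symmetric]
        by (rule Bochner_Integration.integral_nonneg, rule zero_le_even_power, simp)+
      ultimately show ?case
        by (subst nn_integral_eq_integral) (auto simp: has_bochner_integral_iff zero_le_even_power)
    qed
    also have "\<dots> = ennreal (E j) + ennreal (E (j + 1))"
      by (subst nn_integral_add) (use \<nu>(2) in \<open>auto simp: e cong: measurable_cong_sets\<close>)
    finally show ?thesis using E by simp
  qed
  \<comment> \<open>The total mass of the mixture is its moment of order 0.\<close>
  have p: "prob_space ?\<mu>"
    using even[of 0] E(2) by (intro prob_spaceI) simp
  have he: "has_bochner_integral ?\<mu> (\<lambda>x. x ^ (2 * j)) (E j)" for j
    by (rule has_bochner_integral_nn_integral) (use even[of j] E in \<open>auto simp: zero_le_even_power\<close>)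
  have ho: "has_bochner_integral ?\<mu> (\<lambda>x. x ^ (2 * j + 1)) 0" for j
  proof -
    have "has_bochner_integral ?\<mu> (\<lambda>x. x ^ (2 * j) * (1 + x)\<^sup>2) (E j + E (j + 1))"
      by (rule has_bochner_integral_nn_integral) (use odd[of j] E in \<open>auto simp: zero_le_even_power\<close>)
    then have "has_bochner_integral ?\<mu> (\<lambda>x. (x ^ (2 * j) * (1 + x)\<^sup>2 - x ^ (2 * j) - x ^ (2 * (j + 1))) / 2)
        ((E j + E (j + 1) - E j - E (j + 1)) / 2)"
      by (intro has_bochner_integral_divide_zero has_bochner_integral_diff he)
    moreover have "(\<lambda>x. (x ^ (2 * j) * (1 + x)\<^sup>2 - x ^ (2 * j) - x ^ (2 * (j + 1))) / 2) = (\<lambda>x::real. x ^ (2 * j + 1))"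
      by (simp add: fun_eq_iff algebra_simps power2_eq_square)
    ultimately show ?thesis by simp
  qed
  show ?thesis
    unfolding even_moments_def real_distribution_def real_distribution_axioms_def
    using p he ho by auto
qed

section \<open>Gamma, chi and beta densities\<close>

text \<open>The substitution is made on [0, n], with image [0, n^2]. Reading both sides as measures
  of increasing sets passes to the half line, and the point 0 is a null set.\<close>

lemma nn_integral_square_substitution:
  fixes f :: "real \<Rightarrow> ennreal"
  assumes [measurable]: "f \<in> borel_measurable borel"
  shows "(\<integral>\<^sup>+ y. f y * indicator {0<..} y \<partial>lborel)
    = (\<integral>\<^sup>+ x. f (x\<^sup>2) * ennreal (2 * x) * indicator {0<..} x \<partial>lborel)"
proof -
  have U1: "(\<Union>n. {0..(real n)\<^sup>2}) = {0..}" and U2: "(\<Union>n. {0..real n}) = {0..}"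
  proof -
    show "(\<Union>n. {0..real n}) = {0..}" using real_arch_simple by auto
    have "\<exists>n. x \<le> (real n)\<^sup>2" for x
    proof -
      obtain n where "x \<le> real n" using real_arch_simple by blast
      also have "real n \<le> (real n)\<^sup>2" by (cases n) (auto simp: power2_eq_square)
      finally show ?thesis by blast
    qed
    then show "(\<Union>n. {0..(real n)\<^sup>2}) = {0..}" by auto
  qed
  have eq: "(\<integral>\<^sup>+ y. f y * indicator {0..(real n)\<^sup>2} y \<partial>lborel)
      = (\<integral>\<^sup>+ x. f (x\<^sup>2) * ennreal (2 * x) * indicator {0..real n} x \<partial>lborel)" for n
  \<comment> \<open>The substitution rule is for a proper interval; the degenerate one is a null set
    on both sides.\<close>
  proof (cases "n = 0")
    case True
    have "AE x in lborel. x \<noteq> (0::real)" by (rule AE_lborel_singleton)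
    then have "(\<integral>\<^sup>+ x. f x * indicator {0..0} x \<partial>lborel) = (\<integral>\<^sup>+ x. 0 \<partial>(lborel :: real measure))"
      "(\<integral>\<^sup>+ x. f (x\<^sup>2) * ennreal (2 * x) * indicator {0..0} x \<partial>lborel) = (\<integral>\<^sup>+ x. 0 \<partial>(lborel :: real measure))"
      by (intro nn_integral_cong_AE; eventually_elim; simp)+
    then show ?thesis by (simp add: True)
  next
    case False
    have "(\<integral>\<^sup>+ y. f y * indicator {0\<^sup>2..(real n)\<^sup>2} y \<partial>lborel)
      = (\<integral>\<^sup>+ x. f (x\<^sup>2) * ennreal (2 * x) * indicator {0..real n} x \<partial>lborel)"
      using False
      by (intro nn_integral_substitution_aux)
         (auto intro!: derivative_eq_intros continuous_intros)
    then show ?thesis by simp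
  qed
  have "(\<integral>\<^sup>+ y. f y * indicator {0..} y \<partial>lborel) = emeasure (density lborel f) (\<Union>n. {0..(real n)\<^sup>2})"
    unfolding U1 by (simp add: emeasure_density)
  also have "\<dots> = (SUP n. emeasure (density lborel f) {0..(real n)\<^sup>2})"
    by (intro SUP_emeasure_incseq[symmetric]) (auto simp: incseq_def intro: order_trans power_mono)
  also have "\<dots> = (SUP n. emeasure (density lborel (\<lambda>x. f (x\<^sup>2) * ennreal (2 * x))) {0..real n})"
    by (simp add: emeasure_density eq)
  also have "\<dots> = emeasure (density lborel (\<lambda>x. f (x\<^sup>2) * ennreal (2 * x))) (\<Union>n. {0..real n})"
    by (intro SUP_emeasure_incseq) (auto simp: incseq_def)
  also have "\<dots> = (\<integral>\<^sup>+ x. f (x\<^sup>2) * ennreal (2 * x) * indicator {0..} x \<partial>lborel)"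
    unfolding U2 by (simp add: emeasure_density)
  finally have *: "(\<integral>\<^sup>+ y. f y * indicator {0..} y \<partial>lborel)
    = (\<integral>\<^sup>+ x. f (x\<^sup>2) * ennreal (2 * x) * indicator {0..} x \<partial>lborel)" .
  have ae: "AE x in lborel. x \<noteq> (0::real)" by (rule AE_lborel_singleton)
  have "(\<integral>\<^sup>+ y. f y * indicator {0<..} y \<partial>lborel) = (\<integral>\<^sup>+ y. f y * indicator {0..} y \<partial>lborel)"
    by (intro nn_integral_cong_AE, use ae in eventually_elim) (auto split: split_indicator)
  moreover have "(\<integral>\<^sup>+ x. f (x\<^sup>2) * ennreal (2 * x) * indicator {0<..} x \<partial>lborel) =
    (\<integral>\<^sup>+ x. f (x\<^sup>2) * ennreal (2 * x) * indicator {0..} x \<partial>lborel)"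
    by (intro nn_integral_cong_AE, use ae in eventually_elim) (auto split: split_indicator)
  ultimately show ?thesis using * by simp
qed

text \<open>Shape \<open>a\<close> and scale \<open>\<theta>\<close>. The scale stays a parameter
  because all squared Brownian coordinates at time t share the scale 2 t.\<close>

definition gamma_density :: "real \<Rightarrow> real \<Rightarrow> real \<Rightarrow> real" where
  "gamma_density a \<theta> x =
     (if x > 0 then x powr (a - 1) * exp (- x / \<theta>) / (Gamma a * \<theta> powr a) else 0)"

lemma gamma_density_measurable [measurable]: "gamma_density a \<theta> \<in> borel_measurable borel"
  unfolding gamma_density_def by measurable

lemma gamma_density_nonneg: "a > 0 \<Longrightarrow> \<theta> > 0 \<Longrightarrow> gamma_density a \<theta> x \<ge> 0"
  by (simp add: gamma_density_def Gamma_real_pos less_imp_le)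

lemma nn_integral_gamma_density:
  assumes a: "a > 0" and \<theta>: "\<theta> > 0"
  shows "(\<integral>\<^sup>+ x. ennreal (gamma_density a \<theta> x) \<partial>lborel) = 1"
proof -
  have "(\<integral>\<^sup>+ x. ennreal (gamma_density a \<theta> x) \<partial>lborel)
      = ennreal \<theta> * (\<integral>\<^sup>+ u. ennreal (gamma_density a \<theta> (\<theta> * u)) \<partial>lborel)"
    using nn_integral_real_affine[of "\<lambda>x. ennreal (gamma_density a \<theta> x)" \<theta> 0] \<theta> by simp
  also have "\<dots> = (\<integral>\<^sup>+ u. ennreal (1 / Gamma a) * ennreal (indicator {0..} u * (u powr (a - 1) / exp u)) \<partial>lborel)"
  proof (subst nn_integral_cmult[symmetric], simp, rule nn_integral_cong_AE)
    have "AE u in lborel. u \<noteq> (0::real)" by (rule AE_lborel_singleton)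
    then show "AE u in lborel. ennreal \<theta> * ennreal (gamma_density a \<theta> (\<theta> * u)) =
      ennreal (1 / Gamma a) * ennreal (indicator {0..} u * (u powr (a - 1) / exp u))"
    proof eventually_elim
      case (elim u)
      show ?case
      proof (cases "u > 0")
        case True
        have "\<theta> * ((\<theta> * u) powr (a - 1) * exp (- u) / (Gamma a * \<theta> powr a))
          = \<theta> powr 1 * \<theta> powr (a - 1) / \<theta> powr a * (u powr (a - 1) * exp (- u) / Gamma a)"
          using True \<theta> by (simp add: powr_mult ac_simps)
        also have "\<dots> = u powr (a - 1) / exp u / Gamma a"
        proof -
          have "\<theta> powr 1 * \<theta> powr (a - 1) / \<theta> powr a = 1"
            unfolding powr_add[symmetric] using \<theta> by simp
          then show ?thesis by (simp only: exp_minus divide_inverse mult_1 mult.assoc)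
        qed
        finally show ?thesis using True \<theta> a
          by (simp add: gamma_density_def ennreal_mult'[symmetric] Gamma_real_pos less_imp_le)
      next
        case False
        then have "u < 0" "\<not> 0 < \<theta> * u" using elim \<theta> by (auto simp: zero_less_mult_iff)
        then show ?thesis by (simp add: gamma_density_def)
      qed
    qed
  qed
  also have "\<dots> = ennreal (1 / Gamma a) * ennreal (Gamma a)"
    using nn_integral_has_integral_lebesgue[OF _ Gamma_integral_real[OF a]]
    by (subst nn_integral_cmult) auto
  also have "\<dots> = 1"
    using Gamma_real_pos[OF a] by (simp add: ennreal_mult'[symmetric])
  finally show ?thesis .
qed

lemma nn_integral_Beta:
  assumes a: "a > 0" and b: "b > (0::real)"
  shows "(\<integral>\<^sup>+ u. ennreal (indicator {0<..<1} u * (u powr (a - 1) * (1 - u) powr (b - 1))) \<partial>lborel) = ennreal (Beta a b)"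
proof -
  have "((\<lambda>t. t powr (a - 1) * (1 - t) powr (b - 1)) has_integral Beta a b) {0<..<1}"
    using has_integral_Beta_real[OF a b] by (simp add: has_integral_Icc_iff_Ioo)
  from nn_integral_has_integral_lebesgue[OF _ this] show ?thesis by auto
qed

text \<open>The exponentials multiply to a factor independent of y, and y = x u turns the rest into
  a power of x times a beta integral, whose value supplies the normalising constant of shape a +
  b.\<close>

lemma convolution_gamma_density:
  assumes a: "a > 0" and b: "b > 0" and \<theta>: "\<theta> > 0"
  shows "(\<integral>\<^sup>+ y. ennreal (gamma_density a \<theta> (x - y)) * ennreal (gamma_density b \<theta> y) \<partial>lborel)
    = ennreal (gamma_density (a + b) \<theta> x)"
proof (cases "x > 0")
  case False
  then have "ennreal (gamma_density a \<theta> (x - y)) * ennreal (gamma_density b \<theta> y) = 0" for y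
    by (cases "y > 0") (auto simp: gamma_density_def)
  then show ?thesis using False by (subst nn_integral_cong[where v = "\<lambda>_. 0"]) (simp_all add: gamma_density_def)
next
  case x: True
  note [measurable] = gamma_density_measurable
  define C where "C = x powr (a + b - 1) * exp (- x / \<theta>) / (Gamma a * Gamma b * \<theta> powr (a + b))"
  have C: "C \<ge> 0" using a b by (simp add: C_def Gamma_real_pos less_imp_le)
  have "(\<integral>\<^sup>+ y. ennreal (gamma_density a \<theta> (x - y)) * ennreal (gamma_density b \<theta> y) \<partial>lborel)
    = ennreal x * (\<integral>\<^sup>+ u. ennreal (gamma_density a \<theta> (x - x * u)) * ennreal (gamma_density b \<theta> (x * u)) \<partial>lborel)"
    using nn_integral_real_affine[of "\<lambda>y. ennreal (gamma_density a \<theta> (x - y)) * ennreal (gamma_density b \<theta> y)" x 0] x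
    by simp
  also have "\<dots> = (\<integral>\<^sup>+ u. ennreal C * ennreal (indicator {0<..<1} u * (u powr (b - 1) * (1 - u) powr (a - 1))) \<partial>lborel)"
  proof (subst nn_integral_cmult[symmetric], simp, rule nn_integral_cong)
    fix u
    show "ennreal x * (ennreal (gamma_density a \<theta> (x - x * u)) * ennreal (gamma_density b \<theta> (x * u)))
       = ennreal C * ennreal (indicator {0<..<1} u * (u powr (b - 1) * (1 - u) powr (a - 1)))"
    proof (cases "0 < u \<and> u < 1")
      case True
      have e: "x - x * u = x * (1 - u)" by (simp add: algebra_simps)
      have "x * (gamma_density a \<theta> (x - x * u) * gamma_density b \<theta> (x * u))
        = (x powr 1 * x powr (a - 1) * x powr (b - 1)) * (exp (- (x * (1 - u)) / \<theta>) * exp (- (x * u) / \<theta>)) / (Gamma a * Gamma b * (\<theta> powr a * \<theta> powr b))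
           * (u powr (b - 1) * (1 - u) powr (a - 1))"
        unfolding e using True x by (simp add: gamma_density_def powr_mult divide_inverse ac_simps)
      also have "x powr 1 * x powr (a - 1) * x powr (b - 1) = x powr (a + b - 1)"
        unfolding powr_add[symmetric] by (simp add: algebra_simps)
      also have "exp (- (x * (1 - u)) / \<theta>) * exp (- (x * u) / \<theta>) = exp (- x / \<theta>)"
        unfolding exp_add[symmetric] using \<theta> by (simp add: field_simps)
      also have "\<theta> powr a * \<theta> powr b = \<theta> powr (a + b)" by (simp add: powr_add)
      finally have "x * (gamma_density a \<theta> (x - x * u) * gamma_density b \<theta> (x * u))
        = C * (u powr (b - 1) * (1 - u) powr (a - 1))" by (simp add: C_def)
      then show ?thesis using True x gamma_density_nonneg[OF a \<theta>] gamma_density_nonneg[OF b \<theta>] C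
        by (simp add: ennreal_mult'[symmetric])
    next
      case False
      have "gamma_density a \<theta> (x - x * u) = 0 \<or> gamma_density b \<theta> (x * u) = 0"
      proof (cases "u > 0")
        case True
        then have "u \<ge> 1" using False by simp
        then have "x * 1 \<le> x * u" using x by (intro mult_left_mono) auto
        then show ?thesis by (simp add: gamma_density_def)
      next
        case False
        then show ?thesis using x by (simp add: gamma_density_def zero_less_mult_iff)
      qed
      then show ?thesis using False by auto
    qed
  qed
  also have "\<dots> = ennreal C * ennreal (Beta b a)"
    by (subst nn_integral_cmult) (simp_all add: nn_integral_Beta[OF b a])
  also have "\<dots> = ennreal (gamma_density (a + b) \<theta> x)"
    using x C Gamma_real_pos[OF a] Gamma_real_pos[OF b]
    by (simp add: ennreal_mult''[symmetric] C_def gamma_density_def Beta_def mult_ac add.commute)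
  finally show ?thesis .
qed

text \<open>Folding the even integrand onto the positive half line doubles it; substituting y = x^2
  then produces the gamma density of shape 1/2 and scale 2 t.\<close>

lemma nn_integral_normal_square:
  fixes f :: "real \<Rightarrow> ennreal"
  assumes [measurable]: "f \<in> borel_measurable borel" and t: "t > 0"
  shows "(\<integral>\<^sup>+ x. f (x\<^sup>2) * ennreal (normal_density 0 (sqrt t) x) \<partial>lborel)
    = (\<integral>\<^sup>+ y. f y * ennreal (gamma_density (1 / 2) (2 * t) y) \<partial>lborel)"
proof -
  let ?h = "\<lambda>x. f (x\<^sup>2) * ennreal (normal_density 0 (sqrt t) x)"
  have ae: "AE x in lborel. x \<noteq> (0::real)" by (rule AE_lborel_singleton)
  have "(\<integral>\<^sup>+ x. ?h x \<partial>lborel) = (\<integral>\<^sup>+ x. ?h x * indicator {0<..} x + ?h x * indicator {..<0} x \<partial>lborel)"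
    by (intro nn_integral_cong_AE, use ae in eventually_elim) (auto split: split_indicator)
  also have "\<dots> = (\<integral>\<^sup>+ x. ?h x * indicator {0<..} x \<partial>lborel) + (\<integral>\<^sup>+ x. ?h x * indicator {..<0} x \<partial>lborel)"
    by (rule nn_integral_add) auto
  also have "(\<integral>\<^sup>+ x. ?h x * indicator {..<0} x \<partial>lborel) = (\<integral>\<^sup>+ x. ?h x * indicator {0<..} x \<partial>lborel)"
    using nn_integral_real_affine[of "\<lambda>x. ?h x * indicator {..<0} x" "- 1" 0]
    by (auto intro!: nn_integral_cong split: split_indicator simp: normal_density_def)
  also have "(\<integral>\<^sup>+ x. ?h x * indicator {0<..} x \<partial>lborel) + (\<integral>\<^sup>+ x. ?h x * indicator {0<..} x \<partial>lborel)
    = (\<integral>\<^sup>+ x. 2 * (?h x * indicator {0<..} x) \<partial>lborel)"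
    unfolding mult_2[symmetric] by (rule nn_integral_cmult[symmetric]) simp
  also have "\<dots> = (\<integral>\<^sup>+ x. (f (x\<^sup>2) * ennreal (gamma_density (1 / 2) (2 * t) (x\<^sup>2))) * ennreal (2 * x) * indicator {0<..} x \<partial>lborel)"
  proof (rule nn_integral_cong)
    fix x :: real
    have *: "ennreal (2 * normal_density 0 (sqrt t) x) = ennreal (gamma_density (1 / 2) (2 * t) (x\<^sup>2) * (2 * x))" if "x > 0"
    proof -
      have "(x\<^sup>2) powr (- (1 / 2)) = 1 / x" using that
        by (simp add: powr_minus_divide powr_half_sqrt)
      then have g: "gamma_density (1 / 2) (2 * t) (x\<^sup>2) = 1 / x * exp (- x\<^sup>2 / (2 * t)) / (sqrt pi * sqrt (2 * t))"
        using that t by (simp add: gamma_density_def Gamma_one_half_real powr_half_sqrt)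
      have n: "normal_density 0 (sqrt t) x = exp (- x\<^sup>2 / (2 * t)) / (sqrt pi * sqrt (2 * t))"
        using t unfolding normal_density_def real_sqrt_mult[symmetric] by (simp add: ac_simps)
      show ?thesis unfolding g n using that by (simp add: mult.commute)
    qed
    then show "2 * (?h x * indicator {0<..} x) =
       (f (x\<^sup>2) * ennreal (gamma_density (1 / 2) (2 * t) (x\<^sup>2))) * ennreal (2 * x) * indicator {0<..} x"
    proof (cases "x > 0")
      case True
      let ?g = "gamma_density (1 / 2) (2 * t) (x\<^sup>2)" and ?n = "normal_density 0 (sqrt t) x"
      have g0: "?g \<ge> 0" using t by (simp add: gamma_density_nonneg)
      have "2 * (f (x\<^sup>2) * ennreal ?n) = f (x\<^sup>2) * ennreal (2 * ?n)"
        by (simp add: ennreal_mult mult.left_commute)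
      also have "ennreal (2 * ?n) = ennreal (?g * (2 * x))" using * True by blast
      also have "\<dots> = ennreal ?g * ennreal (2 * x)" using True g0 by (intro ennreal_mult) auto
      finally show ?thesis using True by (simp add: mult.assoc)
    qed simp
  qed
  also have "\<dots> = (\<integral>\<^sup>+ y. (f y * ennreal (gamma_density (1 / 2) (2 * t) y)) * indicator {0<..} y \<partial>lborel)"
    by (rule nn_integral_square_substitution[symmetric]) simp
  also have "\<dots> = (\<integral>\<^sup>+ y. f y * ennreal (gamma_density (1 / 2) (2 * t) y) \<partial>lborel)"
    by (intro nn_integral_cong) (auto split: split_indicator simp: gamma_density_def)
  finally show ?thesis .
qed

text \<open>The value is 0 also for \<open>t \<le> 0\<close>. Products of these densities therefore
  vanish off the positive orthant and can be integrated over the whole space.\<close>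

definition chi_density :: "nat \<Rightarrow> real \<Rightarrow> real \<Rightarrow> real" where
  "chi_density d t r = (if r > 0 \<and> t > 0 then r ^ (d - 1) * exp (- r\<^sup>2 / (2 * t))
      / (Gamma (real d / 2) * 2 powr (real d / 2 - 1) * t powr (real d / 2)) else 0)"

lemma chi_density_measurable2 [measurable]:
  "(\<lambda>(t, r). chi_density d t r) \<in> borel_measurable (borel \<Otimes>\<^sub>M borel)"
  unfolding chi_density_def by measurable

lemma chi_density_measurable [measurable]: "chi_density d t \<in> borel_measurable borel"
  unfolding chi_density_def by measurable

lemma chi_density_nonneg: "chi_density d t r \<ge> 0"
proof (cases "d = 0")
  case False
  then show ?thesis by (simp add: chi_density_def Gamma_real_pos less_imp_le)
\<comment> \<open>For d = 0 the denominator contains \<open>Gamma 0\<close>, which is 0, so the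
  quotient is 0 as well.\<close>
qed (simp add: chi_density_def)

lemma nn_integral_chi_density:
  fixes f :: "real \<Rightarrow> ennreal"
  assumes [measurable]: "f \<in> borel_measurable borel" and d: "d \<ge> 1" and t: "t > 0"
  shows "(\<integral>\<^sup>+ y. ennreal (gamma_density (real d / 2) (2 * t) y) * f (sqrt y) \<partial>lborel)
    = (\<integral>\<^sup>+ x. ennreal (chi_density d t x) * f x \<partial>lborel)"
proof -
  let ?g = "gamma_density (real d / 2) (2 * t)"
  have "(\<integral>\<^sup>+ y. ennreal (?g y) * f (sqrt y) \<partial>lborel)
    = (\<integral>\<^sup>+ y. ennreal (?g y) * f (sqrt y) * indicator {0<..} y \<partial>lborel)"
    by (intro nn_integral_cong) (auto split: split_indicator simp: gamma_density_def)
  also have "\<dots> = (\<integral>\<^sup>+ x. ennreal (?g (x\<^sup>2)) * f (sqrt (x\<^sup>2)) * ennreal (2 * x) * indicator {0<..} x \<partial>lborel)"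
    by (rule nn_integral_square_substitution) simp
  also have "\<dots> = (\<integral>\<^sup>+ x. ennreal (chi_density d t x) * f x \<partial>lborel)"
  proof (rule nn_integral_cong)
    fix x :: real
    show "ennreal (?g (x\<^sup>2)) * f (sqrt (x\<^sup>2)) * ennreal (2 * x) * indicator {0<..} x
      = ennreal (chi_density d t x) * f x"
    proof (cases "x > 0")
      case True
      have "(x\<^sup>2) powr (real d / 2 - 1) * x = x powr (2 * (real d / 2 - 1)) * x powr 1"
        using True by (simp add: powr_powr flip: powr_numeral)
      also have "\<dots> = x powr (real (d - 1))"
        unfolding powr_add[symmetric] using d by (simp add: of_nat_diff)
      also have "\<dots> = x ^ (d - 1)"
        using True by (simp add: powr_realpow)
      finally have 1: "(x\<^sup>2) powr (real d / 2 - 1) * x = x ^ (d - 1)" .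
      have "(2 * t) powr (real d / 2) = 2 powr (1 + (real d / 2 - 1)) * t powr (real d / 2)"
        using t by (simp add: powr_mult)
      also have "\<dots> = 2 * 2 powr (real d / 2 - 1) * t powr (real d / 2)"
        unfolding powr_add by simp
      finally have 2: "(2 * t) powr (real d / 2) = 2 * 2 powr (real d / 2 - 1) * t powr (real d / 2)" .
      have "?g (x\<^sup>2) * (2 * x) = chi_density d t x"
        using True t unfolding gamma_density_def chi_density_def 2 1[symmetric] by (simp add: mult_ac)
      moreover have "?g (x\<^sup>2) \<ge> 0" using d t by (simp add: gamma_density_nonneg)
      ultimately have "ennreal (?g (x\<^sup>2)) * ennreal (2 * x) = ennreal (chi_density d t x)"
        using True by (simp add: ennreal_mult[symmetric])
      then show ?thesis using True by (simp add: ac_simps)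
    qed (simp add: chi_density_def)
  qed
  finally show ?thesis .
qed

lemma nn_integral_chi_density_1:
  assumes "d \<ge> 1" "t > 0"
  shows "(\<integral>\<^sup>+ x. ennreal (chi_density d t x) \<partial>lborel) = 1"
  using nn_integral_chi_density[of "\<lambda>_. 1" d t] nn_integral_gamma_density[of "real d / 2" "2 * t"] assms
  by simp

lemma nn_integral_chi_density_moment:
  assumes d: "d \<ge> 1" and t: "t > 0"
  shows "(\<integral>\<^sup>+ x. ennreal (chi_density d t x) * ennreal (x ^ (2 * j)) \<partial>lborel)
    = ennreal ((2 * t) ^ j * pochhammer (real d / 2) j)"
proof -
  have G: "Gamma (real (d + 2 * j) / 2) = pochhammer (real d / 2) j * Gamma (real d / 2)"
  proof -
    have h: "real d / 2 > 0" using d by simp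
    then have "real d / 2 \<notin> \<int>\<^sub>\<le>\<^sub>0" by (auto simp: nonpos_Ints_def)
    moreover have "Gamma (real d / 2) > 0" using h by (rule Gamma_real_pos)
    ultimately show ?thesis
      using pochhammer_Gamma[of "real d / 2" j] by (simp add: add_divide_distrib)
  qed
  have P: "pochhammer (real d / 2) j > 0" using d by (intro pochhammer_pos) simp
  \<comment> \<open>The weight raises the dimension from d to d + 2 j; the constant collects the
    ratio of the Gamma values and the powers of 2 and t.\<close>
  have "chi_density d t x * x ^ (2 * j) = (2 * t) ^ j * pochhammer (real d / 2) j * chi_density (d + 2 * j) t x" for x
  proof (cases "x > 0")
    case True
    have 1: "x ^ (d + 2 * j - 1) = x ^ (d - 1) * x ^ (2 * j)"
      using d by (simp flip: power_add)
    have 2: "(2::real) powr (real (d + 2 * j) / 2 - 1) = 2 powr (real d / 2 - 1) * 2 ^ j"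
    proof -
      have "real (d + 2 * j) / 2 - 1 = (real d / 2 - 1) + real j" by (simp add: add_divide_distrib)
      then show ?thesis by (simp only: powr_add powr_realpow)
    qed
    have 3: "t powr (real (d + 2 * j) / 2) = t powr (real d / 2) * t ^ j"
      using t by (simp flip: powr_realpow powr_add add: add_divide_distrib)
    show ?thesis using True t P unfolding chi_density_def G 1 2 3 by (simp add: power_mult_distrib mult_ac)
  qed (simp add: chi_density_def)
  then have "(\<integral>\<^sup>+ x. ennreal (chi_density d t x) * ennreal (x ^ (2 * j)) \<partial>lborel)
    = (\<integral>\<^sup>+ x. ennreal ((2 * t) ^ j * pochhammer (real d / 2) j) * ennreal (chi_density (d + 2 * j) t x) \<partial>lborel)"
    using P t by (intro nn_integral_cong)
      (simp add: ennreal_mult[symmetric] chi_density_nonneg zero_le_even_power)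
  also have "\<dots> = ennreal ((2 * t) ^ j * pochhammer (real d / 2) j)"
    using nn_integral_chi_density_1[of "d + 2 * j" t] d t by (subst nn_integral_cmult) auto
  finally show ?thesis .
qed

section \<open>Marginal laws of Bessel processes\<close>

lemma distributed_lborelI:
  assumes [measurable]: "X \<in> borel_measurable M" "f \<in> borel_measurable borel"
    and eq: "\<And>g. g \<in> borel_measurable borel \<Longrightarrow> (\<integral>\<^sup>+ \<omega>. g (X \<omega>) \<partial>M) = (\<integral>\<^sup>+ x. f x * g x \<partial>lborel)"
  shows "distributed M lborel X f"
  unfolding distributed_def
proof (intro conjI measure_eqI)
  fix A assume "A \<in> sets (distr M lborel X)"
  then have [measurable]: "A \<in> sets borel" by simp
  have "emeasure (distr M lborel X) A = (\<integral>\<^sup>+ x. indicator A x \<partial>distr M lborel X)"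
    by simp
  also have "\<dots> = (\<integral>\<^sup>+ \<omega>. indicator A (X \<omega>) \<partial>M)" by (subst nn_integral_distr) simp_all
  also have "\<dots> = emeasure (density lborel f) A"
    by (subst eq) (simp_all add: emeasure_density)
  finally show "emeasure (distr M lborel X) A = emeasure (density lborel f) A" .
qed simp_all

text \<open>Every square is gamma distributed with shape 1/2 and the same scale, and shapes add
  under convolution. The induction starts with one summand, since the empty sum has no
  density.\<close>

lemma (in prob_space) distributed_sum_squares:
  assumes X: "indep_vars (\<lambda>_. borel) X {1..d}"
    and N: "\<And>i. i \<in> {1..d} \<Longrightarrow> distributed M lborel (X i) (\<lambda>x. ennreal (normal_density 0 (sqrt t) x))"
    and d: "d \<ge> 1" and t: "t > 0"
  shows "distributed M lborel (\<lambda>\<omega>. \<Sum>i = 1..d. (X i \<omega>)\<^sup>2) (\<lambda>y. ennreal (gamma_density (real d / 2) (2 * t) y))"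
proof -
  have sq: "distributed M lborel (\<lambda>\<omega>. (X i \<omega>)\<^sup>2) (\<lambda>y. ennreal (gamma_density (1 / 2) (2 * t) y))"
    if i: "i \<in> {1..d}" for i
  proof (rule distributed_lborelI)
    have [measurable]: "X i \<in> borel_measurable M" using distributed_measurable[OF N[OF i]] by simp
    show "(\<lambda>\<omega>. (X i \<omega>)\<^sup>2) \<in> borel_measurable M" by simp
    fix g :: "real \<Rightarrow> ennreal" assume [measurable]: "g \<in> borel_measurable borel"
    have "(\<integral>\<^sup>+ \<omega>. g ((X i \<omega>)\<^sup>2) \<partial>M) = (\<integral>\<^sup>+ x. ennreal (normal_density 0 (sqrt t) x) * g (x\<^sup>2) \<partial>lborel)"
      by (rule distributed_nn_integral[OF N[OF i], symmetric]) simp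
    then show "(\<integral>\<^sup>+ \<omega>. g ((X i \<omega>)\<^sup>2) \<partial>M) = (\<integral>\<^sup>+ y. ennreal (gamma_density (1 / 2) (2 * t) y) * g y \<partial>lborel)"
      using nn_integral_normal_square[OF _ t, of g] by (simp add: mult.commute)
  qed simp
  have "k \<ge> 1 \<Longrightarrow> k \<le> d \<Longrightarrow> distributed M lborel (\<lambda>\<omega>. \<Sum>i = 1..k. (X i \<omega>)\<^sup>2) (\<lambda>y. ennreal (gamma_density (real k / 2) (2 * t) y))" for k
  proof (induction k rule: dec_induct)
    case base
    then show ?case using sq[of 1] d by simp
  next
    case (step k)
    have "indep_vars (\<lambda>_. borel) (\<lambda>i \<omega>. (X i \<omega>)\<^sup>2) (insert (Suc k) {1..k})"
      using step by (intro indep_vars_compose2[OF indep_vars_subset[OF X]]) auto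
    then have ind: "indep_var borel (\<lambda>\<omega>. (X (Suc k) \<omega>)\<^sup>2) borel (\<lambda>\<omega>. \<Sum>i = 1..k. (X i \<omega>)\<^sup>2)"
      by (intro indep_vars_sum) auto
    have e: "(\<integral>\<^sup>+ y. ennreal (gamma_density (1 / 2) (2 * t) (x - y)) * ennreal (gamma_density (real k / 2) (2 * t) y) \<partial>lborel)
      = ennreal (gamma_density (real (Suc k) / 2) (2 * t) x)" for x
      using convolution_gamma_density[of "1/2" "real k / 2" "2 * t" x] step t by (simp add: add_divide_distrib)
    have "distributed M lborel (\<lambda>\<omega>. (X (Suc k) \<omega>)\<^sup>2 + (\<Sum>i = 1..k. (X i \<omega>)\<^sup>2))
        (\<lambda>y. ennreal (gamma_density (real (Suc k) / 2) (2 * t) y))"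
      using distributed_convolution[OF ind sq step.IH] step by (simp add: e)
    then show ?case using step by (simp add: add.commute)
  qed
  then show ?thesis using d by simp
qed

text \<open>The hypotheses give the law of increments only, and \<open>W 0\<close> vanishes only
  almost surely; so \<open>W t\<close> is exchanged for \<open>W t - W 0\<close> under the
  integral.\<close>

lemma brownian_motion_distributed:
  assumes W: "brownian_motion M W" and t: "t > 0"
  shows "distributed M lborel (W t) (\<lambda>x. ennreal (normal_density 0 (sqrt t) x))"
proof (rule distributed_lborelI)
  show [measurable]: "W t \<in> borel_measurable M" using W t by (simp add: brownian_motion_def)
  have D: "distributed M lborel (\<lambda>\<omega>. W t \<omega> - W 0 \<omega>) (\<lambda>x. ennreal (normal_density 0 (sqrt t) x))"
    using W t unfolding brownian_motion_def by force
  fix g :: "real \<Rightarrow> ennreal" assume [measurable]: "g \<in> borel_measurable borel"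
  have "AE \<omega> in M. W 0 \<omega> = 0" using W by (simp add: brownian_motion_def)
  then have "(\<integral>\<^sup>+ \<omega>. g (W t \<omega>) \<partial>M) = (\<integral>\<^sup>+ \<omega>. g (W t \<omega> - W 0 \<omega>) \<partial>M)"
    by (intro nn_integral_cong_AE) (auto elim: eventually_mono)
  also have "\<dots> = (\<integral>\<^sup>+ x. ennreal (normal_density 0 (sqrt t) x) * g x \<partial>lborel)"
    by (rule distributed_nn_integral[OF D, symmetric]) simp
  finally show "(\<integral>\<^sup>+ \<omega>. g (W t \<omega>) \<partial>M) = (\<integral>\<^sup>+ x. ennreal (normal_density 0 (sqrt t) x) * g x \<partial>lborel)" .
qed simp

lemma (in prob_space) nn_integral_bessel:
  assumes W: "\<And>i. i \<in> {1..d} \<Longrightarrow> brownian_motion M (W i)"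
    and ind: "indep_vars (\<lambda>_. borel) (\<lambda>i. W i t) {1..d}"
    and d: "d \<ge> 1" and t: "t > 0" and [measurable]: "F \<in> borel_measurable borel"
  shows "(\<integral>\<^sup>+ \<omega>. F (bessel d W t \<omega>) \<partial>M) = (\<integral>\<^sup>+ x. ennreal (chi_density d t x) * F x \<partial>lborel)"
proof -
  note D = distributed_sum_squares[OF ind _ d t, OF brownian_motion_distributed[OF W t]]
  have "(\<integral>\<^sup>+ \<omega>. F (bessel d W t \<omega>) \<partial>M)
      = (\<integral>\<^sup>+ y. ennreal (gamma_density (real d / 2) (2 * t) y) * F (sqrt y) \<partial>lborel)"
    unfolding bessel_def
    by (rule distributed_nn_integral[OF D, where g = "\<lambda>y. F (sqrt y)", symmetric]) simp_all
  also have "\<dots> = (\<integral>\<^sup>+ x. ennreal (chi_density d t x) * F x \<partial>lborel)"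
    by (rule nn_integral_chi_density) (use d t in auto)
  finally show ?thesis .
qed

section \<open>Independent random times and iterated Bessel processes\<close>

text \<open>Rounding the time down to a multiple of 1 / (n + 1) leaves countably many times, for
  which joint measurability is clear; continuity of the paths gives the limit. The truncation
  \<open>max 0 s\<close> keeps the time in the half line on which the assumptions hold.\<close>

lemma continuous_process_measurable:
  fixes W :: "real \<Rightarrow> 'a \<Rightarrow> real"
  assumes W: "\<And>s. s \<ge> 0 \<Longrightarrow> W s \<in> borel_measurable N"
    and cont: "\<And>\<omega>. \<omega> \<in> space N \<Longrightarrow> continuous_on {0..} (\<lambda>s. W s \<omega>)"
  shows "(\<lambda>(s, \<omega>). W (max 0 s) \<omega>) \<in> borel_measurable ((borel :: real measure) \<Otimes>\<^sub>M N)"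
proof (rule borel_measurable_LIMSEQ_real)
  let ?i = "\<lambda>n (s::real). nat \<lfloor>max 0 s * real (Suc n)\<rfloor>"
  let ?u = "\<lambda>n (s, \<omega>). W (real (?i n s) / real (Suc n)) \<omega>"
  show "?u n \<in> borel_measurable ((borel :: real measure) \<Otimes>\<^sub>M N)" for n
  proof -
    have "(\<lambda>x. W (real k / real (Suc n)) (snd x)) \<in> borel_measurable ((borel :: real measure) \<Otimes>\<^sub>M N)" for k
      by (rule measurable_compose[OF measurable_snd W]) simp
    moreover have "(\<lambda>x. ?i n (fst x)) \<in> measurable ((borel :: real measure) \<Otimes>\<^sub>M N) (count_space UNIV)"
      by measurable
    ultimately show ?thesis
      unfolding case_prod_beta'
      by (rule measurable_compose_countable[of "\<lambda>k x. W (real k / real (Suc n)) (snd x)"])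
  qed
  fix x assume "x \<in> space ((borel :: real measure) \<Otimes>\<^sub>M N)"
  then obtain s \<omega> where x: "x = (s, \<omega>)" and \<omega>: "\<omega> \<in> space N" by (auto simp: space_pair_measure)
  define r where "r = max 0 s"
  have r: "r \<ge> 0" by (simp add: r_def)
  have "(\<lambda>n. real (?i n s) / real (Suc n)) \<longlonglongrightarrow> r"
  proof (rule tendsto_sandwich)
    show "\<forall>\<^sub>F n in sequentially. r - inverse (real (Suc n)) \<le> real (?i n s) / real (Suc n)"
    proof (intro always_eventually allI)
      fix n
      have "r * real (Suc n) - 1 \<le> real (?i n s)"
        unfolding r_def[symmetric] using r by (simp add: of_nat_nat)
      then have "(r * real (Suc n) - 1) / real (Suc n) \<le> real (?i n s) / real (Suc n)"
        by (rule divide_right_mono) simp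
      moreover have "(r * real (Suc n) - 1) / real (Suc n) = r - inverse (real (Suc n))"
        by (simp add: diff_divide_distrib inverse_eq_divide del: of_nat_Suc)
      ultimately show "r - inverse (real (Suc n)) \<le> real (?i n s) / real (Suc n)" by simp
    qed
    show "\<forall>\<^sub>F n in sequentially. real (?i n s) / real (Suc n) \<le> r"
    proof (intro always_eventually allI)
      fix n
      have "real (?i n s) \<le> r * real (Suc n)"
        unfolding r_def[symmetric] using r by simp
      then show "real (?i n s) / real (Suc n) \<le> r"
        by (simp add: pos_divide_le_eq del: of_nat_Suc)
    qed
    show "(\<lambda>n. r - inverse (real (Suc n))) \<longlonglongrightarrow> r"
      using tendsto_diff[OF tendsto_const LIMSEQ_inverse_real_of_nat, of r] by simp
  qed simp
  then have "(\<lambda>n. W (real (?i n s) / real (Suc n)) \<omega>) \<longlonglongrightarrow> W r \<omega>"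
    by (intro continuous_on_tendsto_compose[OF cont[OF \<omega>]]) (auto simp: r)
  then show "(\<lambda>n. ?u n x) \<longlonglongrightarrow> (case x of (s, \<omega>) \<Rightarrow> W (max 0 s) \<omega>)"
    by (simp add: x r_def)
qed

lemma (in prob_space) indep_vars_reindex:
  assumes inj: "inj_on f I" and X: "indep_vars M' X (f ` I)"
  shows "indep_vars (\<lambda>i. M' (f i)) (\<lambda>i. X (f i)) I"
  unfolding indep_vars_def2
proof (intro conjI ballI indep_setsI)
  fix i assume "i \<in> I"
  then show "random_variable (M' (f i)) (X (f i))" using X by (auto simp: indep_vars_def2)
  then show "{X (f i) -` A \<inter> space M |A. A \<in> sets (M' (f i))} \<subseteq> events" by auto
next
  fix A J assume J: "J \<noteq> {}" "J \<subseteq> I" "finite J"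
    and A: "\<forall>j\<in>J. A j \<in> {X (f j) -` A \<inter> space M |A. A \<in> sets (M' (f j))}"
  have injJ: "inj_on f J" using inj J(2) by (rule inj_on_subset)
  let ?A = "A \<circ> the_inv_into J f"
  have "indep_sets (\<lambda>i. {X i -` A \<inter> space M |A. A \<in> sets (M' i)}) (f ` I)"
    using X by (simp add: indep_vars_def2)
  then have "prob (\<Inter>j\<in>f ` J. ?A j) = (\<Prod>j\<in>f ` J. prob (?A j))"
  proof (rule indep_setsD)
    show "\<forall>j\<in>f ` J. ?A j \<in> {X j -` A \<inter> space M |A. A \<in> sets (M' j)}"
      using A by (simp add: the_inv_into_f_f[OF injJ])
  qed (use J in auto)
  then show "prob (\<Inter>j\<in>J. A j) = (\<Prod>j\<in>J. prob (A j))"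
    by (simp add: prod.reindex[OF injJ] the_inv_into_f_f[OF injJ])
qed

lemma (in prob_space) indep_elements_distr:
  assumes ind: "indep_elements M E X F Y"
  shows "distr M E X \<Otimes>\<^sub>M distr M F Y = distr M (E \<Otimes>\<^sub>M F) (\<lambda>\<omega>. (X \<omega>, Y \<omega>))"
proof -
  have X[measurable]: "X \<in> measurable M E" and Y[measurable]: "Y \<in> measurable M F"
    using ind by (auto simp: indep_elements_def)
  interpret X: prob_space "distr M E X" by (rule prob_space_distr) simp
  interpret Y: prob_space "distr M F Y" by (rule prob_space_distr) simp
  show ?thesis
  proof (rule pair_measure_eqI)
    fix A B assume "A \<in> sets (distr M E X)" "B \<in> sets (distr M F Y)"
    then have [measurable]: "A \<in> sets E" "B \<in> sets F" by auto
    have "prob ((X -` A \<inter> space M) \<inter> (Y -` B \<inter> space M)) = prob (X -` A \<inter> space M) * prob (Y -` B \<inter> space M)"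
      by (rule indep_setD) (use ind in \<open>auto simp: indep_elements_def intro!: in_vimage_algebra\<close>)
    moreover have "(\<lambda>\<omega>. (X \<omega>, Y \<omega>)) -` (A \<times> B) \<inter> space M = (X -` A \<inter> space M) \<inter> (Y -` B \<inter> space M)" by auto
    ultimately show "emeasure (distr M E X) A * emeasure (distr M F Y) B
        = emeasure (distr M (E \<Otimes>\<^sub>M F) (\<lambda>\<omega>. (X \<omega>, Y \<omega>))) (A \<times> B)"
      by (simp add: emeasure_distr emeasure_eq_measure ennreal_mult')
  qed (auto intro: X.sigma_finite_measure_axioms Y.sigma_finite_measure_axioms)
qed

lemma indep_elements_compose:
  assumes M: "prob_space M" and ind: "indep_elements M E X F Y"
    and f: "f \<in> measurable E E'" and g: "g \<in> measurable F F'"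
  shows "indep_elements M E' (\<lambda>\<omega>. f (X \<omega>)) F' (\<lambda>\<omega>. g (Y \<omega>))"
proof -
  interpret prob_space M by fact
  have XY: "X \<in> measurable M E" "Y \<in> measurable M F"
    using ind by (auto simp: indep_elements_def)
  have sub: "sets (vimage_algebra (space M) (\<lambda>\<omega>. f (X \<omega>)) E') \<subseteq> sets (vimage_algebra (space M) X E)"
    if X: "X \<in> measurable M E" and f: "f \<in> measurable E E'" for E E' X f
  proof -
    have "f (X \<omega>) \<in> space E'" "X \<omega> \<in> space E" if "\<omega> \<in> space M" for \<omega>
      using that measurable_space[OF X] measurable_space[OF f] by auto
    moreover have "\<exists>B. (\<lambda>\<omega>. f (X \<omega>)) -` A \<inter> space M = X -` B \<inter> space M \<and> B \<in> sets E" if "A \<in> sets E'" for A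
      using measurable_space[OF X] measurable_sets[OF f that]
      by (intro exI[of _ "f -` A \<inter> space E"]) auto
    ultimately show ?thesis
      by (subst (1 2) sets_vimage_algebra2) (blast+)
  qed
  have "indep_set (sets (vimage_algebra (space M) (\<lambda>\<omega>. f (X \<omega>)) E')) (sets (vimage_algebra (space M) (\<lambda>\<omega>. g (Y \<omega>)) F'))"
    unfolding indep_set_def
  proof (rule indep_sets_mono_sets)
    show "indep_sets (case_bool (sets (vimage_algebra (space M) X E)) (sets (vimage_algebra (space M) Y F))) UNIV"
      using ind by (simp add: indep_elements_def indep_set_def)
  qed (use sub[OF XY(1) f] sub[OF XY(2) g] in \<open>auto split: bool.splits\<close>)
  then show ?thesis
    unfolding indep_elements_def using measurable_compose[OF XY(1) f] measurable_compose[OF XY(2) g] by blast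
qed

text \<open>The random element \<open>Y\<close> is traded for the identity map into the
  sigma-algebra it generates. Functions of the outcome that are measurable for this sigma-algebra
  can then be used directly, without being factored through \<open>Y\<close>.\<close>

lemma indep_elements_vimage_algebra:
  assumes ind: "indep_elements M E X F Y"
  shows "indep_elements M E X (vimage_algebra (space M) Y F) (\<lambda>\<omega>. \<omega>)"
proof -
  have Y: "Y \<in> measurable M F" using ind by (simp add: indep_elements_def)
  let ?N = "vimage_algebra (space M) Y F"
  have "(\<lambda>\<omega>. \<omega>) \<in> measurable M ?N"
    by (rule measurable_vimage_algebra2) (use Y in auto)
  moreover have "sets (vimage_algebra (space M) (\<lambda>\<omega>. \<omega>) ?N) = sets ?N"
  proof -
    have "{A \<inter> space M |A. A \<in> sets ?N} = (\<lambda>A. A \<inter> space ?N) ` sets ?N" by auto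
    also have "\<dots> = (\<lambda>A. A) ` sets ?N" by (intro image_cong) (simp_all only: sets.Int_space_eq2)
    finally have "{A \<inter> space M |A. A \<in> sets ?N} = sets ?N" by simp
    then show ?thesis by (subst sets_vimage_algebra2) auto
  qed
  ultimately show ?thesis using ind by (simp add: indep_elements_def)
qed

lemma (in prob_space) indep_var_imp_indep_elements:
  assumes "indep_var E X F Y"
  shows "indep_elements M E X F Y"
  using assms unfolding indep_elements_def indep_var_eq sets_vimage_algebra by auto

text \<open>By independence the joint law of \<open>T\<close> and the identity into the
  sigma-algebra of \<open>Y\<close> is a product, so Tonelli's theorem lets the random time be
  frozen while the remaining randomness is integrated.\<close>

lemma (in prob_space) nn_integral_indep_random_time:
  assumes ind: "indep_elements M borel T E Y"
    and G: "G \<in> borel_measurable (borel \<Otimes>\<^sub>M vimage_algebra (space M) Y E)"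
  shows "(\<integral>\<^sup>+ \<omega>. G (T \<omega>, \<omega>) \<partial>M) = (\<integral>\<^sup>+ \<omega>'. (\<integral>\<^sup>+ \<omega>. G (T \<omega>', \<omega>) \<partial>M) \<partial>M)"
    and "(\<lambda>s. \<integral>\<^sup>+ \<omega>. G (s, \<omega>) \<partial>M) \<in> borel_measurable borel"
proof -
  let ?N = "vimage_algebra (space M) Y E"
  have T[measurable]: "T \<in> borel_measurable M" and Y: "Y \<in> measurable M E"
    using ind by (auto simp: indep_elements_def)
  have id: "(\<lambda>\<omega>. \<omega>) \<in> measurable M ?N"
    and eq: "distr M borel T \<Otimes>\<^sub>M distr M ?N (\<lambda>\<omega>. \<omega>) = distr M (borel \<Otimes>\<^sub>M ?N) (\<lambda>\<omega>. (T \<omega>, \<omega>))"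
    using indep_elements_vimage_algebra[OF ind]
    by (auto simp: indep_elements_def intro: indep_elements_distr)
  interpret T: prob_space "distr M borel T" by (rule prob_space_distr) simp
  interpret N: prob_space "distr M ?N (\<lambda>\<omega>. \<omega>)" by (rule prob_space_distr[OF id])
  note [measurable] = G id
  have in_eq: "(\<integral>\<^sup>+ \<omega>. G (s, \<omega>) \<partial>distr M ?N (\<lambda>\<omega>. \<omega>)) = (\<integral>\<^sup>+ \<omega>. G (s, \<omega>) \<partial>M)" for s
    by (rule nn_integral_distr) simp_all
  have "(\<lambda>s. \<integral>\<^sup>+ \<omega>. G (s, \<omega>) \<partial>distr M ?N (\<lambda>\<omega>. \<omega>)) \<in> borel_measurable borel"
    by measurable
  then show m: "(\<lambda>s. \<integral>\<^sup>+ \<omega>. G (s, \<omega>) \<partial>M) \<in> borel_measurable borel"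
    by (simp add: in_eq)
  have "(\<integral>\<^sup>+ \<omega>. G (T \<omega>, \<omega>) \<partial>M) = (\<integral>\<^sup>+ p. G p \<partial>(distr M borel T \<Otimes>\<^sub>M distr M ?N (\<lambda>\<omega>. \<omega>)))"
    unfolding eq by (rule nn_integral_distr[symmetric]) simp_all
  also have "\<dots> = (\<integral>\<^sup>+ s. (\<integral>\<^sup>+ \<omega>. G (s, \<omega>) \<partial>distr M ?N (\<lambda>\<omega>. \<omega>)) \<partial>distr M borel T)"
    by (rule N.nn_integral_fst[symmetric]) simp
  also have "\<dots> = (\<integral>\<^sup>+ \<omega>'. (\<integral>\<^sup>+ \<omega>. G (T \<omega>', \<omega>) \<partial>M) \<partial>M)"
    unfolding in_eq by (rule nn_integral_distr) (use m in simp_all)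
  finally show "(\<integral>\<^sup>+ \<omega>. G (T \<omega>, \<omega>) \<partial>M) = (\<integral>\<^sup>+ \<omega>'. (\<integral>\<^sup>+ \<omega>. G (T \<omega>', \<omega>) \<partial>M) \<partial>M)" .
qed

section \<open>Compositions of independent Bessel processes\<close>

lemma measurable_path_component:
  assumes "i \<in> I" "s \<in> J"
  shows "(\<lambda>f. f i s) \<in> borel_measurable (PiM I (\<lambda>_. path_space J))"
  using measurable_compose[OF measurable_component_singleton[OF assms(1)] measurable_component_singleton[OF assms(2)]] .

lemma bessel_nonneg: "bessel d W t \<omega> \<ge> 0"
  by (simp add: bessel_def sum_nonneg)

text \<open>Each stage is composed with the map sending (s, \<omega>) to the pair of the next Bessel
  value and \<omega> itself. Bessel values are nonnegative, so the truncation at 0 acts only on the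
  outermost argument s.\<close>

lemma iterated_bessel_measurable:
  assumes B: "\<And>k. k \<in> {1..l + 1} \<Longrightarrow>
    (\<lambda>(s, \<omega>). bessel d (B k) (max 0 s) \<omega>) \<in> borel_measurable (borel \<Otimes>\<^sub>M N)"
  shows "(\<lambda>(s, \<omega>). iterated_bessel d B l (max 0 s) \<omega>) \<in> borel_measurable (borel \<Otimes>\<^sub>M N)"
  using B
proof (induction l)
  case 0
  then show ?case by (simp add: iterated_bessel_def)
next
  case (Suc l)
  have [measurable]: "(\<lambda>(s, \<omega>). iterated_bessel d B l (max 0 s) \<omega>) \<in> borel_measurable (borel \<Otimes>\<^sub>M N)"
    by (rule Suc.IH) (use Suc.prems in auto)
  have [measurable]: "(\<lambda>(s, \<omega>). bessel d (B (l + 2)) (max 0 s) \<omega>) \<in> borel_measurable (borel \<Otimes>\<^sub>M N)"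
    by (rule Suc.prems) auto
  have "(\<lambda>p. (case_prod (\<lambda>s \<omega>. iterated_bessel d B l (max 0 s) \<omega>))
      (case_prod (\<lambda>s \<omega>. bessel d (B (l + 2)) (max 0 s) \<omega>) p, snd p)) \<in> borel_measurable (borel \<Otimes>\<^sub>M N)"
    by measurable
  then show ?case
    by (simp add: iterated_bessel_def case_prod_beta' max_absorb2[OF bessel_nonneg])
qed

text \<open>In total \<open>l + 1\<close> Bessel kernels act on \<open>F\<close>, in accordance with
  \<open>iterated\<close>. The outer integral belongs to the innermost process, the one that is
  evaluated at the deterministic time t.\<close>

primrec iter_chi :: "nat \<Rightarrow> nat \<Rightarrow> (real \<Rightarrow> ennreal) \<Rightarrow> real \<Rightarrow> ennreal" where
  "iter_chi d 0 F t = (\<integral>\<^sup>+ u. ennreal (chi_density d t u) * F u \<partial>lborel)"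
| "iter_chi d (Suc l) F t = (\<integral>\<^sup>+ u. ennreal (chi_density d t u) * iter_chi d l F u \<partial>lborel)"

text \<open>The innermost process uses Brownian motions independent of those of all outer processes,
  so its value can be frozen as a new starting time; hence t varies in the induction. The bound
  \<open>L\<close> stays fixed, so the assumptions on the Brownian motions hold unchanged at every
  stage.\<close>

lemma (in prob_space) nn_integral_iterated_bessel:
  assumes d: "d \<ge> 1"
    and B: "\<And>k i. k \<in> {1..L + 1} \<Longrightarrow> i \<in> {1..d} \<Longrightarrow> brownian_motion M (B k i)"
    and ind: "indep_vars (\<lambda>_. path_space {0..}) (\<lambda>(k, i). sample_path {0..} (B k i)) ({1..L + 1} \<times> {1..d})"
    and F[measurable]: "F \<in> borel_measurable borel"
    and l: "l \<le> L" and t: "t > 0"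
  shows "(\<integral>\<^sup>+ \<omega>. F (iterated_bessel d B l t \<omega>) \<partial>M) = iter_chi d l F t"
  using l t
proof (induction l arbitrary: t)
  have bes: "(\<integral>\<^sup>+ \<omega>. F (bessel d (B k) t \<omega>) \<partial>M) = (\<integral>\<^sup>+ x. ennreal (chi_density d t x) * F x \<partial>lborel)"
    if "k \<in> {1..L + 1}" "t > 0" "F \<in> borel_measurable borel" for k t F
  proof (rule nn_integral_bessel)
    have "indep_vars (\<lambda>i. path_space {0..}) (\<lambda>i. (\<lambda>(k, i). sample_path {0..} (B k i)) (k, i)) {1..d}"
    proof (rule indep_vars_reindex)
      show "indep_vars (\<lambda>_. path_space {0..}) (\<lambda>(k, i). sample_path {0..} (B k i)) (Pair k ` {1..d})"
        by (rule indep_vars_subset[OF ind]) (use that in auto)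
    qed (auto intro: inj_onI)
    then have "indep_vars (\<lambda>_. borel) (\<lambda>i \<omega>. (\<lambda>p. p t) ((\<lambda>(k, i). sample_path {0..} (B k i)) (k, i) \<omega>)) {1..d}"
      by (rule indep_vars_compose2) (use that in \<open>auto intro!: measurable_component_singleton\<close>)
    then show "indep_vars (\<lambda>_. borel) (\<lambda>i. B k i t) {1..d}"
      using that by simp
  qed (use that d B in auto)
  {
    case 0
    then show ?case using bes[of 1 t F] by (simp add: iterated_bessel_def)
  next
    case (Suc l)
    let ?A = "{1..l + 1} \<times> {1..d}" and ?K = "{l + 2} \<times> {1..d}"
    let ?P = "\<lambda>I. PiM I (\<lambda>_. path_space {0::real..})"
    let ?Y = "\<lambda>I \<omega>. restrict (\<lambda>ki. (case ki of (k, i) \<Rightarrow> sample_path {0..} (B k i)) \<omega>) I"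
    \<comment> \<open>This sigma-algebra is generated by the outer Brownian paths alone. Freezing
      the time requires joint measurability relative to it and not merely relative to
      \<open>M\<close>; continuity is pathwise and therefore still available.\<close>
    let ?N = "vimage_algebra (space M) (?Y ?A) (?P ?A)"
    let ?T = "\<lambda>\<omega>. bessel d (B (l + 2)) t \<omega>"
    have "indep_var (?P ?K) (?Y ?K) (?P ?A) (?Y ?A)"
      by (rule indep_var_restrict[OF ind]) (use Suc.prems in auto)
    then have "indep_elements M (?P ?K) (?Y ?K) (?P ?A) (?Y ?A)"
      by (rule indep_var_imp_indep_elements)
    then have "indep_elements M borel (\<lambda>\<omega>. sqrt (\<Sum>i = 1..d. (?Y ?K \<omega> (l + 2, i) t)\<^sup>2)) (?P ?A) (\<lambda>\<omega>. ?Y ?A \<omega>)"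
    proof (rule indep_elements_compose[OF prob_space_axioms])
      have [measurable]: "(\<lambda>f. f (l + 2, i) t) \<in> borel_measurable (?P ?K)" if "i \<in> {1..d}" for i
        by (rule measurable_path_component) (use that Suc.prems in auto)
      show "(\<lambda>f. sqrt (\<Sum>i = 1..d. (f (l + 2, i) t)\<^sup>2)) \<in> borel_measurable (?P ?K)"
        by measurable
    qed simp
    also have "(\<lambda>\<omega>. sqrt (\<Sum>i = 1..d. (?Y ?K \<omega> (l + 2, i) t)\<^sup>2)) = ?T"
      using Suc.prems by (auto simp: bessel_def fun_eq_iff)
    finally have indT: "indep_elements M borel ?T (?P ?A) (?Y ?A)" .
    then have Y: "?Y ?A \<in> measurable M (?P ?A)" by (simp add: indep_elements_def)
    have BN: "B k i s \<in> borel_measurable ?N" if "k \<in> {1..l + 1}" "i \<in> {1..d}" "s \<ge> 0" for k i s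
    proof -
      have "(\<lambda>\<omega>. (?Y ?A \<omega>) (k, i) s) \<in> borel_measurable ?N"
      proof (rule measurable_compose[OF measurable_vimage_algebra1])
        show "?Y ?A \<in> space M \<rightarrow> space (?P ?A)" using measurable_space[OF Y] by auto
        show "(\<lambda>f. f (k, i) s) \<in> borel_measurable (?P ?A)"
          by (rule measurable_path_component) (use that in auto)
      qed
      then show ?thesis using that by simp
    qed
    have "(\<lambda>(s, \<omega>). bessel d (B k) (max 0 s) \<omega>) \<in> borel_measurable (borel \<Otimes>\<^sub>M ?N)" if "k \<in> {1..l + 1}" for k
    proof -
      have "(\<lambda>(s, \<omega>). B k i (max 0 s) \<omega>) \<in> borel_measurable (borel \<Otimes>\<^sub>M ?N)" if "i \<in> {1..d}" for i
      proof (rule continuous_process_measurable)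
        show "continuous_on {0..} (\<lambda>s. B k i s \<omega>)" if "\<omega> \<in> space ?N" for \<omega>
          using B[of k i] \<open>k \<in> _\<close> \<open>i \<in> _\<close> Suc.prems that by (auto simp: brownian_motion_def)
      qed (use BN \<open>k \<in> _\<close> \<open>i \<in> _\<close> in auto)
      then show ?thesis
        unfolding bessel_def case_prod_beta' by measurable
    qed
    then have [measurable]: "(\<lambda>(s, \<omega>). iterated_bessel d B l (max 0 s) \<omega>) \<in> borel_measurable (borel \<Otimes>\<^sub>M ?N)"
      by (rule iterated_bessel_measurable)
    define G where "G = (\<lambda>p. F (case p of (s, \<omega>) \<Rightarrow> iterated_bessel d B l (max 0 s) \<omega>))"
    have G: "G \<in> borel_measurable (borel \<Otimes>\<^sub>M ?N)" unfolding G_def by measurable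
    note R = nn_integral_indep_random_time[OF indT G]
    have "(\<integral>\<^sup>+ \<omega>. F (iterated_bessel d B (Suc l) t \<omega>) \<partial>M) = (\<integral>\<^sup>+ \<omega>. G (?T \<omega>, \<omega>) \<partial>M)"
      by (simp add: G_def iterated_bessel_def max_absorb2[OF bessel_nonneg])
    also have "\<dots> = (\<integral>\<^sup>+ s. ennreal (chi_density d t s) * (\<integral>\<^sup>+ \<omega>. G (s, \<omega>) \<partial>M) \<partial>lborel)"
      unfolding R(1) by (rule bes) (use Suc.prems R(2) in auto)
    also have "\<dots> = iter_chi d (Suc l) F t"
      unfolding iter_chi.simps
    proof (rule nn_integral_cong)
      fix s :: real
      show "ennreal (chi_density d t s) * (\<integral>\<^sup>+ \<omega>. G (s, \<omega>) \<partial>M) = ennreal (chi_density d t s) * iter_chi d l F s"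
      \<comment> \<open>The induction hypothesis speaks of positive times only; elsewhere the kernel
        is 0.\<close>
      proof (cases "s > 0")
        case True
        then show ?thesis using Suc.IH[of s] Suc.prems by (simp add: G_def)
      qed (simp add: chi_density_def)
    qed
    finally show ?case .
  }
qed

section \<open>Moments of the motion\<close>

lemma power_fact_derivative:
  fixes c :: real
  assumes "(g has_real_derivative c) (at x)"
  shows "((\<lambda>x. g x ^ (i + 1) / fact (i + 1)) has_real_derivative c * (g x ^ i / fact i)) (at x)"
proof -
  have "((\<lambda>x. g x ^ (i + 1) / fact (i + 1)) has_real_derivative
      c * (real (i + 1) * g x ^ i) / fact (i + 1)) (at x)"
    using DERIV_cdivide[OF DERIV_power[OF assms, of "i + 1"], of "fact (i + 1)"] by simp
  moreover have "fact (i + 1) = real (i + 1) * fact i" by simp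
  then have "c * (real (i + 1) * g x ^ i) / fact (i + 1) = c * (g x ^ i / fact i)"
    by (simp only:) (simp del: of_nat_Suc of_nat_add)
  ultimately show ?thesis by simp
qed

text \<open>Divided powers are closed under convolution. Integration by parts moves one power from
  the second factor to the first: \<open>?F\<close> has as derivative the difference of the
  integrands for (i, q + 1) and (i + 1, q), and it vanishes at both end points.\<close>

lemma beta_monomials:
  fixes r :: real
  assumes r: "r \<ge> 0"
  shows "((\<lambda>x. (r - x) ^ i / fact i * (x ^ q / fact q)) has_integral r ^ (i + q + 1) / fact (i + q + 1)) {0..r}"
proof -
  have minus_derivative: "((\<lambda>x. r - x) has_real_derivative - 1) (at x)" for x
    by (auto intro!: derivative_eq_intros)
  show ?thesis
  proof (induction q arbitrary: i)
    case 0
    let ?F = "\<lambda>x::real. - ((r - x) ^ (i + 1) / fact (i + 1))"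
    have "((\<lambda>x. (r - x) ^ i / fact i) has_integral ?F r - ?F 0) {0..r}"
    proof (rule fundamental_theorem_of_calculus[OF r])
      fix x assume "x \<in> {0..r}"
      have "(?F has_real_derivative (r - x) ^ i / fact i) (at x)"
        using DERIV_minus[OF power_fact_derivative[OF minus_derivative, of i]] by simp
      then show "(?F has_vector_derivative (r - x) ^ i / fact i) (at x within {0..r})"
        by (simp add: has_real_derivative_iff_has_vector_derivative has_vector_derivative_at_within)
    qed
    then show ?case by simp
  next
    case (Suc q)
    let ?F = "\<lambda>x. - ((r - x) ^ (i + 1) / fact (i + 1) * (x ^ (q + 1) / fact (q + 1)))"
    let ?f = "\<lambda>x. (r - x) ^ i / fact i * (x ^ (q + 1) / fact (q + 1)) - (r - x) ^ (i + 1) / fact (i + 1) * (x ^ q / fact q)"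
    have "(?f has_integral ?F r - ?F 0) {0..r}"
    proof (rule fundamental_theorem_of_calculus[OF r])
      fix x assume "x \<in> {0..r}"
      have 1: "((\<lambda>x. (r - x) ^ (i + 1) / fact (i + 1)) has_real_derivative - ((r - x) ^ i / fact i)) (at x)"
        using power_fact_derivative[OF minus_derivative, of i] by simp
      have 2: "((\<lambda>x. x ^ (q + 1) / fact (q + 1)) has_real_derivative (x ^ q / fact q)) (at x)"
        using power_fact_derivative[OF DERIV_ident, of q] by simp
      have "(?F has_real_derivative ?f x) (at x)"
      proof (rule DERIV_cong[OF DERIV_minus[OF DERIV_mult[OF 1 2]]])
        have "- (- p * g + e * f) = p * g - f * e" for p g e f :: real by (simp add: algebra_simps)
        then show "- (- ((r - x) ^ i / fact i) * (x ^ (q + 1) / fact (q + 1)) + x ^ q / fact q * ((r - x) ^ (i + 1) / fact (i + 1))) = ?f x" .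
      qed
      then show "(?F has_vector_derivative ?f x) (at x within {0..r})"
        by (simp add: has_real_derivative_iff_has_vector_derivative has_vector_derivative_at_within)
    qed
    from has_integral_add[OF this Suc[of "i + 1"]] show ?case by simp
  qed
qed

text \<open>The joint law is a product, so Fubini's theorem integrates \<open>V\<close> against its
  density while \<open>X\<close> is frozen.\<close>

lemma (in prob_space) expectation_indep_density:
  fixes f :: "'b \<times> real \<Rightarrow> real"
  assumes ind: "indep_elements M E X borel V"
    and V: "distributed M lborel V (\<lambda>x. ennreal (p x))" and p: "\<And>x. p x \<ge> 0" "p \<in> borel_measurable borel"
    and f[measurable]: "f \<in> borel_measurable (E \<Otimes>\<^sub>M borel)"
    and int: "integrable M (\<lambda>\<omega>. f (X \<omega>, V \<omega>))"
  shows "expectation (\<lambda>\<omega>. f (X \<omega>, V \<omega>)) = expectation (\<lambda>\<omega>. LINT w|lborel. p w * f (X \<omega>, w))"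
proof -
  have X[measurable]: "X \<in> measurable M E" and V'[measurable]: "V \<in> borel_measurable M"
    using ind by (auto simp: indep_elements_def)
  note [measurable] = p(2)
  note eq = indep_elements_distr[OF ind]
  interpret X: prob_space "distr M E X" by (rule prob_space_distr) simp
  interpret V: prob_space "distr M borel V" by (rule prob_space_distr) simp
  interpret P: pair_sigma_finite "distr M E X" "distr M borel V" ..
  have "integrable (distr M E X \<Otimes>\<^sub>M distr M borel V) f"
    unfolding eq by (subst integrable_distr_eq) (use int in auto)
  then have "(LINT x|(distr M E X). LINT w|(distr M borel V). f (x, w)) = (LINT z|(distr M E X \<Otimes>\<^sub>M distr M borel V). f z)"
    by (rule P.integral_fst')
  also have "\<dots> = expectation (\<lambda>\<omega>. f (X \<omega>, V \<omega>))"
    unfolding eq by (subst integral_distr) auto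
  finally have "expectation (\<lambda>\<omega>. f (X \<omega>, V \<omega>)) = (LINT x|(distr M E X). LINT w|(distr M borel V). f (x, w))" ..
  also have "\<dots> = (LINT x|(distr M E X). LINT w|lborel. p w * f (x, w))"
  proof (rule Bochner_Integration.integral_cong[OF refl])
    fix x assume "x \<in> space (distr M E X)"
    then have [measurable]: "(\<lambda>w. f (x, w)) \<in> borel_measurable borel" by simp
    have "distr M borel V = density lborel (\<lambda>x. ennreal (p x))"
      using distributed_distr_eq_density[OF V] by (simp cong: distr_cong)
    then show "(LINT w|(distr M borel V). f (x, w)) = (LINT w|lborel. p w * f (x, w))"
      using p by (simp add: integral_real_density)
  qed
  also have "\<dots> = expectation (\<lambda>\<omega>. LINT w|lborel. p w * f (X \<omega>, w))"
    by (subst integral_distr) auto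
  finally show ?thesis .
qed

text \<open>The motion is reduced to what its moments depend on: exponential waiting times and
  bounded directions \<open>Y\<close> with common moments \<open>a\<close>. Indexing both families
  by one sum type states their joint independence in a single assumption.\<close>

locale random_flight = prob_space +
  fixes rate :: real and a :: "nat \<Rightarrow> real" and W Y :: "nat \<Rightarrow> 'a \<Rightarrow> real"
  assumes rate: "rate > 0"
    and indep: "indep_vars (\<lambda>_. borel) (case_sum W Y) UNIV"
    and W: "\<And>j. distributed M lborel (W j) (\<lambda>x. ennreal (exponential_density rate x))"
    and Y_bound: "\<And>j \<omega>. \<bar>Y j \<omega>\<bar> \<le> 1"
    and Y_moment: "\<And>j k. expectation (\<lambda>\<omega>. Y j \<omega> ^ k) = a k"
begin

text \<open>\<open>S n\<close> is the time of the n-th event and \<open>Z n\<close>, defined next,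
  the displacement accumulated by then at unit speed. Counting starts at 0, so \<open>W n\<close>
  and \<open>Y n\<close> belong to the step after the n-th event.\<close>

definition S :: "nat \<Rightarrow> 'a \<Rightarrow> real" where "S n \<omega> = (\<Sum>j<n. W j \<omega>)"
definition Z :: "nat \<Rightarrow> 'a \<Rightarrow> real" where "Z n \<omega> = (\<Sum>j<n. W j \<omega> * Y j \<omega>)"

lemma rv [measurable]: "W j \<in> borel_measurable M" "Y j \<in> borel_measurable M"
proof -
  have "random_variable borel (case_sum W Y i)" for i using indep by (simp add: indep_vars_def2)
  from this[of "Inl j"] this[of "Inr j"] show "W j \<in> borel_measurable M" "Y j \<in> borel_measurable M" by simp_all
qed

lemma SZ_measurable [measurable]: "S n \<in> borel_measurable M" "Z n \<in> borel_measurable M"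
  unfolding S_def Z_def by measurable

lemma AE_W_nonneg: "AE \<omega> in M. \<forall>j. W j \<omega> \<ge> 0"
proof (subst AE_all_countable, rule allI)
  fix j
  have "AE x in density lborel (\<lambda>x. ennreal (exponential_density rate x)). x \<ge> 0"
    by (subst AE_density) (auto simp: exponential_density_def)
  then have "AE x in distr M lborel (W j). x \<ge> 0"
    unfolding distributed_distr_eq_density[OF W] .
  then show "AE \<omega> in M. W j \<omega> \<ge> 0"
    by (subst (asm) AE_distr_iff) auto
qed

lemma S_nonneg: "\<forall>j. W j \<omega> \<ge> 0 \<Longrightarrow> S n \<omega> \<ge> 0"
  by (simp add: S_def sum_nonneg)

lemma abs_Z_le: "\<forall>j. W j \<omega> \<ge> 0 \<Longrightarrow> \<bar>Z n \<omega>\<bar> \<le> S n \<omega>"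
  unfolding S_def Z_def
  by (intro order_trans[OF sum_abs] sum_mono) (simp add: abs_mult mult_left_le Y_bound)

lemma indep_next:
  "indep_elements M (borel \<Otimes>\<^sub>M borel) (\<lambda>\<omega>. (S n \<omega>, Z n \<omega>)) borel (W n)"
  "indep_elements M (borel \<Otimes>\<^sub>M borel \<Otimes>\<^sub>M borel) (\<lambda>\<omega>. (W n \<omega>, S n \<omega>, Z n \<omega>)) borel (Y n)"
proof -
  let ?V = "case_sum W Y" and ?R = "Inl ` {..<n} \<union> Inr ` {..<n} :: (nat + nat) set"
  let ?P = "\<lambda>I. PiM I (\<lambda>_ :: nat + nat. borel :: real measure)"
  let ?r = "\<lambda>I \<omega>. restrict (\<lambda>i. ?V i \<omega>) I"
  let ?S = "\<lambda>f. \<Sum>j<n. f (Inl j)" and ?Z = "\<lambda>f. \<Sum>j<n. f (Inl j) * f (Inr j)"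
  have "indep_elements M (?P ?R) (?r ?R) (?P {Inl n}) (?r {Inl n})"
    by (intro indep_var_imp_indep_elements indep_var_restrict[OF indep]) auto
  then have "indep_elements M (borel \<Otimes>\<^sub>M borel) (\<lambda>\<omega>. (?S (?r ?R \<omega>), ?Z (?r ?R \<omega>))) borel (\<lambda>\<omega>. ?r {Inl n} \<omega> (Inl n))"
    by (rule indep_elements_compose[OF prob_space_axioms, where f = "\<lambda>f. (?S f, ?Z f)" and g = "\<lambda>f. f (Inl n)"]) measurable
  then show "indep_elements M (borel \<Otimes>\<^sub>M borel) (\<lambda>\<omega>. (S n \<omega>, Z n \<omega>)) borel (W n)"
    by (simp add: S_def Z_def)
  let ?R' = "insert (Inl n) ?R"
  have "indep_elements M (?P ?R') (?r ?R') (?P {Inr n}) (?r {Inr n})"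
    by (intro indep_var_imp_indep_elements indep_var_restrict[OF indep]) auto
  then have "indep_elements M (borel \<Otimes>\<^sub>M borel \<Otimes>\<^sub>M borel) (\<lambda>\<omega>. (?r ?R' \<omega> (Inl n), ?S (?r ?R' \<omega>), ?Z (?r ?R' \<omega>))) borel (\<lambda>\<omega>. ?r {Inr n} \<omega> (Inr n))"
    by (rule indep_elements_compose[OF prob_space_axioms, where f = "\<lambda>f. (f (Inl n), ?S f, ?Z f)" and g = "\<lambda>f. f (Inr n)"]) measurable
  then show "indep_elements M (borel \<Otimes>\<^sub>M borel \<Otimes>\<^sub>M borel) (\<lambda>\<omega>. (W n \<omega>, S n \<omega>, Z n \<omega>)) borel (Y n)"
    by (simp add: S_def Z_def)
qed

lemma expectation_mult_Y_power:
  assumes [measurable]: "g \<in> borel_measurable (borel \<Otimes>\<^sub>M borel \<Otimes>\<^sub>M borel)"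
    and int: "integrable M (\<lambda>\<omega>. g (W n \<omega>, S n \<omega>, Z n \<omega>))"
  shows "integrable M (\<lambda>\<omega>. g (W n \<omega>, S n \<omega>, Z n \<omega>) * Y n \<omega> ^ q)"
    and "expectation (\<lambda>\<omega>. g (W n \<omega>, S n \<omega>, Z n \<omega>) * Y n \<omega> ^ q)
      = a q * expectation (\<lambda>\<omega>. g (W n \<omega>, S n \<omega>, Z n \<omega>))"
proof -
  have "indep_elements M borel (\<lambda>\<omega>. g (W n \<omega>, S n \<omega>, Z n \<omega>)) borel (\<lambda>\<omega>. Y n \<omega> ^ q)"
    by (rule indep_elements_compose[OF prob_space_axioms indep_next(2), where f = g and g = "\<lambda>y. y ^ q" and E' = borel and F' = borel]) measurable
  then have ind: "indep_var borel (\<lambda>\<omega>. g (W n \<omega>, S n \<omega>, Z n \<omega>)) borel (\<lambda>\<omega>. Y n \<omega> ^ q)"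
    unfolding indep_elements_def indep_var_eq sets_vimage_algebra by auto
  have Yi: "integrable M (\<lambda>\<omega>. Y n \<omega> ^ q)"
    by (rule integrable_const_bound[where B = 1])
       (auto simp: power_abs intro!: power_le_one Y_bound)
  show "integrable M (\<lambda>\<omega>. g (W n \<omega>, S n \<omega>, Z n \<omega>) * Y n \<omega> ^ q)"
    by (rule indep_var_integrable[OF ind int Yi])
  show "expectation (\<lambda>\<omega>. g (W n \<omega>, S n \<omega>, Z n \<omega>) * Y n \<omega> ^ q)
      = a q * expectation (\<lambda>\<omega>. g (W n \<omega>, S n \<omega>, Z n \<omega>))"
    using indep_var_lebesgue_integral[OF ind int Yi] by (simp add: Y_moment)
qed

text \<open>The factor exp(rate u) compensates the exponential density of a waiting time, and the
  divided power of s - u measures the room that is left before s. Integrating out a waiting time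
  thus maps this family into itself, with a larger index i.\<close>

definition h :: "real \<Rightarrow> nat \<Rightarrow> real \<Rightarrow> real" where
  "h s i u = (if u \<le> s then (s - u) ^ i / fact i * exp (rate * u) else 0)"

lemma h_measurable [measurable]: "h s i \<in> borel_measurable borel"
  unfolding h_def by measurable

lemma h_bound: "0 \<le> u \<Longrightarrow> 0 \<le> s \<Longrightarrow> \<bar>h s i u\<bar> \<le> s ^ i * exp (rate * s)"
proof (cases "u \<le> s")
  case True
  assume u: "0 \<le> u"
  have "(s - u) ^ i / fact i \<le> (s - u) ^ i / 1"
    using True by (intro divide_left_mono) (auto intro: fact_ge_1)
  also have "\<dots> \<le> s ^ i" using True u by (simp add: power_mono)
  finally have "(s - u) ^ i / fact i * exp (rate * u) \<le> s ^ i * exp (rate * s)"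
    using True u rate by (intro mult_mono) auto
  then show ?thesis using True by (simp add: h_def)
qed (simp add: h_def)


text \<open>The exponentials combine to the constant exp(rate u), and \<open>beta_monomials\<close>
  on [0, s - u] evaluates the rest. For u > s the integrand is 0, because waiting times are
  nonnegative.\<close>

lemma integral_exponential_h:
  assumes u: "0 \<le> u"
  shows "(LINT w|lborel. exponential_density rate w * (h s i (u + w) * (w ^ q / fact q))) = rate * h s (i + q + 1) u"
proof (cases "u \<le> s")
  case False
  then have "(\<lambda>w. exponential_density rate w * (h s i (u + w) * (w ^ q / fact q))) = (\<lambda>_. 0)"
    by (auto simp: exponential_density_def h_def fun_eq_iff)
  then show ?thesis using False by (simp only:) (simp add: h_def)
next
  case True
  let ?r = "s - u"
  let ?f = "\<lambda>w. (?r - w) ^ i / fact i * (w ^ q / fact q)"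
  have eq: "(\<lambda>w. exponential_density rate w * (h s i (u + w) * (w ^ q / fact q)))
    = (\<lambda>w. rate * exp (rate * u) * (indicator {0..?r} w *\<^sub>R ?f w))"
    by (auto simp: fun_eq_iff exponential_density_def h_def diff_diff_eq exp_add[symmetric] ring_distribs
      split: split_indicator simp flip: mult.assoc)
  have val: "(LINT w:{0..?r}|lborel. ?f w) = ?r ^ (i + q + 1) / fact (i + q + 1)"
  proof -
    have "set_integrable lborel {0..?r} ?f"
      by (rule borel_integrable_atLeastAtMost') (auto intro!: continuous_intros)
    then have "(LINT w:{0..?r}|lborel. ?f w) = integral {0..?r} ?f"
      by (rule set_borel_integral_eq_integral)
    also have "\<dots> = ?r ^ (i + q + 1) / fact (i + q + 1)"
      by (rule integral_unique[OF beta_monomials]) (use True in simp)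
    finally show ?thesis .
  qed
  have "(LINT w|lborel. exponential_density rate w * (h s i (u + w) * (w ^ q / fact q)))
    = rate * exp (rate * u) * (LINT w:{0..?r}|lborel. ?f w)"
    unfolding eq set_lebesgue_integral_def by (rule integral_mult_right_zero)
  then show ?thesis unfolding val using True by (simp add: h_def)
qed

lemma integral_exponential_tail:
  assumes "u \<le> s"
  shows "(LINT w|lborel. exponential_density rate w * (if s < u + w then 1 else 0)) = exp (- (rate * (s - u)))"
proof -
  have "(LINT w|lborel. exponential_density rate w * (if s < u + w then 1 else 0))
    = expectation (\<lambda>\<omega>. if s < u + W 0 \<omega> then 1 else 0)"
    by (rule distributed_integral[OF W]) (auto simp: exponential_density_nonneg[OF rate])
  also have "\<dots> = expectation (indicator {\<omega> \<in> space M. s - u < W 0 \<omega>})"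
    by (rule Bochner_Integration.integral_cong) (auto simp: indicator_def algebra_simps)
  also have "\<dots> = prob {\<omega> \<in> space M. s - u < W 0 \<omega>}"
    by simp
  also have "\<dots> = exp (- (rate * (s - u)))"
    using exponential_distributedD_gt[OF W, of "s - u" 0] assms rate by (simp add: algebra_simps)
  finally show ?thesis .
qed

text \<open>One step of the flight is removed at a time: a power of \<open>Y n\<close> contributes a
  moment from \<open>a\<close>, and integrating out \<open>W n\<close> raises i. The index i
  therefore has to be arbitrary in the induction.\<close>

lemma expectation_h_Z:
  assumes s: "s \<ge> 0"
  shows "expectation (\<lambda>\<omega>. h s i (S n \<omega>) * (Z n \<omega> ^ k / fact k))
    = rate ^ n * (Abs_fps a ^ n) $ k * s ^ (n + k + i) / fact (n + k + i)"
proof (induction n arbitrary: i k)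
  case 0
  then show ?case using s by (cases k) (simp_all add: S_def Z_def h_def prob_space)
next
  case (Suc n)
  let ?T = "\<lambda>j \<omega>. h s i (S n \<omega> + W n \<omega>) * (Z n \<omega> ^ j / fact j) * (W n \<omega> ^ (k - j) / fact (k - j))"
  have int: "integrable M (?T j)" for j
  proof (rule integrable_const_bound)
    show "AE \<omega> in M. norm (?T j \<omega>) \<le> (s ^ i * exp (rate * s)) * s ^ j * s ^ (k - j)"
      using AE_W_nonneg
    proof eventually_elim
      case (elim \<omega>)
      note S0 = S_nonneg[OF elim, of n] and ZS = abs_Z_le[OF elim, of n]
      have W0: "W n \<omega> \<ge> 0" using elim by simp
      show ?case
      \<comment> \<open>Where \<open>h\<close> does not vanish, the time, the waiting time and the
        displacement are all at most s in absolute value.\<close>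
      proof (cases "S n \<omega> + W n \<omega> \<le> s")
        case True
        have p: "\<bar>x ^ q / fact q\<bar> \<le> s ^ q" if "\<bar>x\<bar> \<le> s" for x :: real and q
        proof -
          have "\<bar>x ^ q / fact q\<bar> \<le> \<bar>x\<bar> ^ q / 1"
            unfolding abs_divide power_abs by (intro divide_left_mono) (auto intro: fact_ge_1)
          also have "\<dots> \<le> s ^ q" using that by (simp add: power_mono)
          finally show ?thesis .
        qed
        have "norm (?T j \<omega>) = \<bar>h s i (S n \<omega> + W n \<omega>)\<bar> * \<bar>Z n \<omega> ^ j / fact j\<bar> * \<bar>W n \<omega> ^ (k - j) / fact (k - j)\<bar>"
          by (simp only: real_norm_def abs_mult)
        also have "\<dots> \<le> (s ^ i * exp (rate * s)) * s ^ j * s ^ (k - j)"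
          using True S0 W0 ZS s by (intro mult_mono h_bound p) auto
        finally show ?thesis .
      qed (use s in \<open>simp add: h_def\<close>)
    qed
  qed measurable
  have "h s i (S (Suc n) \<omega>) * (Z (Suc n) \<omega> ^ k / fact k) = (\<Sum>j\<le>k. ?T j \<omega> * Y n \<omega> ^ (k - j))" for \<omega>
  proof -
    \<comment> \<open>Divided powers absorb the binomial coefficients, which is what later produces
      a plain Cauchy product.\<close>
    have "Z (Suc n) \<omega> ^ k / fact k = (\<Sum>j\<le>k. (Z n \<omega> ^ j / fact j) * ((W n \<omega> * Y n \<omega>) ^ (k - j) / fact (k - j)))"
      by (simp add: Z_def binomial_ring sum_divide_distrib binomial_fact)
    then show ?thesis by (simp add: S_def sum_distrib_left power_mult_distrib mult_ac)
  qed
  then have "expectation (\<lambda>\<omega>. h s i (S (Suc n) \<omega>) * (Z (Suc n) \<omega> ^ k / fact k))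
      = expectation (\<lambda>\<omega>. \<Sum>j\<le>k. ?T j \<omega> * Y n \<omega> ^ (k - j))" by simp
  also have "\<dots> = (\<Sum>j\<le>k. a (k - j) * expectation (?T j))"
  proof -
    have *: "integrable M (\<lambda>\<omega>. ?T j \<omega> * Y n \<omega> ^ (k - j)) \<and> expectation (\<lambda>\<omega>. ?T j \<omega> * Y n \<omega> ^ (k - j)) = a (k - j) * expectation (?T j)" for j
      using expectation_mult_Y_power[of "\<lambda>(w, u, z). h s i (u + w) * (z ^ j / fact j) * (w ^ (k - j) / fact (k - j))" n "k - j"] int[of j]
      by simp
    show ?thesis using * by (subst Bochner_Integration.integral_sum) auto
  qed
  also have "\<dots> = (\<Sum>j\<le>k. a (k - j) * (rate * (rate ^ n * (Abs_fps a ^ n) $ j * s ^ (n + j + (i + (k - j) + 1)) / fact (n + j + (i + (k - j) + 1)))))"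
  proof (intro sum.cong refl arg_cong2[where f = "(*)"])
    fix j
    let ?f = "\<lambda>p. h s i (fst (fst p) + snd p) * (snd (fst p) ^ j / fact j) * (snd p ^ (k - j) / fact (k - j))"
    have "expectation (?T j) = expectation (\<lambda>\<omega>. ?f ((S n \<omega>, Z n \<omega>), W n \<omega>))" by simp
    also have "\<dots> = expectation (\<lambda>\<omega>. LINT w|lborel. exponential_density rate w * ?f ((S n \<omega>, Z n \<omega>), w))"
      by (rule expectation_indep_density[OF indep_next(1) W])
        (use int in \<open>auto simp: exponential_density_nonneg[OF rate]\<close>)
    also have "\<dots> = expectation (\<lambda>\<omega>. rate * (h s (i + (k - j) + 1) (S n \<omega>) * (Z n \<omega> ^ j / fact j)))"
    proof (rule integral_cong_AE)
      show "AE \<omega> in M. (LINT w|lborel. exponential_density rate w * ?f ((S n \<omega>, Z n \<omega>), w))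
        = rate * (h s (i + (k - j) + 1) (S n \<omega>) * (Z n \<omega> ^ j / fact j))"
        using AE_W_nonneg
      proof eventually_elim
        case (elim \<omega>)
        have "(LINT w|lborel. exponential_density rate w * ?f ((S n \<omega>, Z n \<omega>), w))
          = (LINT w|lborel. (Z n \<omega> ^ j / fact j) * (exponential_density rate w * (h s i (S n \<omega> + w) * (w ^ (k - j) / fact (k - j)))))"
          by (simp add: mult_ac)
        also have "\<dots> = (Z n \<omega> ^ j / fact j) * (rate * h s (i + (k - j) + 1) (S n \<omega>))"
          by (simp only: integral_mult_right_zero integral_exponential_h[OF S_nonneg[OF elim]])
        finally show ?case by simp
      qed
    qed measurable
    also have "\<dots> = rate * expectation (\<lambda>\<omega>. h s (i + (k - j) + 1) (S n \<omega>) * (Z n \<omega> ^ j / fact j))"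
      by (rule integral_mult_right_zero)
    finally show "expectation (?T j) = rate * (rate ^ n * (Abs_fps a ^ n) $ j * s ^ (n + j + (i + (k - j) + 1)) / fact (n + j + (i + (k - j) + 1)))"
      unfolding Suc.IH .
  qed
  also have "\<dots> = (\<Sum>j\<le>k. rate ^ Suc n * ((Abs_fps a ^ n) $ j * a (k - j)) * s ^ (Suc n + k + i) / fact (Suc n + k + i))"
  proof (intro sum.cong refl)
    fix j assume "j \<in> {..k}"
    \<comment> \<open>The exponent is the same for all j, so the power of s and the factorial leave
      the sum, and the j-sum becomes the coefficient of a product of series.\<close>
    then have e: "n + j + (i + (k - j) + 1) = Suc n + k + i" by simp
    show "a (k - j) * (rate * (rate ^ n * (Abs_fps a ^ n) $ j * s ^ (n + j + (i + (k - j) + 1)) / fact (n + j + (i + (k - j) + 1))))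
      = rate ^ Suc n * ((Abs_fps a ^ n) $ j * a (k - j)) * s ^ (Suc n + k + i) / fact (Suc n + k + i)"
      unfolding e by (simp add: mult_ac del: fact_Suc)
  qed
  also have "\<dots> = rate ^ Suc n * (Abs_fps a ^ Suc n) $ k * s ^ (Suc n + k + i) / fact (Suc n + k + i)"
    unfolding power_Suc2 by (simp only: sum_divide_distrib[symmetric] sum_distrib_left[symmetric] sum_distrib_right[symmetric] fps_mult_nth atLeast0AtMost fps_nth_Abs_fps)
  finally show ?case .
qed


text \<open>On the event that exactly \<open>n\<close> waiting times fit into \<open>[0, s]\<close>, the displacement at
  time \<open>s\<close> is \<open>Z n + (s - S n) * Y n\<close>.\<close>

lemma expectation_flight:
  fixes n :: nat
  assumes s: "s \<ge> 0"
  defines "N \<equiv> (\<lambda>\<omega>. if S n \<omega> \<le> s \<and> s < S n \<omega> + W n \<omega> then 1 else 0 :: real)"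
  shows "expectation (\<lambda>\<omega>. N \<omega> * ((Z n \<omega> + (s - S n \<omega>) * Y n \<omega>) ^ k / fact k))
    = exp (- (rate * s)) * rate ^ n * (Abs_fps a ^ (n + 1)) $ k * s ^ (n + k) / fact (n + k)"
proof -
  let ?T = "\<lambda>j \<omega>. N \<omega> * ((s - S n \<omega>) ^ (k - j) / fact (k - j)) * (Z n \<omega> ^ j / fact j)"
  let ?g = "\<lambda>j (w, u, z). (if u \<le> s \<and> s < u + w then 1 else 0 :: real) * ((s - u) ^ (k - j) / fact (k - j)) * (z ^ j / fact j)"
  have int: "integrable M (?T j)" for j
  proof (rule integrable_const_bound)
    show "AE \<omega> in M. norm (?T j \<omega>) \<le> 1 * s ^ (k - j) * s ^ j"
      using AE_W_nonneg
    proof eventually_elim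
      case (elim \<omega>)
      note S0 = S_nonneg[OF elim, of n] and ZS = abs_Z_le[OF elim, of n]
      show ?case
      proof (cases "S n \<omega> \<le> s \<and> s < S n \<omega> + W n \<omega>")
        case True
        have p: "\<bar>x ^ q / fact q\<bar> \<le> s ^ q" if "\<bar>x\<bar> \<le> s" for x :: real and q
        proof -
          have "\<bar>x ^ q / fact q\<bar> \<le> \<bar>x\<bar> ^ q / 1"
            unfolding abs_divide power_abs by (intro divide_left_mono) (auto intro: fact_ge_1)
          also have "\<dots> \<le> s ^ q" using that by (simp add: power_mono)
          finally show ?thesis .
        qed
        have "norm (?T j \<omega>) = \<bar>N \<omega>\<bar> * \<bar>(s - S n \<omega>) ^ (k - j) / fact (k - j)\<bar> * \<bar>Z n \<omega> ^ j / fact j\<bar>"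
          by (simp only: real_norm_def abs_mult)
        also have "\<dots> \<le> 1 * s ^ (k - j) * s ^ j"
          using True S0 ZS s by (intro mult_mono p) (auto simp: N_def)
        finally show ?thesis .
      next
        case False
        then have "N \<omega> = 0" by (simp add: N_def)
        then show ?thesis using s by simp
      qed
    qed
  qed (unfold N_def, measurable)
  have "N \<omega> * ((Z n \<omega> + (s - S n \<omega>) * Y n \<omega>) ^ k / fact k) = (\<Sum>j\<le>k. ?T j \<omega> * Y n \<omega> ^ (k - j))" for \<omega>
  proof -
    have "(Z n \<omega> + (s - S n \<omega>) * Y n \<omega>) ^ k / fact k
        = (\<Sum>j\<le>k. (Z n \<omega> ^ j / fact j) * (((s - S n \<omega>) * Y n \<omega>) ^ (k - j) / fact (k - j)))"
      by (simp add: binomial_ring sum_divide_distrib binomial_fact)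
    then show ?thesis by (simp add: sum_distrib_left power_mult_distrib mult_ac)
  qed
  then have "expectation (\<lambda>\<omega>. N \<omega> * ((Z n \<omega> + (s - S n \<omega>) * Y n \<omega>) ^ k / fact k))
      = expectation (\<lambda>\<omega>. \<Sum>j\<le>k. ?T j \<omega> * Y n \<omega> ^ (k - j))" by simp
  also have "\<dots> = (\<Sum>j\<le>k. a (k - j) * expectation (?T j))"
  proof -
    have *: "integrable M (\<lambda>\<omega>. ?T j \<omega> * Y n \<omega> ^ (k - j)) \<and> expectation (\<lambda>\<omega>. ?T j \<omega> * Y n \<omega> ^ (k - j)) = a (k - j) * expectation (?T j)" for j
      using expectation_mult_Y_power[of "?g j" n "k - j"] int[of j]
      by (simp add: N_def)
    show ?thesis using * by (subst Bochner_Integration.integral_sum) auto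
  qed
  also have "\<dots> = (\<Sum>j\<le>k. a (k - j) * (exp (- (rate * s)) * (rate ^ n * (Abs_fps a ^ n) $ j * s ^ (n + j + (k - j)) / fact (n + j + (k - j)))))"
  proof (intro sum.cong refl arg_cong2[where f = "(*)"])
    fix j
    let ?f = "\<lambda>p. (if fst (fst p) \<le> s \<and> s < fst (fst p) + snd p then 1 else 0 :: real)
        * ((s - fst (fst p)) ^ (k - j) / fact (k - j)) * (snd (fst p) ^ j / fact j)"
    have "expectation (?T j) = expectation (\<lambda>\<omega>. ?f ((S n \<omega>, Z n \<omega>), W n \<omega>))" by (simp add: N_def)
    also have "\<dots> = expectation (\<lambda>\<omega>. LINT w|lborel. exponential_density rate w * ?f ((S n \<omega>, Z n \<omega>), w))"
      by (rule expectation_indep_density[OF indep_next(1) W])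
        (use int in \<open>auto simp: exponential_density_nonneg[OF rate] N_def\<close>)
    also have "\<dots> = expectation (\<lambda>\<omega>. exp (- (rate * s)) * (h s (k - j) (S n \<omega>) * (Z n \<omega> ^ j / fact j)))"
    proof (rule Bochner_Integration.integral_cong[OF refl])
      fix \<omega>
      let ?c = "((s - S n \<omega>) ^ (k - j) / fact (k - j)) * (Z n \<omega> ^ j / fact j)"
      show "(LINT w|lborel. exponential_density rate w * ?f ((S n \<omega>, Z n \<omega>), w))
        = exp (- (rate * s)) * (h s (k - j) (S n \<omega>) * (Z n \<omega> ^ j / fact j))"
      proof (cases "S n \<omega> \<le> s")
        case True
        then have "(LINT w|lborel. exponential_density rate w * ?f ((S n \<omega>, Z n \<omega>), w))
          = (LINT w|lborel. ?c * (exponential_density rate w * (if s < S n \<omega> + w then 1 else 0)))"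
          by (intro Bochner_Integration.integral_cong) auto
        also have "\<dots> = ?c * exp (- (rate * (s - S n \<omega>)))"
          by (simp only: integral_mult_right_zero integral_exponential_tail[OF True])
        \<comment> \<open>The waiting time that overshoots s contributes its tail probability;
          splitting off exp(- rate s) leaves exactly the exponential factor of
          \<open>h\<close>.\<close>
        also have "exp (- (rate * (s - S n \<omega>))) = exp (- (rate * s)) * exp (rate * S n \<omega>)"
          by (simp add: exp_add[symmetric] algebra_simps)
        finally show ?thesis using True by (simp add: h_def)
      qed (simp add: h_def)
    qed
    also have "\<dots> = exp (- (rate * s)) * expectation (\<lambda>\<omega>. h s (k - j) (S n \<omega>) * (Z n \<omega> ^ j / fact j))"
      by (rule integral_mult_right_zero)
    finally show "expectation (?T j) = exp (- (rate * s)) * (rate ^ n * (Abs_fps a ^ n) $ j * s ^ (n + j + (k - j)) / fact (n + j + (k - j)))"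
      unfolding expectation_h_Z[OF s] .
  qed
  also have "\<dots> = (\<Sum>j\<le>k. exp (- (rate * s)) * rate ^ n * ((Abs_fps a ^ n) $ j * a (k - j)) * s ^ (n + k) / fact (n + k))"
  proof (intro sum.cong refl)
    fix j assume "j \<in> {..k}"
    then have e: "n + j + (k - j) = n + k" by simp
    show "a (k - j) * (exp (- (rate * s)) * (rate ^ n * (Abs_fps a ^ n) $ j * s ^ (n + j + (k - j)) / fact (n + j + (k - j))))
      = exp (- (rate * s)) * rate ^ n * ((Abs_fps a ^ n) $ j * a (k - j)) * s ^ (n + k) / fact (n + k)"
      unfolding e by (simp add: mult_ac)
  qed
  also have "\<dots> = exp (- (rate * s)) * rate ^ n * (Abs_fps a ^ (n + 1)) $ k * s ^ (n + k) / fact (n + k)"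
    unfolding Suc_eq_plus1[symmetric] power_Suc2 by (simp only: sum_divide_distrib[symmetric] sum_distrib_left[symmetric] sum_distrib_right[symmetric] fps_mult_nth atLeast0AtMost fps_nth_Abs_fps)
  finally show ?thesis .
qed

end

text \<open>A finite set of indices splits into a left and a right half. Each half yields an event
  in the sigma-algebra of one family, so independence of the families separates the halves and
  independence within each family finishes.\<close>

lemma (in prob_space) indep_vars_case_sum:
  fixes X :: "'i \<Rightarrow> 'a \<Rightarrow> 'b" and Y :: "'j \<Rightarrow> 'a \<Rightarrow> 'b"
  assumes X: "indep_vars (\<lambda>_. N) X UNIV" and Y: "indep_vars (\<lambda>_. N) Y UNIV"
    and XY: "indep_elements M (PiM UNIV (\<lambda>_. N)) (\<lambda>\<omega> i. X i \<omega>) (PiM UNIV (\<lambda>_. N)) (\<lambda>\<omega> j. Y j \<omega>)"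
  shows "indep_vars (\<lambda>_. N) (case_sum X Y) UNIV"
  unfolding indep_vars_def2
proof (intro conjI ballI indep_setsI)
  fix i :: "'i + 'j"
  show rv: "random_variable N (case_sum X Y i)"
    using X Y by (cases i) (auto simp: indep_vars_def2)
  show "{case_sum X Y i -` A \<inter> space M |A. A \<in> sets N} \<subseteq> events"
    using rv by auto
next
  fix A and J :: "('i + 'j) set"
  assume J: "finite J" and A: "\<forall>j\<in>J. A j \<in> {case_sum X Y j -` A \<inter> space M |A. A \<in> sets N}" and ne: "J \<noteq> {}"
  obtain C where C: "\<And>j. j \<in> J \<Longrightarrow> A j = case_sum X Y j -` C j \<inter> space M" "\<And>j. j \<in> J \<Longrightarrow> C j \<in> sets N"
    using A by simp metis
  define J1 where "J1 = Inl -` J"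
  define J2 where "J2 = Inr -` J"
  have J12: "J = Inl ` J1 \<union> Inr ` J2"
  proof -
    have "x \<in> Inl ` J1 \<union> Inr ` J2" if "x \<in> J" for x
      using that by (cases x) (auto simp: J1_def J2_def)
    then show ?thesis by (auto simp: J1_def J2_def)
  qed
  have fin: "finite J1" "finite J2"
    unfolding J1_def J2_def using J by (auto intro: finite_vimageI)
  \<comment> \<open>Intersecting with \<open>space M\<close> covers an empty half, for which the
    bare intersection would be the whole type.\<close>
  have half: "prob (space M \<inter> (\<Inter>i\<in>K. V i -` D i \<inter> space M)) = (\<Prod>i\<in>K. prob (V i -` D i \<inter> space M))
      \<and> space M \<inter> (\<Inter>i\<in>K. V i -` D i \<inter> space M) \<in> sets (vimage_algebra (space M) (\<lambda>\<omega> i. V i \<omega>) (PiM UNIV (\<lambda>_. N)))"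
    if V: "indep_vars (\<lambda>_. N) V UNIV" and K: "finite K" and D: "\<And>i. i \<in> K \<Longrightarrow> D i \<in> sets N"
    for V :: "'k \<Rightarrow> 'a \<Rightarrow> 'b" and K D
  proof
    show "prob (space M \<inter> (\<Inter>i\<in>K. V i -` D i \<inter> space M)) = (\<Prod>i\<in>K. prob (V i -` D i \<inter> space M))"
    proof (cases "K = {}")
      case False
      then have "space M \<inter> (\<Inter>i\<in>K. V i -` D i \<inter> space M) = (\<Inter>i\<in>K. V i -` D i \<inter> space M)" by auto
      also have "prob \<dots> = (\<Prod>i\<in>K. prob (V i -` D i \<inter> space M))"
        by (rule indep_setsD[where I = UNIV and F = "\<lambda>i. {V i -` A \<inter> space M |A. A \<in> sets N}"])
           (use V K D False in \<open>auto simp: indep_vars_def2\<close>)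
      finally show ?thesis .
    qed (simp add: prob_space)
    have "(\<lambda>i. V i \<omega>) \<in> space (PiM UNIV (\<lambda>_. N))" if "\<omega> \<in> space M" for \<omega>
    proof -
      have "V i \<omega> \<in> space N" for i
        using V that by (auto simp: indep_vars_def2 dest: measurable_space)
      then show ?thesis by (simp add: space_PiM PiE_UNIV_domain)
    qed
    then have eq: "space M \<inter> (\<Inter>i\<in>K. V i -` D i \<inter> space M) = (\<lambda>\<omega> i. V i \<omega>) -` {f \<in> space (PiM UNIV (\<lambda>_. N)). \<forall>i\<in>K. f i \<in> D i} \<inter> space M"
      by auto
    have mem: "{f \<in> space (PiM UNIV (\<lambda>_. N)). \<forall>i\<in>K. f i \<in> D i} \<in> sets (PiM UNIV (\<lambda>_. N))"
      using K D by (intro sets.sets_Collect_finite_All) (auto intro!: measurable_sets_Collect measurable_component_singleton)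
    show "space M \<inter> (\<Inter>i\<in>K. V i -` D i \<inter> space M) \<in> sets (vimage_algebra (space M) (\<lambda>\<omega> i. V i \<omega>) (PiM UNIV (\<lambda>_. N)))"
      unfolding eq by (rule in_vimage_algebra[OF mem])
  qed
  let ?P1 = "space M \<inter> (\<Inter>i\<in>J1. X i -` C (Inl i) \<inter> space M)" and ?P2 = "space M \<inter> (\<Inter>i\<in>J2. Y i -` C (Inr i) \<inter> space M)"
  have h1: "prob ?P1 = (\<Prod>i\<in>J1. prob (X i -` C (Inl i) \<inter> space M))" 
    "?P1 \<in> sets (vimage_algebra (space M) (\<lambda>\<omega> i. X i \<omega>) (PiM UNIV (\<lambda>_. N)))"
    using half[OF X fin(1), of "\<lambda>i. C (Inl i)"] C(2) by (auto simp: J12)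
  have h2: "prob ?P2 = (\<Prod>i\<in>J2. prob (Y i -` C (Inr i) \<inter> space M))"
    "?P2 \<in> sets (vimage_algebra (space M) (\<lambda>\<omega> i. Y i \<omega>) (PiM UNIV (\<lambda>_. N)))"
    using half[OF Y fin(2), of "\<lambda>i. C (Inr i)"] C(2) by (auto simp: J12)
  have "(\<Inter>j\<in>J. A j) = (\<Inter>j\<in>J. case_sum X Y j -` C j \<inter> space M)"
    by (intro INF_cong refl) (rule C(1))
  also have "\<dots> = ?P1 \<inter> ?P2" using ne by (auto simp: J12 ball_Un)
  also have "prob \<dots> = prob ?P1 * prob ?P2"
    by (rule indep_setD[OF _ h1(2) h2(2)]) (use XY in \<open>simp add: indep_elements_def\<close>)
  also have "\<dots> = (\<Prod>i\<in>J1. prob (A (Inl i))) * (\<Prod>i\<in>J2. prob (A (Inr i)))"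
    unfolding h1 h2 by (intro arg_cong2[where f = "(*)"] prod.cong) (auto simp: C(1) J12)
  also have "\<dots> = (\<Prod>j\<in>J. prob (A j))"
    unfolding J12 by (subst prod.union_disjoint) (auto simp: fin prod.reindex)
  finally show "prob (\<Inter>j\<in>J. A j) = (\<Prod>j\<in>J. prob (A j))" .
qed

text \<open>The recursion is the vanishing of the integral of the derivative of cos^(k + 1) sin^(2 m
  + 1), with sin^2 = 1 - cos^2 used once; for I 1 the antiderivative is a power of the sine.\<close>

lemma cos_sin_moment_recursion:
  fixes m k :: nat
  defines "I \<equiv> \<lambda>k. integral {0..pi} (\<lambda>x. cos x ^ k * sin x ^ (2 * m))"
  shows "(real k + 2 + 2 * real m) * I (k + 2) = real (k + 1) * I k" "I 1 = 0"
proof -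
  have int: "(\<lambda>x. cos x ^ k * sin x ^ (2 * m)) integrable_on {0..pi}" for k
    by (intro integrable_continuous_real continuous_intros)
  have has: "((\<lambda>x. cos x ^ k * sin x ^ (2 * m)) has_integral I k) {0..pi}" for k
    unfolding I_def by (rule integrable_integral[OF int])
  let ?f = "\<lambda>x. (real k + 2 + 2 * real m) * (cos x ^ (k + 2) * sin x ^ (2 * m)) - real (k + 1) * (cos x ^ k * sin x ^ (2 * m))"
  let ?F = "\<lambda>x. cos x ^ (k + 1) * sin x ^ (2 * m + 1)"
  have "(?f has_integral ?F pi - ?F 0) {0..pi}"
  proof (rule fundamental_theorem_of_calculus)
    fix x :: real
    have "?f x = (real (2 * m + 1) * sin x ^ (2 * m) * cos x) * cos x ^ (k + 1) + (- (real (k + 1) * cos x ^ k * sin x)) * sin x ^ (2 * m + 1)"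
    proof -
      have "(- (real (k + 1) * cos x ^ k * sin x)) * sin x ^ (2 * m + 1) = - (real (k + 1) * cos x ^ k * sin x ^ (2 * m) * (sin x)\<^sup>2)"
        by (simp add: power2_eq_square mult_ac)
      also have "\<dots> = - (real (k + 1) * cos x ^ k * sin x ^ (2 * m) * (1 - (cos x)\<^sup>2))"
        by (simp add: sin_squared_eq)
      finally show ?thesis by (simp add: algebra_simps power2_eq_square)
    qed
    moreover have "(?F has_real_derivative (real (2 * m + 1) * sin x ^ (2 * m) * cos x) * cos x ^ (k + 1) + (- (real (k + 1) * cos x ^ k * sin x)) * sin x ^ (2 * m + 1)) (at x)"
      by (rule DERIV_cong[OF DERIV_mult[OF DERIV_power[OF DERIV_cos, of "k + 1"] DERIV_power[OF DERIV_sin, of "2 * m + 1"]]])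
         (simp add: mult_ac del: power_Suc of_nat_Suc of_nat_add)
    ultimately show "(?F has_vector_derivative ?f x) (at x within {0..pi})"
      by (simp add: has_real_derivative_iff_has_vector_derivative has_vector_derivative_at_within)
  qed simp
  moreover have "(?f has_integral (real k + 2 + 2 * real m) * I (k + 2) - real (k + 1) * I k) {0..pi}"
    by (intro has_integral_diff has_integral_mult_right has)
  ultimately show "(real k + 2 + 2 * real m) * I (k + 2) = real (k + 1) * I k"
    by (auto dest: has_integral_unique)
  let ?G = "\<lambda>x. sin x ^ (2 * m + 1) / real (2 * m + 1)"
  have "((\<lambda>x. cos x ^ 1 * sin x ^ (2 * m)) has_integral ?G pi - ?G 0) {0..pi}"
  proof (rule fundamental_theorem_of_calculus)
    fix x :: real
    have "(?G has_real_derivative cos x ^ 1 * sin x ^ (2 * m)) (at x)"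
      using DERIV_cdivide[OF DERIV_power[OF DERIV_sin, of "2 * m + 1"], of "real (2 * m + 1)"]
      by (simp del: of_nat_Suc of_nat_add of_nat_mult)
    then show "(?G has_vector_derivative cos x ^ 1 * sin x ^ (2 * m)) (at x within {0..pi})"
      by (simp add: has_real_derivative_iff_has_vector_derivative has_vector_derivative_at_within)
  qed simp
  then show "I 1 = 0"
    unfolding I_def by (subst integral_unique) auto
qed

text \<open>Up to a constant the moments are the trigonometric integrals, hence they obey the
  recursion of \<open>sym_moment\<close>. The start values are the total mass 1 and the vanishing
  first moment.\<close>

lemma (in prob_space) expectation_cos_power:
  assumes D: "distributed M lborel U (\<lambda>x. ennreal (angle_density m x))"
  shows "expectation (\<lambda>\<omega>. cos (U \<omega>) ^ k) = sym_moment (real m) k"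
proof -
  define C where "C = Gamma (real m + 1) / (sqrt pi * Gamma (real m + 1 / 2))"
  have C: "C \<ge> 0" unfolding C_def by (simp add: Gamma_real_pos less_imp_le)
  have [measurable]: "angle_density m \<in> borel_measurable borel"
    unfolding angle_density_def by measurable
  have nonneg: "angle_density m x \<ge> 0" for x
    using C unfolding angle_density_def C_def[symmetric] by (simp add: zero_le_even_power)
  let ?I = "\<lambda>k. integral {0..pi} (\<lambda>x. cos x ^ k * sin x ^ (2 * m))"
  define e where "e k = expectation (\<lambda>\<omega>. cos (U \<omega>) ^ k)" for k
  have e: "e k = C * ?I k" for k
  proof -
    let ?f = "\<lambda>x. cos x ^ k * sin x ^ (2 * m)"
    have "e k = (LINT x|lborel. angle_density m x * cos x ^ k)"
      unfolding e_def by (rule distributed_integral[OF D, symmetric]) (auto simp: nonneg)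
    also have "\<dots> = (LINT x|lborel. C * (indicator {0<..<pi} x *\<^sub>R ?f x))"
      by (simp add: angle_density_def C_def mult_ac)
    also have "\<dots> = C * (LINT x:{0<..<pi}|lborel. ?f x)"
      unfolding set_lebesgue_integral_def by (rule integral_mult_right_zero)
    also have "(LINT x:{0<..<pi}|lborel. ?f x) = integral {0<..<pi} ?f"
    proof (rule set_borel_integral_eq_integral)
      have "set_integrable lborel {0..pi} ?f"
        by (rule borel_integrable_atLeastAtMost') (auto intro!: continuous_intros)
      then show "set_integrable lborel {0<..<pi} ?f"
        by (rule set_integrable_subset) auto
    qed
    also have "\<dots> = ?I k" by (rule integral_open_interval_real[symmetric])
    finally show ?thesis .
  qed
  have e0: "e 0 = 1" by (simp add: e_def prob_space)
  have "e k = sym_moment (real m) k \<and> e (Suc k) = sym_moment (real m) (Suc k)"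
  proof (induction k)
    case 0
    have "e 1 = 0" unfolding e cos_sin_moment_recursion(2) by simp
    then show ?case using e0 by (simp add: sym_moment_0 sym_moment_1)
  next
    case (Suc k)
    have "(real k + 2 + 2 * real m) * e (k + 2) = real (k + 1) * e k"
      using cos_sin_moment_recursion(1)[of k m] unfolding e by (simp add: mult.left_commute)
    also have "\<dots> = (real k + 2 + 2 * real m) * sym_moment (real m) (k + 2)"
      using sym_moment_step[of "real m" k] Suc by simp
    finally have "e (k + 2) = sym_moment (real m) (k + 2)"
      using of_nat_0_le_iff[of k, where 'a = real] of_nat_0_le_iff[of m, where 'a = real] by (simp only: mult_cancel_left) linarith
    with Suc show ?case by simp
  qed
  then show ?thesis by (simp add: e_def)
qed

lemma (in prob_space) random_flight_of_motion:
  assumes "rate > 0"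
    and S: "poisson_event_times M rate S" and \<Theta>: "iid_angles M m \<Theta>"
    and ind: "indep_var (path_space UNIV) (sample_path UNIV S) (path_space {1..}) (sample_path {1..} \<Theta>)"
  shows "random_flight M rate (sym_moment (real m)) (\<lambda>j \<omega>. S (Suc j) \<omega> - S j \<omega>) (\<lambda>j \<omega>. cos (\<Theta> (Suc j) \<omega>))"
proof (unfold_locales)
  let ?W = "\<lambda>j \<omega>. S (Suc j) \<omega> - S j \<omega>" and ?Y = "\<lambda>j \<omega>. cos (\<Theta> (Suc j) \<omega>)"
  have W: "indep_vars (\<lambda>_. borel) ?W UNIV" using S by (simp add: poisson_event_times_def)
  have "Suc ` UNIV = {1..}"
  proof -
    have "k \<in> range Suc" if "k \<ge> 1" for k using that by (cases k) auto
    then show ?thesis by auto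
  qed
  then have "indep_vars (\<lambda>_. borel) \<Theta> (Suc ` UNIV)" using \<Theta> by (simp add: iid_angles_def)
  then have "indep_vars (\<lambda>_. borel) (\<lambda>j. \<Theta> (Suc j)) UNIV"
    using indep_vars_reindex[of Suc UNIV "\<lambda>_. borel" \<Theta>] by simp
  then have Y: "indep_vars (\<lambda>_. borel) ?Y UNIV" by (rule indep_vars_compose2) simp
  have "indep_elements M (path_space UNIV) (\<lambda>\<omega>. (\<lambda>f j. f (Suc j) - f j) (sample_path UNIV S \<omega>))
     (path_space UNIV) (\<lambda>\<omega>. (\<lambda>f j. cos (f (Suc j))) (sample_path {1..} \<Theta> \<omega>))"
  proof (rule indep_elements_compose[OF prob_space_axioms indep_var_imp_indep_elements[OF ind]])
    show "(\<lambda>f j. f (Suc j) - f j) \<in> measurable (path_space UNIV) (path_space UNIV)"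
      by (rule measurable_PiM_single') (auto simp: space_PiM)
    have "(\<lambda>f. cos (f (Suc j))) \<in> borel_measurable (path_space {1..})" for j
      using measurable_component_singleton[of "Suc j" "{1..}" "\<lambda>_. borel :: real measure"] by simp
    then show "(\<lambda>f j. cos (f (Suc j))) \<in> measurable (path_space {1..}) (path_space UNIV)"
      by (intro measurable_PiM_single') (auto simp: space_PiM)
  qed
  then have "indep_elements M (path_space UNIV) (\<lambda>\<omega> j. ?W j \<omega>) (path_space UNIV) (\<lambda>\<omega> j. ?Y j \<omega>)"
    by simp
  then show "indep_vars (\<lambda>_. borel) (case_sum ?W ?Y) UNIV"
    by (rule indep_vars_case_sum[OF W Y])
  show "distributed M lborel (?W j) (\<lambda>x. ennreal (exponential_density rate x))" for j
    using S by (simp add: poisson_event_times_def)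
  show "expectation (\<lambda>\<omega>. ?Y j \<omega> ^ k) = sym_moment (real m) k" for j k
    by (rule expectation_cos_power) (use \<Theta> in \<open>simp add: iid_angles_def\<close>)
qed (use assms in auto)

section \<open>Conditional law of the motion at a fixed time\<close>

locale motion = prob_space +
  fixes rate c :: real and S \<Theta> :: "nat \<Rightarrow> 'a \<Rightarrow> real" and m n :: nat
  assumes rate_pos: "rate > 0" and c_pos: "c > 0" and n_pos: "n \<ge> 1" and m: "m \<in> {0, 1}"
    and event_times: "poisson_event_times M rate S" and angles: "iid_angles M m \<Theta>"
    and times_angles: "indep_var (path_space UNIV) (sample_path UNIV S) (path_space {1..}) (sample_path {1..} \<Theta>)"
begin

sublocale flight: random_flight M rate "sym_moment (real m)" "\<lambda>j \<omega>. S (Suc j) \<omega> - S j \<omega>" "\<lambda>j \<omega>. cos (\<Theta> (Suc j) \<omega>)"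
  by (rule random_flight_of_motion[OF rate_pos event_times angles times_angles])

lemma flight_S: "\<omega> \<in> space M \<Longrightarrow> flight.S k \<omega> = S k \<omega>"
  using event_times sum_lessThan_telescope[of "\<lambda>j. S j \<omega>" k] by (simp add: flight.S_def poisson_event_times_def)

lemma S_measurable [measurable]: "S k \<in> borel_measurable M"
  using flight.SZ_measurable(1)[of k] by (rule measurable_cong[THEN iffD1, rotated]) (rule flight_S)

lemma Theta_measurable: "k \<ge> 1 \<Longrightarrow> \<Theta> k \<in> borel_measurable M"
  using angles by (simp add: iid_angles_def indep_vars_def2)

text \<open>For nondecreasing event times the counted indices form an initial segment, whose
  cardinality is its maximum.\<close>

lemma event_count_eq_iff:
  assumes mono: "\<And>j. S j \<omega> \<le> S (Suc j) \<omega>"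
  shows "event_count S s \<omega> = n \<longleftrightarrow> S n \<omega> \<le> s \<and> s < S (Suc n) \<omega>"
proof -
  let ?E = "{j. 1 \<le> j \<and> S j \<omega> \<le> s}"
  have le: "S i \<omega> \<le> S j \<omega>" if "i \<le> j" for i j
    using mono that by (rule lift_Suc_mono_le)
  show ?thesis
  proof
    assume "S n \<omega> \<le> s \<and> s < S (Suc n) \<omega>"
    then have n: "S n \<omega> \<le> s" "s < S (Suc n) \<omega>" by auto
    have "?E = {1..n}"
    proof (intro equalityI subsetI)
      fix j assume "j \<in> ?E"
      then show "j \<in> {1..n}" using le[of "Suc n" j] n by (cases "j \<le> n") auto
    next
      fix j assume "j \<in> {1..n}"
      then show "j \<in> ?E" using le[of j n] n by auto
    qed
    then show "event_count S s \<omega> = n" by (simp add: event_count_def)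
  next
    assume card: "event_count S s \<omega> = n"
    \<comment> \<open>An infinite set has \<open>card\<close> 0, so n \<ge> 1 makes the set both
      finite and nonempty.\<close>
    then have pos: "card ?E > 0" using n_pos by (simp add: event_count_def)
    then have fin: "finite ?E" by (rule card_ge_0_finite)
    have ne: "?E \<noteq> {}" using pos by (metis card.empty less_irrefl)
    define k where "k = Max ?E"
    have k: "k \<in> ?E" unfolding k_def by (rule Max_in[OF fin ne])
    have "?E = {1..k}"
    proof (intro equalityI subsetI)
      fix j assume "j \<in> ?E" then show "j \<in> {1..k}" using Max_ge[OF fin] by (auto simp: k_def)
    next
      fix j assume "j \<in> {1..k}" then show "j \<in> ?E" using k le[of j k] by auto
    qed
    then have "k = n" "Suc k \<notin> ?E" using card by (auto simp: event_count_def)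
    then show "S n \<omega> \<le> s \<and> s < S (Suc n) \<omega>" using k by auto
  qed
qed

lemma random_motion_eq:
  assumes "event_count S s \<omega> = n" "\<omega> \<in> space M"
  shows "random_motion c S \<Theta> s \<omega> = c * (flight.Z n \<omega> + (s - flight.S n \<omega>) * cos (\<Theta> (Suc n) \<omega>))"
proof -
  have "random_motion c S \<Theta> s \<omega>
      = c * ((\<Sum>j = 1..n. (S j \<omega> - S (j - 1) \<omega>) * cos (\<Theta> j \<omega>)) + (s - S n \<omega>) * cos (\<Theta> (Suc n) \<omega>))"
    unfolding random_motion_def assms(1) by simp
  also have "(\<Sum>j = 1..n. (S j \<omega> - S (j - 1) \<omega>) * cos (\<Theta> j \<omega>)) = flight.Z n \<omega>"
    unfolding flight.Z_def One_nat_def by (subst sum.atLeast1_atMost_eq) simp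
  finally show ?thesis by (simp add: flight_S assms(2))
qed

abbreviation law :: "real \<Rightarrow> real measure" where
  "law \<equiv> law_given_count M (random_motion c S \<Theta>) (event_count S) n"

lemma event_count_measurable [measurable]:
  "(\<lambda>p. event_count S (fst p) (snd p)) \<in> measurable (borel \<Otimes>\<^sub>M M) (count_space UNIV)"
  unfolding event_count_def by measurable

lemma random_motion_measurable [measurable]:
  "(\<lambda>p. random_motion c S \<Theta> (fst p) (snd p)) \<in> borel_measurable (borel \<Otimes>\<^sub>M M)"
proof -
  have "(\<lambda>p. c * (\<Sum>j = 1..k + 1. ((if j = k + 1 then fst p else S j (snd p)) - S (j - 1) (snd p)) * cos (\<Theta> j (snd p))))
      \<in> borel_measurable (borel \<Otimes>\<^sub>M M)" for k
  proof -
    have [measurable]: "(\<lambda>p. \<Theta> j (snd p)) \<in> borel_measurable ((borel :: real measure) \<Otimes>\<^sub>M M)" if "j \<in> {1..k + 1}" for j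
      using that by (intro measurable_compose[OF measurable_snd Theta_measurable]) auto
    show ?thesis by measurable
  qed
  from measurable_compose_countable[OF this event_count_measurable]
  show ?thesis unfolding random_motion_def .
qed

lemma motion_measurable_at [measurable]:
  "event_count S s \<in> measurable M (count_space UNIV)" "random_motion c S \<Theta> s \<in> borel_measurable M"
  using measurable_compose[OF measurable_Pair1' event_count_measurable, of s]
    measurable_compose[OF measurable_Pair1' random_motion_measurable, of s] by simp_all

text \<open>The Poisson weight is the moment of order 0 of the flight; the trivial factor with
  exponent 0 is inserted to match \<open>flight.expectation_flight\<close>.\<close>

lemma prob_event_count:
  assumes s: "s \<ge> 0"
  shows "prob {\<omega> \<in> space M. event_count S s \<omega> = n} = exp (- (rate * s)) * (rate * s) ^ n / fact n"
proof -
  have "prob {\<omega> \<in> space M. event_count S s \<omega> = n}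
      = expectation (indicator {\<omega> \<in> space M. event_count S s \<omega> = n})" by simp
  also have "\<dots> = expectation (\<lambda>\<omega>. (if flight.S n \<omega> \<le> s \<and> s < flight.S n \<omega> + (S (Suc n) \<omega> - S n \<omega>) then 1 else 0)
      * ((flight.Z n \<omega> + (s - flight.S n \<omega>) * cos (\<Theta> (Suc n) \<omega>)) ^ 0 / fact 0))"
  proof (rule integral_cong_AE)
    show "AE \<omega> in M. indicator {\<omega> \<in> space M. event_count S s \<omega> = n} \<omega>
      = (if flight.S n \<omega> \<le> s \<and> s < flight.S n \<omega> + (S (Suc n) \<omega> - S n \<omega>) then 1 else 0 :: real)
      * ((flight.Z n \<omega> + (s - flight.S n \<omega>) * cos (\<Theta> (Suc n) \<omega>)) ^ 0 / fact 0)"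
      using flight.AE_W_nonneg AE_space
      by eventually_elim (auto simp: event_count_eq_iff flight_S)
  qed (use flight.rv(2)[of n] in measurable)
  also have "\<dots> = exp (- (rate * s)) * (rate * s) ^ n / fact n"
    unfolding flight.expectation_flight[OF s] by (simp add: fps_nth_power_0 sym_moment_0 power_mult_distrib)
  finally show ?thesis .
qed

lemma angle_fps_power:
  "(angle_fps m ^ (n + 1)) $ k * (fact k * fact n / fact (n + k)) = sym_moment (v_index m n) k"
  using m angle_fps_0_power[of n k] angle_fps_1_power[of n k] by (auto simp: v_index_def simp del: power_Suc)

text \<open>The moment restricted to the event of n counts is divided by the Poisson weight of that
  event, which cancels exp(- rate s), rate^n and s^n. Integrability holds because the displacement
  is at most c s there.\<close>

lemma law_moments:
  assumes s: "s > 0"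
  shows "prob_space (law s)" "has_bochner_integral (law s) (\<lambda>x. x ^ k) ((c * s) ^ k * sym_moment (v_index m n) k)"
proof -
  let ?A = "{\<omega> \<in> space M. event_count S s \<omega> = n}" and ?X = "random_motion c S \<Theta> s"
  have [measurable]: "?A \<in> sets M" by measurable
  have p: "prob ?A > 0"
    unfolding prob_event_count[OF less_imp_le[OF s]] using rate_pos s by simp
  then have em: "emeasure M ?A \<noteq> 0" by (simp add: emeasure_eq_measure)
  interpret U: prob_space "uniform_measure M ?A"
    by (rule prob_space_uniform_measure[OF em]) simp
  show "prob_space (law s)"
    unfolding law_given_count_def by (rule U.prob_space_distr) simp
  let ?G = "\<lambda>\<omega>. flight.Z n \<omega> + (s - flight.S n \<omega>) * cos (\<Theta> (Suc n) \<omega>)"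
  let ?N = "\<lambda>\<omega>. if flight.S n \<omega> \<le> s \<and> s < flight.S n \<omega> + (S (Suc n) \<omega> - S n \<omega>) then 1 else 0 :: real"
  have ae: "AE \<omega> in M. indicator ?A \<omega> * ?X \<omega> ^ k = c ^ k * fact k * (?N \<omega> * (?G \<omega> ^ k / fact k))"
    using flight.AE_W_nonneg AE_space
  proof eventually_elim
    case (elim \<omega>)
    then have "event_count S s \<omega> = n \<longleftrightarrow> ?N \<omega> = 1"
      by (auto simp: event_count_eq_iff flight_S)
    then show ?case using elim
      by (cases "event_count S s \<omega> = n") (auto simp: random_motion_eq power_mult_distrib)
  qed
  have int: "integrable M (\<lambda>\<omega>. indicator ?A \<omega> * ?X \<omega> ^ k)"
  proof (rule integrable_const_bound)
    show "AE \<omega> in M. norm (indicator ?A \<omega> * ?X \<omega> ^ k) \<le> (c * s) ^ k"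
      using flight.AE_W_nonneg AE_space
    proof eventually_elim
      case (elim \<omega>)
      show ?case
      proof (cases "event_count S s \<omega> = n")
        case True
        then have "flight.S n \<omega> \<le> s" using elim by (simp add: event_count_eq_iff flight_S)
        then have "\<bar>?G \<omega>\<bar> \<le> flight.S n \<omega> + (s - flight.S n \<omega>) * 1"
          using flight.abs_Z_le[OF elim(1), of n]
          by (intro order_trans[OF abs_triangle_ineq] add_mono) (auto simp: abs_mult intro!: mult_left_le)
        then have "\<bar>?X \<omega>\<bar> \<le> c * s"
          using True elim c_pos by (simp add: random_motion_eq abs_mult)
        then show ?thesis using c_pos s by (simp add: indicator_def abs_mult power_abs power_mono)
      qed (use c_pos s in simp)
    qed
  qed measurable
  have "expectation (\<lambda>\<omega>. indicator ?A \<omega> * ?X \<omega> ^ k) = expectation (\<lambda>\<omega>. c ^ k * fact k * (?N \<omega> * (?G \<omega> ^ k / fact k)))"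
    by (rule integral_cong_AE[OF _ _ ae]) (use flight.rv(2)[of n] in measurable)
  also have "\<dots> = c ^ k * fact k * expectation (\<lambda>\<omega>. ?N \<omega> * (?G \<omega> ^ k / fact k))"
    by (rule integral_mult_right_zero)
  also have "\<dots> = c ^ k * fact k * (exp (- (rate * s)) * rate ^ n * (angle_fps m ^ (n + 1)) $ k * s ^ (n + k) / fact (n + k))"
    using s by (subst flight.expectation_flight) auto
  also have "\<dots> = prob ?A * ((c * s) ^ k * sym_moment (v_index m n) k)"
    unfolding prob_event_count[OF less_imp_le[OF s]] angle_fps_power[of k, symmetric]
    by (simp add: power_mult_distrib power_add mult_ac)
  finally have val: "expectation (\<lambda>\<omega>. indicator ?A \<omega> * ?X \<omega> ^ k) = prob ?A * ((c * s) ^ k * sym_moment (v_index m n) k)" .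
  have "has_bochner_integral M (\<lambda>\<omega>. indicator ?A \<omega> * ?X \<omega> ^ k) (prob ?A * ((c * s) ^ k * sym_moment (v_index m n) k))"
    using int val by (simp add: has_bochner_integral_iff)
  then have "has_bochner_integral M (\<lambda>\<omega>. (indicator ?A \<omega> * ?X \<omega> ^ k) / prob ?A) ((prob ?A * ((c * s) ^ k * sym_moment (v_index m n) k)) / prob ?A)"
    by (rule has_bochner_integral_divide_zero)
  then have "has_bochner_integral M (\<lambda>\<omega>. (indicator ?A \<omega> / prob ?A) *\<^sub>R ?X \<omega> ^ k) ((c * s) ^ k * sym_moment (v_index m n) k)"
    using p by simp
  then have "has_bochner_integral (density M (\<lambda>\<omega>. ennreal (indicator ?A \<omega> / prob ?A))) (\<lambda>\<omega>. ?X \<omega> ^ k) ((c * s) ^ k * sym_moment (v_index m n) k)"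
    by (intro has_bochner_integral_density) auto
  also have "density M (\<lambda>\<omega>. ennreal (indicator ?A \<omega> / prob ?A)) = uniform_measure M ?A"
    unfolding uniform_measure_def using p divide_ennreal[of 1 "prob ?A"]
    by (intro density_cong) (auto simp: emeasure_eq_measure divide_ennreal split: split_indicator)
  finally show "has_bochner_integral (law s) (\<lambda>x. x ^ k) ((c * s) ^ k * sym_moment (v_index m n) k)"
    unfolding law_given_count_def by (intro has_bochner_integral_distr) auto
qed

lemma law_even_moments:
  assumes "s > 0"
  shows "even_moments (law s) (\<lambda>j. (c * s) ^ (2 * j) * sym_moment (v_index m n) (2 * j))"
  unfolding even_moments_def real_distribution_def real_distribution_axioms_def
proof (intro conjI allI)
  show "has_bochner_integral (law s) (\<lambda>x. x ^ (2 * j + 1)) 0" for j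
    using law_moments(2)[OF assms, of "2 * j + 1"] by (simp add: sym_moment_def)
qed (use law_moments[OF assms] in \<open>auto simp: law_given_count_def\<close>)

lemma emeasure_law:
  assumes [measurable]: "A \<in> sets borel"
  shows "emeasure (law s) A = emeasure M {\<omega> \<in> space M. event_count S s \<omega> = n \<and> random_motion c S \<Theta> s \<omega> \<in> A}
    / emeasure M {\<omega> \<in> space M. event_count S s \<omega> = n}"
proof -
  let ?E = "{\<omega> \<in> space M. event_count S s \<omega> = n}" and ?X = "random_motion c S \<Theta> s"
  have "emeasure (law s) A = emeasure (uniform_measure M ?E) (?X -` A \<inter> space M)"
    unfolding law_given_count_def by (subst emeasure_distr) simp_all
  also have "\<dots> = emeasure M (?E \<inter> (?X -` A \<inter> space M)) / emeasure M ?E"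
    by (rule emeasure_uniform_measure) measurable
  also have "?E \<inter> (?X -` A \<inter> space M) = {\<omega> \<in> space M. event_count S s \<omega> = n \<and> ?X \<omega> \<in> A}" by auto
  finally show ?thesis .
qed

text \<open>By \<open>emeasure_law\<close> each value is a quotient of probabilities of sections of
  jointly measurable sets, hence measurable in s. This is what makes the mixture over a random time
  meaningful.\<close>

lemma law_kernel: "law \<in> measurable borel (subprob_algebra borel)"
proof (rule measurable_subprob_algebra)
  fix s
  show "subprob_space (law s)"
  proof (rule subprob_spaceI)
    have "emeasure (law s) (space (law s)) = emeasure (law s) UNIV" by (simp add: law_given_count_def)
    also have "\<dots> \<le> 1"
      unfolding emeasure_law[OF sets.top[of borel, unfolded space_borel]]
      \<comment> \<open>If the event has probability 0, the quotient is 0 / 0, which is 0.\<close>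
      by (cases "emeasure M {\<omega> \<in> space M. event_count S s \<omega> = n} = 0")
         (simp_all add: emeasure_eq_measure divide_ennreal less_le)
    finally show "emeasure (law s) (space (law s)) \<le> 1" .
  qed (simp add: law_given_count_def)
  show "sets (law s) = sets borel" by (simp add: law_given_count_def)
next
  fix A :: "real set" assume [measurable]: "A \<in> sets borel"
  have m: "(\<lambda>s. emeasure M {\<omega> \<in> space M. P s \<omega>}) \<in> borel_measurable borel"
    if [measurable]: "Measurable.pred (borel \<Otimes>\<^sub>M M) (\<lambda>p. P (fst p) (snd p))" for P :: "real \<Rightarrow> 'a \<Rightarrow> bool"
  proof -
    have "(\<lambda>s. emeasure M (Pair s -` {p \<in> space (borel \<Otimes>\<^sub>M M). P (fst p) (snd p)})) \<in> borel_measurable borel"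
      by (rule measurable_emeasure_Pair) measurable
    moreover have "Pair s -` {p \<in> space (borel \<Otimes>\<^sub>M M). P (fst p) (snd p)} = {\<omega> \<in> space M. P s \<omega>}" for s
      by (auto simp: space_pair_measure)
    ultimately show ?thesis by simp
  qed
  show "(\<lambda>s. emeasure (law s) A) \<in> borel_measurable borel"
    unfolding emeasure_law[OF \<open>A \<in> sets borel\<close>]
    by (intro borel_measurable_divide_ennreal m) measurable
qed

end

section \<open>Mixtures of normal laws and the final density\<close>

definition beta_density :: "real \<Rightarrow> real \<Rightarrow> real \<Rightarrow> real" where
  "beta_density a b w = indicator {0<..<1} w * (w powr (a - 1) * (1 - w) powr (b - 1)) / Beta a b"

lemma beta_density_measurable [measurable]: "beta_density a b \<in> borel_measurable borel"
  unfolding beta_density_def by measurable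

lemma Beta_real_pos: "a > 0 \<Longrightarrow> b > 0 \<Longrightarrow> Beta a b > (0 :: real)"
  by (simp add: Beta_def Gamma_real_pos)

lemma beta_density_nonneg: "a > 0 \<Longrightarrow> b > 0 \<Longrightarrow> beta_density a b w \<ge> 0"
  using Beta_real_pos[of a b] by (simp add: beta_density_def)

text \<open>The weight \<open>w ^ j\<close> shifts the first parameter by j, and the quotient of the
  two beta functions is a quotient of Pochhammer symbols.\<close>

lemma nn_integral_beta_density_moment:
  assumes a: "a > 0" and b: "b > 0"
  shows "(\<integral>\<^sup>+ w. ennreal (beta_density a b w) * ennreal (w ^ j) \<partial>lborel)
    = ennreal (pochhammer a j / pochhammer (a + b) j)"
proof -
  have "ennreal (beta_density a b w) * ennreal (w ^ j)
      = ennreal (1 / Beta a b) * ennreal (indicator {0<..<1} w * (w powr (a + real j - 1) * (1 - w) powr (b - 1)))" for w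
  proof (cases "w \<in> {0<..<1}")
    case True
    then have "w powr (a + real j - 1) = w powr (a - 1) * w ^ j"
      by (simp flip: powr_realpow powr_add add: algebra_simps)
    then show ?thesis using True Beta_real_pos[OF a b]
      by (simp add: beta_density_def ennreal_mult[symmetric])
  qed (simp add: beta_density_def)
  then have "(\<integral>\<^sup>+ w. ennreal (beta_density a b w) * ennreal (w ^ j) \<partial>lborel)
      = ennreal (1 / Beta a b) * ennreal (Beta (a + real j) b)"
    using a b by (simp add: nn_integral_cmult nn_integral_Beta)
  also have "\<dots> = ennreal (Beta (a + real j) b / Beta a b)"
    using a b by (simp add: ennreal_mult'[symmetric] Beta_real_pos less_imp_le)
  also have "Beta (a + real j) b / Beta a b = pochhammer a j / pochhammer (a + b) j"
  proof -
    have "a \<notin> \<int>\<^sub>\<le>\<^sub>0" "a + b \<notin> \<int>\<^sub>\<le>\<^sub>0" using a b by (auto simp: nonpos_Ints_def)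
    moreover have "Gamma a > 0" "Gamma b > 0" "Gamma (a + b) > 0" "Gamma (a + b + real j) > 0"
      using a b by (auto intro!: Gamma_real_pos)
    ultimately show ?thesis by (simp add: Beta_def pochhammer_Gamma add_ac)
  qed
  finally show ?thesis .
qed

text \<open>With y = |x| / \<sigma> the claim follows from y exp(- y^2 / 2) \<le> 1. The bound is
  uniform in \<sigma>, so a mixture of normal densities over \<sigma> is finite at every x \<noteq>
  0.\<close>

lemma normal_density_le:
  assumes \<sigma>: "\<sigma> > 0" and x: "x \<noteq> 0"
  shows "normal_density 0 \<sigma> x \<le> 1 / \<bar>x\<bar>"
proof -
  define y where "y = \<bar>x\<bar> / \<sigma>"
  have y: "y > 0" using \<sigma> x by (simp add: y_def)
  have "2 * y \<le> 2 + y\<^sup>2" using zero_le_power2[of "y - 1"] by (simp add: power2_eq_square algebra_simps)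
  then have "y \<le> 1 + y\<^sup>2 / 2" by simp
  also have "\<dots> \<le> exp (y\<^sup>2 / 2)" by (rule exp_ge_add_one_self)
  finally have e: "exp (- (y\<^sup>2 / 2)) * y \<le> 1"
    by (simp add: exp_minus field_simps)
  have "1 \<le> sqrt (2 * pi)" using pi_gt3 by (simp add: real_le_rsqrt)
  then have "1 / sqrt (2 * pi) * (exp (- (y\<^sup>2 / 2)) * y) \<le> 1 * 1"
    using e y by (intro mult_mono) (auto simp: field_simps)
  then have "1 / sqrt (2 * pi) * (exp (- (y\<^sup>2 / 2)) * y) / \<bar>x\<bar> \<le> 1 / \<bar>x\<bar>"
    by (intro divide_right_mono) simp_all
  moreover have "normal_density 0 \<sigma> x = 1 / sqrt (2 * pi) * (exp (- (y\<^sup>2 / 2)) * y) / \<bar>x\<bar>"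
    using \<sigma> x by (simp add: normal_density_def y_def real_sqrt_mult power_divide)
  ultimately show ?thesis by simp
qed

lemma normal_even_moments:
  assumes \<sigma>: "\<sigma> > 0"
  shows "even_moments (density lborel (\<lambda>x. ennreal (normal_density 0 \<sigma> x))) (\<lambda>j. fact (2 * j) / ((2 / \<sigma>\<^sup>2) ^ j * fact j))"
  unfolding even_moments_def real_distribution_def real_distribution_axioms_def
proof (intro conjI allI)
  show "prob_space (density lborel (\<lambda>x. ennreal (normal_density 0 \<sigma> x)))"
    by (rule prob_space_normal_density[OF \<sigma>])
  show "has_bochner_integral (density lborel (\<lambda>x. ennreal (normal_density 0 \<sigma> x))) (\<lambda>x. x ^ (2 * j)) (fact (2 * j) / ((2 / \<sigma>\<^sup>2) ^ j * fact j))" for j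
    using normal_moment_even[OF \<sigma>, of 0 j] by (intro has_bochner_integral_density) auto
  show "has_bochner_integral (density lborel (\<lambda>x. ennreal (normal_density 0 \<sigma> x))) (\<lambda>x. x ^ (2 * j + 1)) 0" for j
    using normal_moment_odd[OF \<sigma>, of 0 j] by (intro has_bochner_integral_density) auto
qed simp_all

lemma pochhammer_half: "pochhammer (1 / 2) j = (fact (2 * j) / (4 ^ j * fact j) :: real)"
  using sym_moment_nat[of 0 j] by (simp add: sym_moment_def pochhammer_fact[symmetric] field_simps)

text \<open>The zero measure for \<open>w \<le> 0\<close> makes this a subprobability kernel on the
  whole line, as the monadic bind requires.\<close>

definition mixture_kernel :: "real \<Rightarrow> real \<Rightarrow> real \<Rightarrow> real measure" where
  "mixture_kernel c t w = density lborel (\<lambda>x. ennreal (indicator {0<..} w * normal_density 0 (c * sqrt (t * w)) x))"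

lemma mixture_kernel_measurable:
  assumes c: "c > 0" and t: "t > 0"
  shows "mixture_kernel c t \<in> measurable borel (subprob_algebra borel)"
proof (rule measurable_subprob_algebra)
  fix w
  show "subprob_space (mixture_kernel c t w)"
  proof (cases "w > 0")
    case True
    then have "prob_space (mixture_kernel c t w)"
      using c t prob_space_normal_density[of "c * sqrt (t * w)" 0] by (simp add: mixture_kernel_def)
    then show ?thesis by (rule prob_space_imp_subprob_space)
  next
    case False
    then show ?thesis
      by (intro subprob_spaceI) (simp_all add: mixture_kernel_def emeasure_density)
  qed
  show "sets (mixture_kernel c t w) = sets borel" by (simp add: mixture_kernel_def)
next
  fix A :: "real set" assume [measurable]: "A \<in> sets borel"
  have "(\<lambda>w. \<integral>\<^sup>+ x. ennreal (indicator {0<..} w * normal_density 0 (c * sqrt (t * w)) x) * indicator A x \<partial>lborel) \<in> borel_measurable borel"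
    unfolding normal_density_def by measurable
  then show "(\<lambda>w. emeasure (mixture_kernel c t w) A) \<in> borel_measurable borel"
    by (simp add: mixture_kernel_def emeasure_density normal_density_def)
qed

context motion
begin

text \<open>Both sides are laws with even moments \<open>(2 t c\<^sup>2) ^ j * (1/2)\<^sub>j * (d/2)\<^sub>j / (v+1)\<^sub>j\<close>
  and vanishing odd moments.\<close>

lemma motion_at_bessel_time:
  assumes d: "d \<ge> 1" and t: "t > 0" and v: "v_index m n > real d / 2 - 1" and A: "A \<in> sets borel"
  defines "b \<equiv> v_index m n - real d / 2 + 1"
  shows "(\<integral>\<^sup>+ u. ennreal (chi_density d t u) * emeasure (law u) A \<partial>lborel)
    = (\<integral>\<^sup>+ w. ennreal (beta_density (real d / 2) b w) * emeasure (mixture_kernel c t w) A \<partial>lborel)"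
proof -
  let ?v = "v_index m n"
  let ?\<nu>1 = "density lborel (\<lambda>u. ennreal (chi_density d t u))"
  let ?\<nu>2 = "density lborel (\<lambda>w. ennreal (beta_density (real d / 2) b w))"
  have b: "b > 0" and d2: "real d / 2 > 0" using v d by (simp_all add: b_def)
  have vb: "real d / 2 + b = ?v + 1" by (simp add: b_def)
  have v0: "?v > 0" using n_pos by (auto simp: v_index_def)
  define E where "E j = c ^ (2 * j) * sym_moment ?v (2 * j) * ((2 * t) ^ j * pochhammer (real d / 2) j)" for j
  have smn: "sym_moment ?v (2 * j) \<ge> 0" for j
    using v0 by (auto simp: sym_moment_def intro!: divide_nonneg_nonneg pochhammer_nonneg)
  have pd: "pochhammer (real d / 2) j > 0" "pochhammer (?v + 1) j > 0" for j
    using d v0 by (auto intro!: pochhammer_pos)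
  have E0: "E j \<ge> 0" for j
    unfolding E_def using smn pd[of j] c_pos t by (intro mult_nonneg_nonneg) auto
  have E1: "E 0 = 1" by (simp add: E_def sym_moment_0)
  have p1: "prob_space ?\<nu>1"
    using nn_integral_chi_density_1[OF d t] by (intro prob_spaceI) (simp add: emeasure_density)
  have p2: "prob_space ?\<nu>2"
    using nn_integral_beta_density_moment[OF d2 b, of 0] by (intro prob_spaceI) (simp add: emeasure_density)
  have m1: "even_moments (?\<nu>1 \<bind> law) E"
  proof (rule even_moments_bind[OF p1 _ law_kernel])
    \<comment> \<open>The chi density charges positive times only, and
      \<open>law_even_moments\<close> holds for those.\<close>
    show "AE s in ?\<nu>1. even_moments (law s) (\<lambda>j. (c * s) ^ (2 * j) * sym_moment ?v (2 * j))"
      by (subst AE_density) (auto intro!: AE_I2 law_even_moments simp: chi_density_def split: if_splits)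
    show "(\<integral>\<^sup>+ s. ennreal ((c * s) ^ (2 * j) * sym_moment ?v (2 * j)) \<partial>?\<nu>1) = ennreal (E j)" for j
    proof -
      have "(\<integral>\<^sup>+ s. ennreal ((c * s) ^ (2 * j) * sym_moment ?v (2 * j)) \<partial>?\<nu>1)
        = (\<integral>\<^sup>+ s. ennreal (chi_density d t s) * ennreal ((c * s) ^ (2 * j) * sym_moment ?v (2 * j)) \<partial>lborel)"
        by (rule nn_integral_density) auto
      also have "\<dots> = (\<integral>\<^sup>+ s. ennreal (c ^ (2 * j) * sym_moment ?v (2 * j)) * (ennreal (chi_density d t s) * ennreal (s ^ (2 * j))) \<partial>lborel)"
        using smn[of j] by (intro nn_integral_cong)
          (simp add: power_mult_distrib ennreal_mult zero_le_even_power mult_ac)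
      also have "\<dots> = ennreal (c ^ (2 * j) * sym_moment ?v (2 * j)) * ennreal ((2 * t) ^ j * pochhammer (real d / 2) j)"
        by (subst nn_integral_cmult) (simp_all add: nn_integral_chi_density_moment[OF d t])
      also have "\<dots> = ennreal (E j)"
        unfolding E_def using smn[of j] pd[of j] t by (intro ennreal_mult[symmetric]) (auto simp: zero_le_even_power)
      finally show ?thesis .
    qed
  qed (use E0 E1 in auto)
  have m2: "even_moments (?\<nu>2 \<bind> mixture_kernel c t) E"
  proof (rule even_moments_bind[OF p2 _ mixture_kernel_measurable[OF c_pos t]])
    let ?e = "\<lambda>j w. (c\<^sup>2 * t) ^ j * (fact (2 * j) / (2 ^ j * fact j)) * w ^ j"
    show "AE w in ?\<nu>2. even_moments (mixture_kernel c t w) (\<lambda>j. ?e j w)"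
    proof (subst AE_density, simp, intro AE_I2 impI)
      fix w assume "0 < ennreal (beta_density (real d / 2) b w)"
      then have w: "w > 0" by (cases "w > 0") (simp_all add: beta_density_def)
      have "(\<lambda>j. ?e j w) = (\<lambda>j. fact (2 * j) / ((2 / (c * sqrt (t * w))\<^sup>2) ^ j * fact j))"
        using w t c_pos by (simp add: fun_eq_iff power_mult_distrib power_divide field_simps)
      then show "even_moments (mixture_kernel c t w) (\<lambda>j. ?e j w)"
        using normal_even_moments[of "c * sqrt (t * w)"] w t c_pos by (simp add: mixture_kernel_def)
    qed
    show "(\<integral>\<^sup>+ w. ennreal (?e j w) \<partial>?\<nu>2) = ennreal (E j)" for j
    proof -
      have "(\<integral>\<^sup>+ w. ennreal (?e j w) \<partial>?\<nu>2) = (\<integral>\<^sup>+ w. ennreal (beta_density (real d / 2) b w) * ennreal (?e j w) \<partial>lborel)"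
        by (rule nn_integral_density) auto
      also have "\<dots> = (\<integral>\<^sup>+ w. ennreal ((c\<^sup>2 * t) ^ j * (fact (2 * j) / (2 ^ j * fact j))) * (ennreal (beta_density (real d / 2) b w) * ennreal (w ^ j)) \<partial>lborel)"
      proof (rule nn_integral_cong)
        fix w
        show "ennreal (beta_density (real d / 2) b w) * ennreal (?e j w)
          = ennreal ((c\<^sup>2 * t) ^ j * (fact (2 * j) / (2 ^ j * fact j))) * (ennreal (beta_density (real d / 2) b w) * ennreal (w ^ j))"
        proof (cases "w > 0")
          case True
          then have "ennreal (?e j w) = ennreal ((c\<^sup>2 * t) ^ j * (fact (2 * j) / (2 ^ j * fact j))) * ennreal (w ^ j)"
            using t by (intro ennreal_mult) auto
          then show ?thesis by (simp add: mult_ac)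
        qed (simp add: beta_density_def)
      qed
      also have "\<dots> = ennreal ((c\<^sup>2 * t) ^ j * (fact (2 * j) / (2 ^ j * fact j))) * ennreal (pochhammer (real d / 2) j / pochhammer (?v + 1) j)"
        using nn_integral_beta_density_moment[OF d2 b, of j] vb by (subst nn_integral_cmult) simp_all
      also have "\<dots> = ennreal ((c\<^sup>2 * t) ^ j * (fact (2 * j) / (2 ^ j * fact j)) * (pochhammer (real d / 2) j / pochhammer (?v + 1) j))"
        using t pd[of j] by (intro ennreal_mult[symmetric]) auto
      also have "(c\<^sup>2 * t) ^ j * (fact (2 * j) / (2 ^ j * fact j)) * (pochhammer (real d / 2) j / pochhammer (?v + 1) j) = E j"
      proof -
        \<comment> \<open>Since (1/2)_j = (2 j)! / (4^j j!), the factor (2 t)^j / 4^j of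
          \<open>E j\<close> is (t / 2)^j, the constant of the Gaussian moment.\<close>
        have "(4 :: real) ^ j = 2 ^ j * 2 ^ j" by (simp flip: power_mult_distrib)
        then show ?thesis
          by (simp add: E_def sym_moment_def pochhammer_half power_mult_distrib power_mult[symmetric])
             (simp only: mult_ac)
      qed
      finally show ?thesis .
    qed
  qed (use E0 E1 in auto)
  have "(\<lambda>j. a ^ (2 * j) / fact (2 * j) * E j) \<longlonglongrightarrow> 0" for a :: real
  proof (rule Lim_null_comparison)
    \<comment> \<open>In \<open>E j\<close> the factor (1/2)_j contributes (2 j)!, which cancels
      against the denominator. What remains is z^j / j! times (d/2)_j / (v + 1)_j, a ratio at most 1
      because d/2 < v + 1.\<close>
    define z where "z = a\<^sup>2 * c\<^sup>2 * t / 2"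
    have z: "z \<ge> 0" using t by (simp add: z_def)
    show "\<forall>\<^sub>F j in sequentially. norm (a ^ (2 * j) / fact (2 * j) * E j) \<le> z ^ j /\<^sub>R fact j"
    proof (intro always_eventually allI)
      fix j
      have "(4 :: real) ^ j = 2 ^ j * 2 ^ j" by (simp flip: power_mult_distrib)
      then have "a ^ (2 * j) / fact (2 * j) * E j = z ^ j / fact j * (pochhammer (real d / 2) j / pochhammer (?v + 1) j)"
        by (simp add: E_def z_def sym_moment_def pochhammer_half power_mult_distrib power_mult power_divide)
      then have eq: "a ^ (2 * j) / fact (2 * j) * E j = z ^ j / fact j * (pochhammer (real d / 2) j / pochhammer (?v + 1) j)" .
      have "pochhammer (real d / 2) j \<le> pochhammer (?v + 1) j"
        unfolding pochhammer_prod using vb b d by (intro prod_mono) auto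
      then have r: "0 \<le> pochhammer (real d / 2) j / pochhammer (?v + 1) j" "pochhammer (real d / 2) j / pochhammer (?v + 1) j \<le> 1"
        using pd[of j] by simp_all
      have n0: "0 \<le> z ^ j / fact j" using z by simp
      have "norm (a ^ (2 * j) / fact (2 * j) * E j) = z ^ j / fact j * (pochhammer (real d / 2) j / pochhammer (?v + 1) j)"
        unfolding eq real_norm_def by (rule abs_of_nonneg) (rule mult_nonneg_nonneg[OF n0 r(1)])
      also have "\<dots> \<le> z ^ j / fact j * 1"
        by (rule mult_left_mono[OF r(2) n0])
      also have "\<dots> = z ^ j /\<^sub>R fact j"
        by (simp add: divide_inverse mult.commute)
      finally show "norm (a ^ (2 * j) / fact (2 * j) * E j) \<le> z ^ j /\<^sub>R fact j" .
    qed
    show "(\<lambda>j. z ^ j /\<^sub>R fact j) \<longlonglongrightarrow> 0"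
      using summable_LIMSEQ_zero[OF summable_exp_generic[of z]] .
  qed
  with m1 m2 have "?\<nu>1 \<bind> law = ?\<nu>2 \<bind> mixture_kernel c t"
    by (rule even_moments_unique)
  then have "emeasure (?\<nu>1 \<bind> law) A = emeasure (?\<nu>2 \<bind> mixture_kernel c t) A" by simp
  moreover have "emeasure (?\<nu>1 \<bind> law) A = (\<integral>\<^sup>+ u. ennreal (chi_density d t u) * emeasure (law u) A \<partial>lborel)"
  proof -
    have k: "law \<in> measurable ?\<nu>1 (subprob_algebra borel)" using law_kernel by (simp cong: measurable_cong_sets)
    have "(\<lambda>u. emeasure (law u) A) \<in> borel_measurable lborel"
      using measurable_emeasure_kernel[OF law_kernel A] by simp
    then show ?thesis
      using emeasure_bind[OF _ k A] by (simp add: nn_integral_density)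
  qed
  moreover have "emeasure (?\<nu>2 \<bind> mixture_kernel c t) A = (\<integral>\<^sup>+ w. ennreal (beta_density (real d / 2) b w) * emeasure (mixture_kernel c t w) A \<partial>lborel)"
  proof -
    note mk = mixture_kernel_measurable[OF c_pos t]
    have k: "mixture_kernel c t \<in> measurable ?\<nu>2 (subprob_algebra borel)" using mk by (simp cong: measurable_cong_sets)
    have "(\<lambda>u. emeasure (mixture_kernel c t u) A) \<in> borel_measurable lborel"
      using measurable_emeasure_kernel[OF mk A] by simp
    then show ?thesis
      using emeasure_bind[OF _ k A] by (simp add: nn_integral_density)
  qed
  ultimately show ?thesis by simp
qed

end

text \<open>The density of the Gaussian mixture is kept as an extended nonnegative integral, so that
  it is defined everywhere, x = 0 included, and Tonelli's theorem applies to it.\<close>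

definition mixed_density :: "nat \<Rightarrow> real \<Rightarrow> real \<Rightarrow> real \<Rightarrow> real \<Rightarrow> ennreal" where
  "mixed_density d b c t x = (\<integral>\<^sup>+ w. ennreal (beta_density (real d / 2) b w)
     * ennreal (indicator {0<..} w * normal_density 0 (c * sqrt (t * w)) x) \<partial>lborel)"

lemma mixed_density_measurable [measurable]:
  "(\<lambda>(t, x). mixed_density d b c t x) \<in> borel_measurable (borel \<Otimes>\<^sub>M borel)"
proof -
  let ?h = "\<lambda>p w. ennreal (beta_density (real d / 2) b w)
     * ennreal (indicator {0<..} w * normal_density 0 (c * sqrt (fst p * w)) (snd p))"
  have "(\<lambda>q. ?h (fst q) (snd q)) \<in> borel_measurable ((borel \<Otimes>\<^sub>M borel) \<Otimes>\<^sub>M lborel)"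
    unfolding normal_density_def by measurable
  then have "(\<lambda>p. \<integral>\<^sup>+ w. ?h p w \<partial>lborel) \<in> borel_measurable (borel \<Otimes>\<^sub>M borel)"
    by (intro lborel.borel_measurable_nn_integral) (simp add: case_prod_beta')
  then show ?thesis by (simp add: mixed_density_def case_prod_beta')
qed

primrec iter_density :: "nat \<Rightarrow> real \<Rightarrow> real \<Rightarrow> nat \<Rightarrow> real \<Rightarrow> real \<Rightarrow> ennreal" where
  "iter_density d b c 0 t x = mixed_density d b c t x"
| "iter_density d b c (Suc l) t x = (\<integral>\<^sup>+ u. ennreal (chi_density d t u) * iter_density d b c l u x \<partial>lborel)"

lemma iter_density_measurable [measurable]:
  "(\<lambda>(t, x). iter_density d b c l t x) \<in> borel_measurable (borel \<Otimes>\<^sub>M borel)"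
proof (induction l)
  case (Suc l)
  note [measurable] = Suc
  show ?case unfolding iter_density.simps by measurable
qed simp

text \<open>One Bessel kernel is absorbed by \<open>motion_at_bessel_time\<close>; for the others
  Tonelli's theorem moves the integral over x to the outside.\<close>

lemma (in motion) iter_chi_law:
  assumes d: "d \<ge> 1" and v: "v_index m n > real d / 2 - 1" and A[measurable]: "A \<in> sets borel" and t: "t > 0"
  shows "iter_chi d l (\<lambda>u. emeasure (law u) A) t
    = (\<integral>\<^sup>+ x. iter_density d (v_index m n - real d / 2 + 1) c l t x * indicator A x \<partial>lborel)"
  using t
proof (induction l arbitrary: t)
  case 0
  let ?b = "v_index m n - real d / 2 + 1"
  let ?f = "\<lambda>w x. ennreal (beta_density (real d / 2) ?b w) * (ennreal (indicator {0<..} w * normal_density 0 (c * sqrt (t * w)) x) * indicator A x)"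
  have "iter_chi d 0 (\<lambda>u. emeasure (law u) A) t = (\<integral>\<^sup>+ w. ennreal (beta_density (real d / 2) ?b w) * emeasure (mixture_kernel c t w) A \<partial>lborel)"
    using motion_at_bessel_time[OF d 0 v A] by simp
  also have "\<dots> = (\<integral>\<^sup>+ w. \<integral>\<^sup>+ x. ?f w x \<partial>lborel \<partial>lborel)"
    unfolding mixture_kernel_def by (simp add: emeasure_density nn_integral_cmult)
  also have "\<dots> = (\<integral>\<^sup>+ x. \<integral>\<^sup>+ w. ?f w x \<partial>lborel \<partial>lborel)"
    unfolding normal_density_def by (rule lborel_pair.Fubini') measurable
  also have "\<dots> = (\<integral>\<^sup>+ x. iter_density d ?b c 0 t x * indicator A x \<partial>lborel)"
    unfolding iter_density.simps mixed_density_def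
    by (subst nn_integral_multc[symmetric]) (auto simp: mult.assoc normal_density_def)
  finally show ?case .
next
  case (Suc l)
  let ?b = "v_index m n - real d / 2 + 1"
  have "iter_chi d (Suc l) (\<lambda>u. emeasure (law u) A) t
      = (\<integral>\<^sup>+ u. ennreal (chi_density d t u) * (\<integral>\<^sup>+ x. iter_density d ?b c l u x * indicator A x \<partial>lborel) \<partial>lborel)"
    unfolding iter_chi.simps
  proof (rule nn_integral_cong)
    fix u :: real
    show "ennreal (chi_density d t u) * iter_chi d l (\<lambda>u. emeasure (law u) A) u
      = ennreal (chi_density d t u) * (\<integral>\<^sup>+ x. iter_density d ?b c l u x * indicator A x \<partial>lborel)"
      using Suc.IH[of u] by (cases "u > 0") (auto simp: chi_density_def)
  qed
  also have "\<dots> = (\<integral>\<^sup>+ u. \<integral>\<^sup>+ x. ennreal (chi_density d t u) * (iter_density d ?b c l u x * indicator A x) \<partial>lborel \<partial>lborel)"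
    by (simp add: nn_integral_cmult)
  also have "\<dots> = (\<integral>\<^sup>+ x. \<integral>\<^sup>+ u. ennreal (chi_density d t u) * (iter_density d ?b c l u x * indicator A x) \<partial>lborel \<partial>lborel)"
    by (rule lborel_pair.Fubini') measurable
  also have "\<dots> = (\<integral>\<^sup>+ x. iter_density d ?b c (Suc l) t x * indicator A x \<partial>lborel)"
    unfolding iter_density.simps
    by (subst nn_integral_multc[symmetric]) (auto simp: mult.assoc)
  finally show ?case .
qed

text \<open>The update at l + 1 encodes the convention that t_(l + 1) = t. For l = 0 the product is
  empty and \<open>u 1\<close> is t itself, which serves as the base of the induction.\<close>

definition chain_integrand :: "nat \<Rightarrow> real \<Rightarrow> real \<Rightarrow> nat \<Rightarrow> real \<Rightarrow> real \<Rightarrow> (nat \<Rightarrow> real) \<Rightarrow> ennreal" where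
  "chain_integrand d b c l t x \<tau> = (let u = \<tau>(l + 1 := t) in
     (\<Prod>j = 1..l. ennreal (chi_density d (u (j + 1)) (u j))) * mixed_density d b c (u 1) x)"

lemma chain_integrand_measurable [measurable]:
  "chain_integrand d b c l t x \<in> borel_measurable (\<Pi>\<^sub>M j\<in>{1..l}. lborel)"
proof -
  have [measurable]: "(\<lambda>\<tau>. (\<tau>(l + 1 := t)) j) \<in> borel_measurable (\<Pi>\<^sub>M j\<in>{1..l}. lborel :: real measure)"
    if "j \<in> {1..l + 1}" for j
  proof (cases "j = l + 1")
    case False
    then have "j \<in> {1..l}" using that by auto
    from measurable_component_singleton[OF this, of "\<lambda>_. lborel :: real measure"] False show ?thesis by simp
  qed simp
  have "(\<lambda>\<tau>. ennreal (chi_density d ((\<tau>(l + 1 := t)) (j + 1)) ((\<tau>(l + 1 := t)) j))) \<in> borel_measurable (\<Pi>\<^sub>M j\<in>{1..l}. lborel :: real measure)"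
    if "j \<in> {1..l}" for j
  proof -
    have "j \<in> {1..l + 1}" "j + 1 \<in> {1..l + 1}" using that by auto
    note this[measurable]
    show ?thesis by measurable
  qed
  moreover have "(\<lambda>\<tau>. mixed_density d b c ((\<tau>(l + 1 := t)) 1) x) \<in> borel_measurable (\<Pi>\<^sub>M j\<in>{1..l}. lborel :: real measure)"
    by measurable
  ultimately show ?thesis
    unfolding chain_integrand_def Let_def by (intro borel_measurable_times_ennreal borel_measurable_prod_ennreal) auto
qed

text \<open>The coordinate with the largest index is split off as the outer variable: its value y is
  the end time of the chain formed by the remaining coordinates, and its link to t is the new chi
  density.\<close>

lemma iter_density_eq_chain:
  "iter_density d b c l t x = (\<integral>\<^sup>+ \<tau>. chain_integrand d b c l t x \<tau> \<partial>(\<Pi>\<^sub>M j\<in>{1..l}. lborel))"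
proof (induction l arbitrary: t)
  case 0
  interpret product_sigma_finite "\<lambda>_ :: nat. lborel :: real measure" ..
  have "{1..0::nat} = {}" by simp
  then show ?case by (simp only:) (subst nn_integral_empty, simp_all add: chain_integrand_def)
next
  case (Suc l)
  interpret product_sigma_finite "\<lambda>_ :: nat. lborel :: real measure" ..
  have ins: "{1..Suc l} = insert (Suc l) {1..l}" by auto
  have chain: "chain_integrand d b c (Suc l) t x (\<tau>(Suc l := y)) = ennreal (chi_density d t y) * chain_integrand d b c l y x \<tau>" for \<tau> y
  proof -
    let ?u = "(\<tau>(Suc l := y))(Suc l + 1 := t)" and ?u' = "\<tau>(l + 1 := y)"
    have "(\<Prod>j = 1..Suc l. ennreal (chi_density d (?u (j + 1)) (?u j)))
        = (\<Prod>j = 1..l. ennreal (chi_density d (?u (j + 1)) (?u j))) * ennreal (chi_density d t y)"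
      by simp
    also have "(\<Prod>j = 1..l. ennreal (chi_density d (?u (j + 1)) (?u j))) = (\<Prod>j = 1..l. ennreal (chi_density d (?u' (j + 1)) (?u' j)))"
      by (intro prod.cong) auto
    finally show ?thesis by (simp add: chain_integrand_def Let_def mult_ac)
  qed
  have "(\<integral>\<^sup>+ \<tau>. chain_integrand d b c (Suc l) t x \<tau> \<partial>(\<Pi>\<^sub>M j\<in>{1..Suc l}. lborel))
      = (\<integral>\<^sup>+ y. (\<integral>\<^sup>+ \<tau>. chain_integrand d b c (Suc l) t x (\<tau>(Suc l := y)) \<partial>(\<Pi>\<^sub>M j\<in>{1..l}. lborel)) \<partial>lborel)"
    unfolding ins
  proof (rule product_nn_integral_insert_rev)
    show "chain_integrand d b c (Suc l) t x \<in> borel_measurable (\<Pi>\<^sub>M j\<in>insert (Suc l) {1..l}. lborel)"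
      using chain_integrand_measurable[of d b c "Suc l" t x] unfolding ins .
  qed auto
  also have "\<dots> = iter_density d b c (Suc l) t x"
  proof -
    have "(\<integral>\<^sup>+ \<tau>. ennreal (chi_density d t y) * chain_integrand d b c l y x \<tau> \<partial>(\<Pi>\<^sub>M j\<in>{1..l}. lborel))
        = ennreal (chi_density d t y) * iter_density d b c l y x" for y
      unfolding Suc by (rule nn_integral_cmult) (rule chain_integrand_measurable)
    then show ?thesis unfolding chain by simp
  qed
  finally show ?case ..
qed

text \<open>For x \<noteq> 0 the Gaussian factor is at most 1 / |x| for all w, so the mixture is
  finite and agrees with the real integral. At x = 0 with d = 1 the integrand behaves like 1 / w
  near 0: the extended integral is infinite there, whereas the real one defaults to 0.\<close>

lemma mixed_density_real:
  assumes d: "d \<ge> 1" and b: "b > 0" and c: "c > 0" and t: "t > 0" and x: "x \<noteq> 0"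
  shows "mixed_density d b c t x = ennreal (1 / Beta (real d / 2) b * (LBINT w:{0<..<1}.
     w powr (real d / 2 - 1) * (1 - w) powr (b - 1) * (exp (- x\<^sup>2 / (2 * c\<^sup>2 * t * w)) / (sqrt (2 * pi * t * w) * c))))"
    (is "_ = ennreal (1 / ?B * (LBINT w:_. ?f w))")
proof -
  have d2: "real d / 2 > 0" using d by simp
  have B: "?B > 0" by (rule Beta_real_pos[OF d2 b])
  let ?g = "\<lambda>w. indicator {0<..<1} w *\<^sub>R ?f w"
  have g0: "?g w \<ge> 0" for w using c t by (auto simp: indicator_def)
  have pt: "ennreal (beta_density (real d / 2) b w) * ennreal (indicator {0<..} w * normal_density 0 (c * sqrt (t * w)) x)
      = ennreal (1 / ?B) * ennreal (?g w)" for w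
  proof (cases "w \<in> {0<..<1}")
    case True
    then have w: "0 < w" "w < 1" by auto
    have "normal_density 0 (c * sqrt (t * w)) x = exp (- x\<^sup>2 / (2 * c\<^sup>2 * t * w)) / (sqrt (2 * pi * t * w) * c)"
    proof -
      have s: "(c * sqrt (t * w))\<^sup>2 = c\<^sup>2 * (t * w)" using t w by (simp add: power_mult_distrib)
      have "sqrt (2 * pi * (c\<^sup>2 * (t * w))) = sqrt (2 * pi * t * w * c\<^sup>2)" by (simp add: mult_ac)
      also have "\<dots> = sqrt (2 * pi * t * w) * c" using c by (simp add: real_sqrt_mult)
      finally show ?thesis unfolding normal_density_def s by (simp add: mult_ac)
    qed
    then have "beta_density (real d / 2) b w * normal_density 0 (c * sqrt (t * w)) x = 1 / ?B * ?g w"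
      using w by (simp add: beta_density_def)
    then show ?thesis using w B beta_density_nonneg[OF d2 b, of w] g0[of w]
      by (simp add: ennreal_mult[symmetric])
  qed (simp add: beta_density_def)
  have eq: "mixed_density d b c t x = ennreal (1 / ?B) * (\<integral>\<^sup>+ w. ennreal (?g w) \<partial>lborel)"
    unfolding mixed_density_def pt by (rule nn_integral_cmult) simp
  have "mixed_density d b c t x \<le> (\<integral>\<^sup>+ w. ennreal (beta_density (real d / 2) b w) * ennreal (1 / \<bar>x\<bar>) \<partial>lborel)"
    unfolding mixed_density_def
  proof (intro nn_integral_mono mult_left_mono ennreal_leI)
    fix w :: real
    show "indicator {0<..} w * normal_density 0 (c * sqrt (t * w)) x \<le> 1 / \<bar>x\<bar>"
      using normal_density_le[of "c * sqrt (t * w)" x] c t x by (cases "w > 0") auto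
  qed simp
  also have "\<dots> = ennreal (1 / \<bar>x\<bar>)"
    using nn_integral_beta_density_moment[OF d2 b, of 0] by (subst nn_integral_multc) auto
  finally have "mixed_density d b c t x < \<infinity>" by (rule le_less_trans) simp
  then have "(\<integral>\<^sup>+ w. ennreal (?g w) \<partial>lborel) < \<infinity>"
    unfolding eq using B by (auto simp: ennreal_mult_less_top)
  then obtain r where r: "(\<integral>\<^sup>+ w. ennreal (?g w) \<partial>lborel) = ennreal r" "r \<ge> 0"
    by (cases "\<integral>\<^sup>+ w. ennreal (?g w) \<partial>lborel") auto
  have "(LBINT w:{0<..<1}. ?f w) = enn2real (\<integral>\<^sup>+ w. ennreal (?g w) \<partial>lborel)"
    unfolding set_lebesgue_integral_def
  proof (rule integral_eq_nn_integral)
    show "AE w in lborel. 0 \<le> ?g w" by (rule AE_I2[OF g0])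
  qed measurable
  then have "(LBINT w:{0<..<1}. ?f w) = r" unfolding r(1) using r(2) by (simp only: enn2real_ennreal)
  then show ?thesis
    unfolding eq r(1) using B r(2) by (simp only:) (intro ennreal_mult[symmetric], auto)
qed

text \<open>The constant \<open>K\<close> gathers the constants of l chi densities and of the beta
  density. Finiteness is assumed because a real integral of a nonnegative function of infinite mass
  defaults to 0.\<close>

lemma iter_density_real:
  assumes d: "d \<ge> 1" and b: "b > 0" and c: "c > 0" and t: "t > 0" and x: "x \<noteq> 0"
    and fin: "iter_density d b c l t x < \<infinity>"
  shows "iter_density d b c l t x = ennreal (1 / Beta (real d / 2) b
    * (1 / (Gamma (real d / 2) * 2 powr (real d / 2 - 1))) ^ l
    * (LINT \<tau>:(\<Pi>\<^sub>E j\<in>{1..l}. {0<..})|(\<Pi>\<^sub>M j\<in>{1..l}. lborel).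
         (let u = \<tau>(l + 1 := t) in
           (\<Prod>j = 1..l. u j ^ (d - 1) * exp (- (u j)\<^sup>2 / (2 * u (j + 1))) / u (j + 1) powr (real d / 2))
           * (LBINT w:{0<..<1}. w powr (real d / 2 - 1) * (1 - w) powr (b - 1)
                * (exp (- x\<^sup>2 / (2 * c\<^sup>2 * u 1 * w)) / (sqrt (2 * pi * u 1 * w) * c))))))"
    (is "_ = ennreal (1 / ?B * ?C ^ l * (LINT \<tau>:?P|?M. ?f \<tau>))")
proof -
  let ?q = "\<lambda>u j. u j ^ (d - 1) * exp (- (u j)\<^sup>2 / (2 * u (j + 1))) / u (j + 1) powr (real d / 2)"
  let ?J = "\<lambda>s. LBINT w:{0<..<1}. w powr (real d / 2 - 1) * (1 - w) powr (b - 1)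
                * (exp (- x\<^sup>2 / (2 * c\<^sup>2 * s * w)) / (sqrt (2 * pi * s * w) * c))"
  have B: "?B > 0" and C: "?C > 0" using d b by (auto intro!: Beta_real_pos simp: Gamma_real_pos)
  define K where "K = 1 / ?B * ?C ^ l"
  have K: "K > 0" using B C by (simp add: K_def)
  have eq: "indicator ?P \<tau> *\<^sub>R ?f \<tau> = enn2real (chain_integrand d b c l t x \<tau>) / K"
    and chain_fin: "chain_integrand d b c l t x \<tau> < \<infinity>"
    if \<tau>: "\<tau> \<in> space ?M" for \<tau>
  proof -
    let ?u = "\<tau>(l + 1 := t)"
    have "indicator ?P \<tau> *\<^sub>R ?f \<tau> = enn2real (chain_integrand d b c l t x \<tau>) / K \<and> chain_integrand d b c l t x \<tau> < \<infinity>"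
    proof (cases "\<tau> \<in> ?P")
      case True
      have u: "?u j > 0" if "j \<in> {1..l + 1}" for j
        using that True t by (cases "j = l + 1") (auto simp: PiE_iff)
      have chi: "chi_density d (?u (j + 1)) (?u j) = ?C * ?q ?u j" if "j \<in> {1..l}" for j
        using u[of j] u[of "j + 1"] that by (simp add: chi_density_def)
      have J0: "?J s \<ge> 0" if "s > 0" for s
        unfolding set_lebesgue_integral_def using that c
        by (intro Bochner_Integration.integral_nonneg) (auto simp: indicator_def)
      have q0: "?q ?u j \<ge> 0" if "j \<in> {1..l}" for j
        using u[of j] that by simp
      have "(\<Prod>j = 1..l. ennreal (chi_density d (?u (j + 1)) (?u j))) = (\<Prod>j = 1..l. ennreal (?C * ?q ?u j))"
        by (intro prod.cong refl) (simp only: chi)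
      also have "\<dots> = ennreal (\<Prod>j = 1..l. ?C * ?q ?u j)"
        by (rule prod_ennreal) (intro mult_nonneg_nonneg q0 less_imp_le[OF C])
      also have "(\<Prod>j = 1..l. ?C * ?q ?u j) = ?C ^ l * (\<Prod>j = 1..l. ?q ?u j)"
        by (simp only: prod.distrib prod_constant card_atLeastAtMost diff_Suc_1)
      finally have "chain_integrand d b c l t x \<tau> = ennreal (?C ^ l * (\<Prod>j = 1..l. ?q ?u j)) * ennreal (1 / ?B * ?J (?u 1))"
        unfolding chain_integrand_def Let_def
        by (simp only: mixed_density_real[OF d b c u[of 1] x] atLeastAtMost_iff le_add2 le_refl simp_thms)
      also have "\<dots> = ennreal ((?C ^ l * (\<Prod>j = 1..l. ?q ?u j)) * (1 / ?B * ?J (?u 1)))"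
        using C B J0[OF u[of 1]] by (intro ennreal_mult[symmetric] mult_nonneg_nonneg prod_nonneg q0) auto
      also have "(?C ^ l * (\<Prod>j = 1..l. ?q ?u j)) * (1 / ?B * ?J (?u 1)) = K * ?f \<tau>"
        unfolding K_def Let_def by (simp only: mult_ac)
      finally have ch: "chain_integrand d b c l t x \<tau> = ennreal (K * ?f \<tau>)" .
      have f0: "?f \<tau> \<ge> 0"
        unfolding Let_def using J0[OF u[of 1]] by (intro mult_nonneg_nonneg prod_nonneg q0) auto
      have "enn2real (ennreal (K * ?f \<tau>)) = K * ?f \<tau>"
        by (rule enn2real_ennreal[OF mult_nonneg_nonneg[OF less_imp_le[OF K] f0]])
      moreover have "K \<noteq> 0" "indicator ?P \<tau> = (1 :: real)" using K True by simp_all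
      ultimately show ?thesis
        unfolding ch by (simp only: scaleR_one nonzero_mult_div_cancel_left ennreal_less_top infinity_ennreal_def simp_thms)
    next
      \<comment> \<open>Some coordinate is at most 0, so its chi density vanishes, in agreement with
        the indicator of the orthant.\<close>
      case False
      then obtain j where j: "j \<in> {1..l}" "\<tau> j \<le> 0"
        using \<tau> by (auto simp: space_PiM PiE_iff not_less)
      then have "(\<Prod>j = 1..l. ennreal (chi_density d (?u (j + 1)) (?u j))) = 0"
        by (intro prod_zero) (auto intro!: bexI[of _ j] simp: chi_density_def)
      then have "chain_integrand d b c l t x \<tau> = 0"
        unfolding chain_integrand_def Let_def by (simp only: mult_zero_left)
      then show ?thesis using False by simp
    qed
    then show "indicator ?P \<tau> *\<^sub>R ?f \<tau> = enn2real (chain_integrand d b c l t x \<tau>) / K"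
      and "chain_integrand d b c l t x \<tau> < \<infinity>" by auto
  qed
  have "(LINT \<tau>:?P|?M. ?f \<tau>) = (LINT \<tau>|?M. enn2real (chain_integrand d b c l t x \<tau>) / K)"
    unfolding set_lebesgue_integral_def[of ?M] by (intro Bochner_Integration.integral_cong refl eq)
  also have "\<dots> = (LINT \<tau>|?M. enn2real (chain_integrand d b c l t x \<tau>)) / K"
    by (rule integral_divide_zero)
  also have "(LINT \<tau>|?M. enn2real (chain_integrand d b c l t x \<tau>)) = enn2real (\<integral>\<^sup>+ \<tau>. ennreal (enn2real (chain_integrand d b c l t x \<tau>)) \<partial>?M)"
  proof (rule integral_eq_nn_integral)
    show "(\<lambda>\<tau>. enn2real (chain_integrand d b c l t x \<tau>)) \<in> borel_measurable ?M"
      by (rule borel_measurable_enn2real[OF chain_integrand_measurable])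
    show "AE \<tau> in ?M. 0 \<le> enn2real (chain_integrand d b c l t x \<tau>)" by (rule AE_I2) (rule enn2real_nonneg)
  qed
  also have "(\<integral>\<^sup>+ \<tau>. ennreal (enn2real (chain_integrand d b c l t x \<tau>)) \<partial>?M) = iter_density d b c l t x"
    unfolding iter_density_eq_chain
  proof (rule nn_integral_cong)
    fix \<tau> assume "\<tau> \<in> space ?M"
    then show "ennreal (enn2real (chain_integrand d b c l t x \<tau>)) = chain_integrand d b c l t x \<tau>"
      by (intro ennreal_enn2real chain_fin[unfolded infinity_ennreal_def])
  qed
  finally have "K * (LINT \<tau>:?P|?M. ?f \<tau>) = K * (enn2real (iter_density d b c l t x) / K)"
    by (rule arg_cong)
  also have "\<dots> = enn2real (iter_density d b c l t x)"
    using K by simp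
  finally have "ennreal (K * (LINT \<tau>:?P|?M. ?f \<tau>)) = ennreal (enn2real (iter_density d b c l t x))"
    by (rule arg_cong)
  also have "\<dots> = iter_density d b c l t x"
    by (rule ennreal_enn2real[OF fin[unfolded infinity_ennreal_def]])
  finally show ?thesis unfolding K_def by (rule sym)
qed

theorem theorem4p3:
  fixes M :: "'a measure"
    and S \<Theta> :: "nat \<Rightarrow> 'a \<Rightarrow> real"
    and B :: "nat \<Rightarrow> nat \<Rightarrow> real \<Rightarrow> 'a \<Rightarrow> real"
    and c rate t :: real
    and d l m n :: nat
  assumes "prob_space M"
    and "c > 0" and "rate > 0" and "t > 0"
    and "d \<ge> 1" and "l \<ge> 1" and "m \<in> {0, 1}" and "n \<ge> 1"
    and "v_index m n > real d / 2 - 1"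
    and "poisson_event_times M rate S"
    and "iid_angles M m \<Theta>"
    and "prob_space.indep_var M (path_space UNIV) (sample_path UNIV S) (path_space {1..}) (sample_path {1..} \<Theta>)"
    and "\<And>k i. k \<in> {1..l + 1} \<Longrightarrow> i \<in> {1..d} \<Longrightarrow> brownian_motion M (B k i)"
    and "prob_space.indep_vars M (\<lambda>_. path_space {0..}) (\<lambda>(k, i). sample_path {0..} (B k i))
           ({1..l + 1} \<times> {1..d})"
    and "indep_elements M
           (path_space UNIV \<Otimes>\<^sub>M path_space {1..}) (\<lambda>\<omega>. (sample_path UNIV S \<omega>, sample_path {1..} \<Theta> \<omega>))
           (path_space (({1..l + 1} \<times> {1..d}) \<times> {0..}))
           (sample_path (({1..l + 1} \<times> {1..d}) \<times> {0..}) (\<lambda>((k, i), s). B k i s))"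
  shows "law_at_time_given_count M (random_motion c S \<Theta>) (event_count S) n (iterated_bessel d B l t) =
    density lborel (\<lambda>x. ennreal (
      1 / Beta (real d / 2) (v_index m n - real d / 2 + 1)
      * (1 / (Gamma (real d / 2) * 2 powr (real d / 2 - 1)) ^ l)
      * (LINT \<tau>:(\<Pi>\<^sub>E j\<in>{1..l}. {0<..})|(\<Pi>\<^sub>M j\<in>{1..l}. lborel).
           (let u = \<tau>(l + 1 := t) in
             (\<Prod>j = 1..l. u j ^ (d - 1) * exp (- (u j)\<^sup>2 / (2 * u (j + 1)))
                           / u (j + 1) powr (real d / 2))
             * (LBINT w:{0<..<1}.
                  w powr (real d / 2 - 1) * (1 - w) powr (v_index m n - real d / 2)
                  * (exp (- x\<^sup>2 / (2 * c\<^sup>2 * u 1 * w)) / (sqrt (2 * pi * u 1 * w) * c)))))))"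
proof -
  interpret M: prob_space M by fact
  interpret motion M rate c S \<Theta> m n
    by unfold_locales (use assms in auto)
  define b where "b = v_index m n - real d / 2 + 1"
  have b: "b > 0" using assms by (simp add: b_def)
  have b1: "v_index m n - real d / 2 = b - 1" by (simp add: b_def)
  let ?T = "iterated_bessel d B l t"
  \<comment> \<open>Path continuity gives joint measurability, which makes the nested process at
    time t a random variable.\<close>
  have "(\<lambda>(s, \<omega>). bessel d (B k) (max 0 s) \<omega>) \<in> borel_measurable (borel \<Otimes>\<^sub>M M)" if k: "k \<in> {1..l + 1}" for k
  proof -
    have "(\<lambda>(s, \<omega>). B k i (max 0 s) \<omega>) \<in> borel_measurable (borel \<Otimes>\<^sub>M M)" if "i \<in> {1..d}" for i
      using assms(13)[OF k that] by (intro continuous_process_measurable) (auto simp: brownian_motion_def)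
    then show ?thesis unfolding bessel_def case_prod_beta' by measurable
  qed
  then have "(\<lambda>(s, \<omega>). iterated_bessel d B l (max 0 s) \<omega>) \<in> borel_measurable (borel \<Otimes>\<^sub>M M)"
    by (rule iterated_bessel_measurable)
  from measurable_compose[OF measurable_Pair1' this, of t] \<open>t > 0\<close>
  have T[measurable]: "?T \<in> borel_measurable M" by simp
  have law_meas[measurable]: "(\<lambda>s. emeasure (law s) A) \<in> borel_measurable borel" if "A \<in> sets borel" for A
    by (rule measurable_emeasure_kernel[OF law_kernel that])
  have at_T: "(\<integral>\<^sup>+ \<omega>. emeasure (law (?T \<omega>)) A \<partial>M) = (\<integral>\<^sup>+ x. iter_density d b c l t x * indicator A x \<partial>lborel)"
    if A: "A \<in> sets borel" for A
  proof -
    have "(\<integral>\<^sup>+ \<omega>. emeasure (law (?T \<omega>)) A \<partial>M) = iter_chi d l (\<lambda>s. emeasure (law s) A) t"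
      by (rule M.nn_integral_iterated_bessel[where L = l]) (use assms A in auto)
    also have "\<dots> = (\<integral>\<^sup>+ x. iter_density d b c l t x * indicator A x \<partial>lborel)"
      unfolding b_def by (rule iter_chi_law) (use assms A in auto)
    finally show ?thesis .
  qed
  let ?L = "law_at_time_given_count M (random_motion c S \<Theta>) (event_count S) n ?T"
  have kernel: "law \<in> measurable (distr M borel ?T) (subprob_algebra borel)"
    using law_kernel by (simp cong: measurable_cong_sets)
  have "?L = density lborel (\<lambda>x. iter_density d b c l t x)"
  proof (rule measure_eqI)
    show sets: "sets ?L = sets (density lborel (\<lambda>x. iter_density d b c l t x))"
      unfolding law_at_time_given_count_def
      by (subst sets_bind[where N = borel]) (auto simp: law_given_count_def)
    fix A assume "A \<in> sets ?L"
    then have A[measurable]: "A \<in> sets borel" using sets by simp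
    have "emeasure ?L A = (\<integral>\<^sup>+ s. emeasure (law s) A \<partial>distr M borel ?T)"
      unfolding law_at_time_given_count_def by (rule emeasure_bind[OF _ kernel A]) simp
    also have "\<dots> = (\<integral>\<^sup>+ \<omega>. emeasure (law (?T \<omega>)) A \<partial>M)"
      by (rule nn_integral_distr) (use law_meas[OF A] in auto)
    also have "\<dots> = emeasure (density lborel (\<lambda>x. iter_density d b c l t x)) A"
      unfolding at_T[OF A] by (simp add: emeasure_density)
    finally show "emeasure ?L A = emeasure (density lborel (\<lambda>x. iter_density d b c l t x)) A" .
  qed
  also have "\<dots> = density lborel (\<lambda>x. ennreal (1 / Beta (real d / 2) b
    * (1 / (Gamma (real d / 2) * 2 powr (real d / 2 - 1))) ^ l
    * (LINT \<tau>:(\<Pi>\<^sub>E j\<in>{1..l}. {0<..})|(\<Pi>\<^sub>M j\<in>{1..l}. lborel).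
         (let u = \<tau>(l + 1 := t) in
           (\<Prod>j = 1..l. u j ^ (d - 1) * exp (- (u j)\<^sup>2 / (2 * u (j + 1))) / u (j + 1) powr (real d / 2))
           * (LBINT w:{0<..<1}. w powr (real d / 2 - 1) * (1 - w) powr (b - 1)
                * (exp (- x\<^sup>2 / (2 * c\<^sup>2 * u 1 * w)) / (sqrt (2 * pi * u 1 * w) * c)))))))"
    (is "_ = density lborel (\<lambda>x. ennreal (?g x))")
  proof -
    \<comment> \<open>The candidate density has total mass at most 1, because each
      \<open>law s\<close> is a subprobability measure; it is therefore finite almost
      everywhere.\<close>
    have "(\<integral>\<^sup>+ x. iter_density d b c l t x \<partial>lborel) = (\<integral>\<^sup>+ \<omega>. emeasure (law (?T \<omega>)) UNIV \<partial>M)"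
      by (simp add: at_T)
    also have "\<dots> \<le> (\<integral>\<^sup>+ \<omega>. 1 \<partial>M)"
      using law_kernel by (intro nn_integral_mono subprob_space.subprob_emeasure_le_1) (auto dest: subprob_space_kernel)
    finally have "(\<integral>\<^sup>+ x. iter_density d b c l t x \<partial>lborel) \<noteq> \<infinity>"
      by (auto simp: M.emeasure_space_1 top_unique)
    then have "AE x in lborel. iter_density d b c l t x \<noteq> \<infinity>"
      by (intro nn_integral_PInf_AE) auto
    moreover have "AE x in lborel. x \<noteq> (0 :: real)" by (rule AE_lborel_singleton)
    ultimately have ae: "AE x in lborel. iter_density d b c l t x = ennreal (?g x)"
      by eventually_elim (rule iter_density_real, use assms b in \<open>auto simp: less_top\<close>)
    show ?thesis
      \<comment> \<open>This reduces the claim to integrals of functions equal almost everywhere, a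
        comparison that asks for no measurability of \<open>?g\<close>.\<close>
      unfolding density_def
    proof (intro arg_cong[where f = "measure_of _ _"] ext nn_integral_cong_AE)
      show "AE x in lborel. iter_density d b c l t x * indicator A x = ennreal (?g x) * indicator A x" for A
        using ae by eventually_elim (simp only:)
    qed
  qed
  finally show ?thesis unfolding b1[symmetric] power_one_over unfolding b_def .
qed

end
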